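(* Let $\beta > 1$ and let $\Omega_\beta \subset \mathbb{C}$ be an inward cusp domain of degree $\beta$. Then there is a homeomorphism $\varphi \colon \partial \mathbb{D} \to \partial \Omega_\beta$ (onto) which satisfies the Douglas condition (and hence admits a continuous extension to $\overline{\mathbb{D}}$ in $W^{1,2}(\mathbb{D},\mathbb{C})$), but which does not admit a homeomorphic extension $h \colon \overline{\mathbb{D}} \to \overline{\Omega_\beta}$ (onto) in the Sobolev class $W^{1,2}(\mathbb{D}, \mathbb{C})$.
   Context: $\mathbb{D} \subset \mathbb{C}$ is the open unit disk. A Jordan domain is the bounded component of the complement of a Jordan curve in $\mathbb{C}$. For $\beta>1$, an inward cusp domain $\Omega_\beta$ is a bounded Jordan domain whose boundary is a smooth curve except at one point, taken to be the origin, near which (after a rigid motion) the complement of $\Omega_\beta$ coincides with the cusp region $\{(x,y)\in\mathbb{R}^2 : x \ge 0,\ |y| \le x^\beta\}$; that is, the exterior of the domain has a cusp of degree $\beta$ pointing into the domain. A map $\varphi \colon \partial \mathbb{D} \to \mathbb{C}$ satisfies the Douglas condition if $$\int_{\partial \mathbb{D}} \int_{\partial \mathbb{D}} \frac{|\varphi(x)-\varphi(y)|^2}{|x-y|^2}\, dx\, dy < \infty,$$ where $dx, dy$ denote integration with respect to arclength. *)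

theory Defs
  imports "HOL-Analysis.Analysis"
begin

(* Meant for open S; C^k there, because all directional derivatives are required to be C^(k-1)
   and a differentiable function is continuous. *)
primrec Ck_on :: "nat \<Rightarrow> 'a::euclidean_space set \<Rightarrow> ('a \<Rightarrow> 'b::real_normed_vector) \<Rightarrow> bool" where
  "Ck_on 0 S f \<longleftrightarrow> continuous_on S f"
| "Ck_on (Suc k) S f \<longleftrightarrow>
     (\<forall>x\<in>S. f differentiable (at x)) \<and>
     (\<forall>v. Ck_on k S (\<lambda>x. frechet_derivative f (at x) v))"

definition smooth_on :: "'a::euclidean_space set \<Rightarrow> ('a \<Rightarrow> 'b::real_normed_vector) \<Rightarrow> bool" where
  "smooth_on S f \<longleftrightarrow> (\<forall>k. Ck_on k S f)"

definition jordan_domain :: "complex set \<Rightarrow> bool" where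
  "jordan_domain \<Omega> \<longleftrightarrow>
     (\<exists>\<gamma>. simple_path \<gamma> \<and> pathfinish \<gamma> = pathstart \<gamma> \<and>
          \<Omega> \<in> components (- path_image \<gamma>) \<and> bounded \<Omega>)"

definition cusp_region :: "real \<Rightarrow> complex set" where
  "cusp_region \<beta> = {z. 0 \<le> Re z \<and> \<bar>Im z\<bar> \<le> Re z powr \<beta>}"

(* A regular injective parametrization over an open interval. For a Jordan curve J and p in J,
   the set J - {p} is an open arc, so an injective parametrization of it is automatically a
   homeomorphism, and the condition says that J - {p} is an embedded smooth curve. *)
definition smooth_curve_except_at :: "complex set \<Rightarrow> complex \<Rightarrow> bool" where
  "smooth_curve_except_at J p \<longleftrightarrow>
     (\<exists>\<gamma> :: real \<Rightarrow> complex.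
        smooth_on {0<..<1} \<gamma> \<and>
        (\<forall>t\<in>{0<..<1}. vector_derivative \<gamma> (at t) \<noteq> 0) \<and>
        inj_on \<gamma> {0<..<1} \<and>
        \<gamma> ` {0<..<1} = J - {p})"

(* The map z |-> p + u * z with |u| = 1 is the inverse of the rigid motion bringing the cusp to
   standard position, with the exceptional point p at the origin. Reflections are not needed,
   since the cusp region is symmetric about the real axis. *)
definition inward_cusp_domain :: "real \<Rightarrow> complex set \<Rightarrow> bool" where
  "inward_cusp_domain \<beta> \<Omega> \<longleftrightarrow>
     jordan_domain \<Omega> \<and>
     (\<exists>p\<in>frontier \<Omega>.
        smooth_curve_except_at (frontier \<Omega>) p \<and>
        (\<exists>u r. norm u = 1 \<and> r > 0 \<and>
           (- \<Omega>) \<inter> ball p r = ((\<lambda>z. p + u * z) ` cusp_region \<beta>) \<inter> ball p r))"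

definition circle_arclength :: "complex measure" where
  "circle_arclength =
     distr (restrict_space lborel {0..<2 * pi}) (restrict_space borel (sphere 0 1)) cis"

(* On the diagonal, a null set for the product measure, the integrand is 0 / 0 = 0. *)
definition douglas_condition :: "(complex \<Rightarrow> complex) \<Rightarrow> bool" where
  "douglas_condition \<phi> \<longleftrightarrow>
     (\<integral>\<^sup>+ x. (\<integral>\<^sup>+ y. ennreal ((norm (\<phi> x - \<phi> y))\<^sup>2 / (norm (x - y))\<^sup>2)
        \<partial>circle_arclength) \<partial>circle_arclength) < \<infinity>"

definition L2_on :: "complex set \<Rightarrow> (complex \<Rightarrow> complex) \<Rightarrow> bool" where
  "L2_on U f \<longleftrightarrow>
     set_borel_measurable lebesgue U f \<and> set_integrable lebesgue U (\<lambda>z. (norm (f z))\<^sup>2)"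

definition test_function :: "complex set \<Rightarrow> (complex \<Rightarrow> real) \<Rightarrow> bool" where
  "test_function U \<eta> \<longleftrightarrow>
     smooth_on UNIV \<eta> \<and> compact (closure {z. \<eta> z \<noteq> 0}) \<and> closure {z. \<eta> z \<noteq> 0} \<subseteq> U"

(* Only used for f and g in L^2, where both integrands are integrable. *)
definition weak_directional_deriv ::
    "complex set \<Rightarrow> complex \<Rightarrow> (complex \<Rightarrow> complex) \<Rightarrow> (complex \<Rightarrow> complex) \<Rightarrow> bool" where
  "weak_directional_deriv U v f g \<longleftrightarrow>
     (\<forall>\<eta>. test_function U \<eta> \<longrightarrow>
        set_lebesgue_integral lebesgue U (\<lambda>z. frechet_derivative \<eta> (at z) v *\<^sub>R f z) =
        - set_lebesgue_integral lebesgue U (\<lambda>z. \<eta> z *\<^sub>R g z))"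

(* The Sobolev space of complex-valued functions of two real variables: the directions 1 and \<i>
   are the x- and y-directions. *)
definition W12_on :: "complex set \<Rightarrow> (complex \<Rightarrow> complex) \<Rightarrow> bool" where
  "W12_on U f \<longleftrightarrow>
     L2_on U f \<and> (\<forall>v\<in>{1, \<i>}. \<exists>g. L2_on U g \<and> weak_directional_deriv U v f g)"

end

theory Submission
  imports Defs
begin

text \<open>
Near the tip of the cusp the boundary consists of two branches, and the points of the two branches with
abscissa \<open>x\<close> are only \<open>2 x\<^sup>\<beta>\<close> apart, although inside the domain they are separated by the cusp:
every path in the closed domain from one to the other has to move by at least \<open>x\<close>. The
homeomorphism \<open>\<phi>\<close> exploits this gap. It sends the two points of the circle at distance \<open>\<rho>\<close> from \<open>1\<close> to
the two boundary points with abscissa \<open>a(\<rho>) = (K - ln \<rho>)\<^sup>-\<^sup>1\<^sup>/\<^sup>2\<close>, and the rest of the circle in a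
Lipschitz way to the rest of the boundary.

The Douglas integral and the energy of a suitable extension are finite. Write \<open>L = K - ln \<rho>\<close>. The
abscissa varies at scale \<open>\<rho>\<close> by \<open>L\<^sup>-\<^sup>3\<^sup>/\<^sup>2\<close>, and the ordinate, which changes sign between the branches,
by \<open>L\<^sup>-\<^sup>\<beta>\<^sup>/\<^sup>2\<close>. The energy at scale \<open>\<rho>\<close> is therefore at most a multiple of \<open>L\<^sup>-\<^sup>b d\<rho> / \<rho>\<close> with
\<open>b = min 3 \<beta>\<close>, which is integrable at \<open>0\<close> because \<open>b > 1\<close>. All of this is extracted from the single
estimate \<open>cusp_param_diff_le\<close>: it gives the Douglas condition in \<open>ext_douglas\<close>, and the bound on the
gradient in \<open>ext_W12\<close>. The extension is differentiable off finitely many lines, and such a function has its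
pointwise gradient as weak gradient (\<open>weak_directional_derivI\<close>).

A homeomorphic extension \<open>h\<close> has infinite energy. The three sides inside the disc of the square with centre
\<open>1\<close> and half-side \<open>s\<close> form a path of length at most \<open>4 s\<close> between points that \<open>h\<close> maps to different
branches, at an abscissa of at least \<open>a(s)\<close>. Its image moves by at least \<open>a(s)\<close>
(\<open>square_path_escapes\<close>), so by the Cauchy-Schwarz inequality its share of the energy is at least a
constant times \<open>a(s)\<^sup>2 / s = 1 / (s (K - ln s))\<close>. Since these paths sweep out a part of the disc, the
energy dominates the divergent integral of that function (\<open>no_sobolev_extension\<close>). Squares are
used because their sides are parallel to the axes, so that the two weak partial derivatives suffice. As
these exist only in the weak sense, the estimate is made for mollifications of \<open>h\<close>, whose increments along
lines are controlled by testing with an explicit bump (\<open>moll_increment_le\<close>), with bounds that do not depend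
on the mollification.

That the boundary off the tip can be parametrized by one Lipschitz arc joining the two branches
is \<open>complementary_arc\<close>; it uses that the boundary is a Jordan curve.
\<close>

section \<open>Fubini along coordinate lines\<close>

text \<open>The coordinate directions in either order, so that horizontal and vertical lines are treated by the
same argument.\<close>

definition axis_frame :: "complex \<Rightarrow> complex \<Rightarrow> bool" where
  "axis_frame v w \<longleftrightarrow> (v = 1 \<and> w = \<i>) \<or> (v = \<i> \<and> w = 1)"

lemma axis_frameE:
  assumes "v \<in> {1, \<i>}"
  obtains w where "axis_frame v w"
  using assms by (auto simp: axis_frame_def)

lemma axis_frame_inner:
  assumes "axis_frame v w"
  shows "(s *\<^sub>R v + t *\<^sub>R w) \<bullet> v = s" "(s *\<^sub>R v + t *\<^sub>R w) \<bullet> w = t"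
    "v \<bullet> v = 1" "w \<bullet> w = 1" "v \<bullet> w = 0" "w \<bullet> v = 0" "norm v = 1" "norm w = 1"
  using assms by (auto simp: axis_frame_def inner_complex_def)

lemma axis_frame_decomp:
  assumes "axis_frame v w"
  shows "(z \<bullet> v) *\<^sub>R v + (z \<bullet> w) *\<^sub>R w = z"
  using assms by (auto simp: axis_frame_def inner_complex_def complex_eq_iff)

lemma lborel_axis_frame:
  assumes "axis_frame v w"
  shows "distr (lborel \<Otimes>\<^sub>M lborel) borel (\<lambda>(s::real, t::real). s *\<^sub>R v + t *\<^sub>R w) = lborel"
proof (rule sym, rule lborel_eqI)
  fix l u :: complex
  assume le: "\<And>b. b \<in> Basis \<Longrightarrow> l \<bullet> b \<le> u \<bullet> b"
  have le': "Re l \<le> Re u" "Im l \<le> Im u"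
    using le[of 1] le[of \<i>] by (auto simp: inner_complex_def Basis_complex_def)
  have vimage: "(\<lambda>(s::real, t::real). s *\<^sub>R v + t *\<^sub>R w) -` box l u
      = {l \<bullet> v<..<u \<bullet> v} \<times> {l \<bullet> w<..<u \<bullet> w}"
    using assms by (auto simp: axis_frame_def inner_complex_def mem_box Basis_complex_def)
  have "emeasure (distr (lborel \<Otimes>\<^sub>M lborel) borel (\<lambda>(s::real, t::real). s *\<^sub>R v + t *\<^sub>R w)) (box l u)
      = emeasure (lborel \<Otimes>\<^sub>M lborel) ({l \<bullet> v<..<u \<bullet> v} \<times> {l \<bullet> w<..<u \<bullet> w})"
    by (subst emeasure_distr) (auto simp: vimage space_pair_measure)
  also have "\<dots> = emeasure lborel {l \<bullet> v<..<u \<bullet> v} * emeasure lborel {l \<bullet> w<..<u \<bullet> w}"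
    by (intro lborel.emeasure_pair_measure_Times) auto
  also have "\<dots> = ennreal ((u \<bullet> v - l \<bullet> v) * (u \<bullet> w - l \<bullet> w))"
    using assms le' by (subst ennreal_mult) (auto simp: axis_frame_def inner_complex_def)
  also have "\<dots> = (\<Prod>b\<in>Basis. (u - l) \<bullet> b)"
    using assms le'
    by (auto simp: axis_frame_def inner_complex_def Basis_complex_def prod_ennreal[symmetric])
  finally show "emeasure (distr (lborel \<Otimes>\<^sub>M lborel) borel (\<lambda>(s::real, t::real). s *\<^sub>R v + t *\<^sub>R w)) (box l u)
      = (\<Prod>b\<in>Basis. (u - l) \<bullet> b)" .
qed simp

lemma nn_integral_axis_frame:
  assumes fr: "axis_frame v w" and [measurable]: "F \<in> borel_measurable borel"
  shows "(\<integral>\<^sup>+z. F z \<partial>lborel) = (\<integral>\<^sup>+t. \<integral>\<^sup>+s. F (s *\<^sub>R v + t *\<^sub>R w) \<partial>lborel \<partial>lborel)"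
proof -
  have "(\<integral>\<^sup>+z. F z \<partial>lborel)
      = (\<integral>\<^sup>+p. F ((\<lambda>(s, t). s *\<^sub>R v + t *\<^sub>R w) p) \<partial>(lborel \<Otimes>\<^sub>M lborel))"
    by (subst lborel_axis_frame[OF fr, symmetric], subst nn_integral_distr) auto
  also have "\<dots> = (\<integral>\<^sup>+t. \<integral>\<^sup>+s. F (s *\<^sub>R v + t *\<^sub>R w) \<partial>lborel \<partial>lborel)"
    by (subst lborel_pair.nn_integral_snd[symmetric]) auto
  finally show ?thesis .
qed

lemma integral_axis_frame:
  fixes F :: "complex \<Rightarrow> 'a::{banach, second_countable_topology}"
  assumes fr: "axis_frame v w" and int: "integrable lborel F"
  shows "AE t in lborel. integrable lborel (\<lambda>s. F (s *\<^sub>R v + t *\<^sub>R w))"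
    and "(\<integral>z. F z \<partial>lborel) = (\<integral>t. \<integral>s. F (s *\<^sub>R v + t *\<^sub>R w) \<partial>lborel \<partial>lborel)"
proof -
  have [measurable]: "F \<in> borel_measurable borel"
    using borel_measurable_integrable[OF int] by simp
  have int2: "integrable (lborel \<Otimes>\<^sub>M lborel) (\<lambda>(s, t). F (s *\<^sub>R v + t *\<^sub>R w))"
    using int by (subst (asm) lborel_axis_frame[OF fr, symmetric], subst (asm) integrable_distr_eq)
       (auto simp: case_prod_unfold)
  show "AE t in lborel. integrable lborel (\<lambda>s. F (s *\<^sub>R v + t *\<^sub>R w))"
    using lborel_pair.AE_integrable_snd[of "\<lambda>s t. F (s *\<^sub>R v + t *\<^sub>R w)"] int2 by simp
  have "(\<integral>z. F z \<partial>lborel)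
      = (\<integral>p. F ((\<lambda>(s, t). s *\<^sub>R v + t *\<^sub>R w) p) \<partial>(lborel \<Otimes>\<^sub>M lborel))"
    by (subst lborel_axis_frame[OF fr, symmetric], subst integral_distr) auto
  also have "\<dots> = (\<integral>t. \<integral>s. F (s *\<^sub>R v + t *\<^sub>R w) \<partial>lborel \<partial>lborel)"
    using lborel_pair.integral_snd[of "\<lambda>s t. F (s *\<^sub>R v + t *\<^sub>R w)"] int2
    by (simp add: case_prod_unfold)
  finally show "(\<integral>z. F z \<partial>lborel) = (\<integral>t. \<integral>s. F (s *\<^sub>R v + t *\<^sub>R w) \<partial>lborel \<partial>lborel)" .
qed

section \<open>Weak derivatives of line-differentiable functions\<close>

lemma smooth_on_directional_derivative:
  fixes \<eta> :: "complex \<Rightarrow> real"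
  assumes "smooth_on UNIV \<eta>"
  shows "continuous_on UNIV \<eta>"
    and "continuous_on UNIV (\<lambda>z. frechet_derivative \<eta> (at z) v)"
    and "((\<lambda>s. \<eta> (z + s *\<^sub>R v)) has_vector_derivative frechet_derivative \<eta> (at z) v) (at 0)"
proof -
  have Ck: "Ck_on k UNIV \<eta>" for k
    using assms by (simp add: smooth_on_def)
  show "continuous_on UNIV \<eta>" using Ck[of 0] by simp
  show "continuous_on UNIV (\<lambda>z. frechet_derivative \<eta> (at z) v)" using Ck[of "Suc 0"] by simp
  have "\<eta> differentiable at z" using Ck[of "Suc 0"] by simp
  then have d: "(\<eta> has_derivative frechet_derivative \<eta> (at z)) (at (z + 0 *\<^sub>R v))"
    by (simp add: frechet_derivative_works)
  have "((\<lambda>s. z + s *\<^sub>R v) has_derivative (\<lambda>s. s *\<^sub>R v)) (at 0)"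
    by (auto intro!: derivative_eq_intros)
  from diff_chain_at[OF this d]
  have "((\<lambda>s. \<eta> (z + s *\<^sub>R v)) has_derivative (\<lambda>s. frechet_derivative \<eta> (at z) (s *\<^sub>R v))) (at 0)"
    by (simp add: o_def)
  moreover have "linear (frechet_derivative \<eta> (at z))"
    using d has_derivative_linear by blast
  ultimately show "((\<lambda>s. \<eta> (z + s *\<^sub>R v)) has_vector_derivative frechet_derivative \<eta> (at z) v) (at 0)"
    by (simp add: has_vector_derivative_def linear_cmul)
qed

lemma has_vector_derivative_line:
  fixes f :: "complex \<Rightarrow> 'b::real_normed_vector"
  assumes "((\<lambda>s. f ((s0 *\<^sub>R v + q) + s *\<^sub>R v)) has_vector_derivative f') (at 0)"
  shows "((\<lambda>s. f (s *\<^sub>R v + q)) has_vector_derivative f') (at s0)"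
proof -
  have "((\<lambda>s. s - s0) has_vector_derivative 1) (at s0)"
    by (auto intro!: derivative_eq_intros)
  from vector_diff_chain_at[OF this, of "\<lambda>s. f ((s0 *\<^sub>R v + q) + s *\<^sub>R v)" f'] assms
  show ?thesis by (simp add: o_def algebra_simps)
qed

lemma open_line:
  fixes z v :: complex
  assumes "open S"
  shows "open {s::real. z + s *\<^sub>R v \<in> S}"
proof -
  have "open ((\<lambda>s. z + s *\<^sub>R v) -` S)"
    using assms by (rule open_vimage) (intro continuous_intros)
  then show ?thesis by (simp add: vimage_def)
qed

text \<open>On almost every line in direction \<open>v\<close> the product of \<open>f\<close> with a test function is continuous with compact
support and differentiable off a finite set, so by the fundamental theorem of calculus its derivative has
integral zero on that line; the theorem of Fubini gives integration by parts. The set \<open>S\<close> of exceptional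
coordinates lets \<open>f\<close> be glued from smooth pieces along lines parallel to the axes.\<close>

lemma weak_directional_derivI:
  assumes fr: "axis_frame v w" and fin: "finite S"
    and cont: "continuous_on (cball 0 1) f"
    and intg: "integrable lborel (\<lambda>z. indicator (ball 0 1) z *\<^sub>R g z)"
    and der: "\<And>z. z \<in> ball 0 1 \<Longrightarrow> z \<bullet> v \<notin> S \<Longrightarrow>
        z \<bullet> w \<notin> S \<Longrightarrow> ((\<lambda>s. f (z + s *\<^sub>R v)) has_vector_derivative g z) (at 0)"
  shows "weak_directional_deriv (ball 0 1) v f g"
  unfolding weak_directional_deriv_def
proof (intro allI impI)
  fix \<eta> assume \<eta>: "test_function (ball 0 1) \<eta>"
  let ?U = "ball 0 1 :: complex set"
  define K where "K = closure {z. \<eta> z \<noteq> 0}"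
  define D where "D = (\<lambda>z. frechet_derivative \<eta> (at z) v)"
  have sm: "smooth_on UNIV \<eta>" and KU: "K \<subseteq> ?U"
    using \<eta> by (auto simp: test_function_def K_def)
  note smd = smooth_on_directional_derivative[OF sm]
  have \<eta>0: "\<eta> z = 0" if "z \<notin> K" for z
    using that closure_subset[of "{z. \<eta> z \<noteq> 0}"] by (auto simp: K_def)
  have opK: "open (- K)" by (simp add: K_def open_Compl)
  \<comment> \<open>Extension by zero of the product; its derivative along \<open>v\<close> is \<open>T\<close> also at the boundary of the disc,
    because the test function vanishes near that boundary.\<close>
  define P where "P = (\<lambda>z. if z \<in> ?U then \<eta> z *\<^sub>R f z else 0)"
  define T where "T = (\<lambda>z. indicator ?U z *\<^sub>R (D z *\<^sub>R f z) + indicator ?U z *\<^sub>R (\<eta> z *\<^sub>R g z))"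
  have contf: "continuous_on ?U f"
    using cont by (rule continuous_on_subset) auto
  have contD: "continuous_on UNIV D" using smd(2) by (simp add: D_def)
  have "set_integrable lborel (cball 0 1) (\<lambda>z. D z *\<^sub>R f z)"
    unfolding set_integrable_def
    by (rule borel_integrable_compact)
       (auto intro!: continuous_intros cont continuous_on_subset[OF contD])
  then have int1: "integrable lborel (\<lambda>z. indicator ?U z *\<^sub>R (D z *\<^sub>R f z))"
    using set_integrable_subset[of lborel "cball 0 1" "\<lambda>z. D z *\<^sub>R f z" ?U]
    by (simp only: set_integrable_def[symmetric]) auto
  have "bounded (\<eta> ` cball 0 1)"
    by (intro compact_imp_bounded compact_continuous_image continuous_on_subset[OF smd(1)]) auto
  then obtain B where "\<forall>z\<in>cball 0 1. norm (\<eta> z) \<le> B"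
    unfolding bounded_iff by blast
  then have B: "norm (\<eta> z) \<le> B" if "z \<in> cball 0 1" for z using that by blast
  have [measurable]: "\<eta> \<in> borel_measurable borel"
    using smd(1) by (rule borel_measurable_continuous_onI)
  have [measurable]: "(\<lambda>z. indicator ?U z *\<^sub>R g z) \<in> borel_measurable borel"
    using intg by (auto dest: borel_measurable_integrable)
  have int2: "integrable lborel (\<lambda>z. indicator ?U z *\<^sub>R (\<eta> z *\<^sub>R g z))"
  proof (rule Bochner_Integration.integrable_bound)
    show "integrable lborel (\<lambda>z. B *\<^sub>R (indicator ?U z *\<^sub>R g z))"
      using intg by (rule integrable_scaleR_right)
    have "(\<lambda>z. \<eta> z *\<^sub>R (indicator ?U z *\<^sub>R g z)) \<in> borel_measurable lborel"
      by measurable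
    then show "(\<lambda>z. indicator ?U z *\<^sub>R (\<eta> z *\<^sub>R g z)) \<in> borel_measurable lborel"
      by (simp add: mult.commute)
    have "norm (\<eta> z) \<le> \<bar>B\<bar>" if "z \<in> ?U" for z using B[of z] that by auto
    then show "AE z in lborel. norm (indicator ?U z *\<^sub>R (\<eta> z *\<^sub>R g z)) \<le> norm (B *\<^sub>R (indicator ?U z *\<^sub>R g z))"
      by (auto simp: indicator_def intro!: AE_I2 mult_right_mono)
  qed
  have intT: "integrable lborel T"
    unfolding T_def using int1 int2 by auto
  have derP: "((\<lambda>s. P (z + s *\<^sub>R v)) has_vector_derivative T z) (at 0)" if "z \<bullet> v \<notin> S" "z \<bullet> w \<notin> S" for z
  proof (cases "z \<in> ?U")
    case True
    have prod: "((\<lambda>s. \<eta> (z + s *\<^sub>R v) *\<^sub>R f (z + s *\<^sub>R v)) has_vector_derivative T z) (at 0)"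
      using has_vector_derivative_scaleR[OF smd(3)[of z v, unfolded has_real_derivative_iff_has_vector_derivative[symmetric]] der[OF True that]] True
      by (simp add: T_def D_def add.commute)
    show ?thesis
    proof (rule has_vector_derivative_transform_within_open[OF prod])
      show "open {s. z + s *\<^sub>R v \<in> ?U}" by (rule open_line) auto
    qed (use True in \<open>auto simp: P_def\<close>)
  next
    case False
    then have "z \<in> - K" using KU by auto
    have zero: "((\<lambda>s. 0) has_vector_derivative T z) (at (0::real))"
      using False by (simp add: T_def)
    show ?thesis
    proof (rule has_vector_derivative_transform_within_open[OF zero])
      show "open {s. z + s *\<^sub>R v \<in> - K}" using opK by (rule open_line)
    qed (use \<open>z \<in> - K\<close> in \<open>auto simp: P_def \<eta>0\<close>)
  qed
  have contP: "isCont P z" for z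
  proof (cases "z \<in> ?U")
    case True
    have "isCont (\<lambda>z. \<eta> z *\<^sub>R f z) z"
      using True contf smd(1) by (auto intro!: continuous_intros simp: continuous_on_eq_continuous_at)
    moreover have "\<forall>\<^sub>F z in nhds z. P z = \<eta> z *\<^sub>R f z"
      using eventually_nhds_in_open[of ?U z] True by (auto simp: P_def elim!: eventually_mono)
    ultimately show ?thesis using isCont_cong[of P "\<lambda>z. \<eta> z *\<^sub>R f z" z] by simp
  next
    case False
    then have "z \<in> - K" using KU by auto
    then have "\<forall>\<^sub>F z in nhds z. z \<in> - K" using opK by (intro eventually_nhds_in_open)
    then have "\<forall>\<^sub>F z in nhds z. P z = 0" by eventually_elim (simp add: P_def \<eta>0)
    then show ?thesis using isCont_cong[of P "\<lambda>_. 0" z] by auto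
  qed
  have line: "(\<integral>s. T (s *\<^sub>R v + t *\<^sub>R w) \<partial>lborel) = 0"
    if it: "integrable lborel (\<lambda>s. T (s *\<^sub>R v + t *\<^sub>R w))" and tS: "t \<notin> S" for t
  proof -
    let ?T = "\<lambda>s. T (s *\<^sub>R v + t *\<^sub>R w)" and ?P = "\<lambda>s. P (s *\<^sub>R v + t *\<^sub>R w)"
    have out: "s *\<^sub>R v + t *\<^sub>R w \<notin> ?U" if "\<bar>s\<bar> \<ge> 2" for s
    proof
      assume "s *\<^sub>R v + t *\<^sub>R w \<in> ?U"
      then have "\<bar>(s *\<^sub>R v + t *\<^sub>R w) \<bullet> v\<bar> < 1"
        using Cauchy_Schwarz_ineq2[of "s *\<^sub>R v + t *\<^sub>R w" v] axis_frame_inner(7)[OF fr] by auto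
      then show False using that axis_frame_inner(1)[OF fr] by simp
    qed
    have "(?T has_integral (?P 2 - ?P (-2))) {-2..2}"
    proof (rule fundamental_theorem_of_calculus_strong[OF fin])
      show "continuous_on {-2..2} ?P"
        by (intro continuous_at_imp_continuous_on ballI continuous_within_compose3[OF contP] continuous_intros)
      show "(?P has_vector_derivative ?T s) (at s)" if "s \<in> {-2..2} - S" for s
        by (rule has_vector_derivative_line, rule derP)
           (use that tS axis_frame_inner(1,2)[OF fr] in auto)
    qed auto
    then have "integral {-2..2} ?T = 0"
      using out[of 2] out[of "-2"] by (simp add: P_def integral_unique)
    moreover have "set_integrable lborel {-2..2} ?T"
      using it unfolding set_integrable_def by (rule integrable_mult_indicator[rotated]) simp
    ultimately have "(LBINT s:{-2..2}. ?T s) = 0"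
      by (simp add: set_borel_integral_eq_integral)
    moreover have "indicator {-2..2} s *\<^sub>R ?T s = ?T s" for s
      using out[of s] by (auto simp: indicator_def T_def)
    ultimately show ?thesis by (simp add: set_lebesgue_integral_def)
  qed
  have "(\<integral>z. T z \<partial>lborel) = (\<integral>t. \<integral>s. T (s *\<^sub>R v + t *\<^sub>R w) \<partial>lborel \<partial>lborel)"
    by (rule integral_axis_frame(2)[OF fr intT])
  also have "\<dots> = (integral\<^sup>L lborel (\<lambda>t::real. 0))"
  proof (rule integral_cong_AE)
    show "(\<lambda>t. \<integral>s. T (s *\<^sub>R v + t *\<^sub>R w) \<partial>lborel) \<in> borel_measurable lborel"
      using borel_measurable_integrable[OF intT] by measurable
    show "AE t in lborel. (\<integral>s. T (s *\<^sub>R v + t *\<^sub>R w) \<partial>lborel) = 0"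
      using integral_axis_frame(1)[OF fr intT] AE_not_in[OF finite_imp_null_set_lborel[OF fin]]
      by eventually_elim (rule line)
  qed simp
  finally have "(\<integral>z. T z \<partial>lborel) = 0" by simp
  then have "(\<integral>z. indicator ?U z *\<^sub>R (D z *\<^sub>R f z) \<partial>lborel) = - (\<integral>z. indicator ?U z *\<^sub>R (\<eta> z *\<^sub>R g z) \<partial>lborel)"
    unfolding T_def using int1 int2
    by (subst (asm) Bochner_Integration.integral_add) (auto simp: eq_neg_iff_add_eq_0)
  then show "set_lebesgue_integral lebesgue ?U (\<lambda>z. frechet_derivative \<eta> (at z) v *\<^sub>R f z) =
        - set_lebesgue_integral lebesgue ?U (\<lambda>z. \<eta> z *\<^sub>R g z)"
    unfolding set_lebesgue_integral_def D_def
    using int1 int2 by (simp add: integral_completion borel_measurable_integrable D_def)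
qed

lemma vector_derivative_quotient_tendsto:
  fixes f :: "real \<Rightarrow> 'b::real_normed_vector"
  assumes "(f has_vector_derivative D) (at 0)"
  shows "((\<lambda>s. (f s - f 0) /\<^sub>R s) \<longlongrightarrow> D) (at 0)"
proof -
  have "((\<lambda>s. (f s - f 0 - s *\<^sub>R D) /\<^sub>R norm s) \<longlongrightarrow> 0) (at 0)"
    using assms by (simp add: has_vector_derivative_def has_derivative_def netlimit_at)
  then have "((\<lambda>s. norm ((f s - f 0 - s *\<^sub>R D) /\<^sub>R norm s)) \<longlongrightarrow> 0) (at 0)"
    by (rule tendsto_norm_zero)
  moreover have "\<forall>\<^sub>F s in at 0. norm ((f s - f 0 - s *\<^sub>R D) /\<^sub>R norm s) = norm ((f s - f 0) /\<^sub>R s - D)"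
    unfolding eventually_at_filter
  proof (rule always_eventually, intro allI impI)
    fix s :: real assume "s \<noteq> 0"
    then have "(f s - f 0) /\<^sub>R s - D = (f s - f 0 - s *\<^sub>R D) /\<^sub>R s"
      by (simp add: scaleR_diff_right)
    then show "norm ((f s - f 0 - s *\<^sub>R D) /\<^sub>R norm s) = norm ((f s - f 0) /\<^sub>R s - D)"
      by simp
  qed
  ultimately have "((\<lambda>s. norm ((f s - f 0) /\<^sub>R s - D)) \<longlongrightarrow> 0) (at 0)"
    by (rule Lim_transform_eventually)
  then have "((\<lambda>s. (f s - f 0) /\<^sub>R s - D) \<longlongrightarrow> 0) (at 0)" by (rule tendsto_norm_zero_cancel)
  then show ?thesis by (rule Lim_null[THEN iffD2])
qed

lemma differentiable_line:
  fixes f :: "complex \<Rightarrow> complex"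
  assumes "f differentiable (at z)"
  shows "((\<lambda>s. f (z + s *\<^sub>R v)) has_vector_derivative frechet_derivative f (at z) v) (at 0)"
proof -
  have d: "(f has_derivative frechet_derivative f (at z)) (at (z + 0 *\<^sub>R v))"
    using assms by (simp add: frechet_derivative_works)
  have "((\<lambda>s. z + s *\<^sub>R v) has_derivative (\<lambda>s. s *\<^sub>R v)) (at 0)"
    by (auto intro!: derivative_eq_intros)
  from diff_chain_at[OF this d] linear_cmul[OF has_derivative_linear[OF d]] show ?thesis
    by (simp add: has_vector_derivative_def o_def)
qed

text \<open>The Sobolev criterion for the extension: only differentiability off finitely many lines and a bound
\<open>M\<close> on the gradient are needed. The gradient is a pointwise limit of difference quotients, which makes it
measurable.\<close>

lemma W12_onI:
  fixes f :: "complex \<Rightarrow> complex" and M :: "complex \<Rightarrow> real"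
  assumes cont: "continuous_on (cball 0 1) f" and [measurable]: "f \<in> borel_measurable borel"
    and fin: "finite S"
    and diff: "\<And>z. z \<in> ball 0 1 \<Longrightarrow> Re z \<notin> S \<Longrightarrow> Im z \<notin> S \<Longrightarrow> f differentiable (at z)"
    and bound: "\<And>z v. z \<in> ball 0 1 \<Longrightarrow> Re z \<notin> S \<Longrightarrow> Im z \<notin> S \<Longrightarrow> v \<in> {1, \<i>} \<Longrightarrow>
        norm (frechet_derivative f (at z) v) \<le> M z"
    and M: "(\<integral>\<^sup>+z. indicator (ball 0 1) z * ennreal ((M z)\<^sup>2) \<partial>lborel) < \<infinity>"
  shows "W12_on (ball 0 1) f"
proof -
  let ?U = "ball 0 1 :: complex set"
  have L2I: "L2_on ?U g" if [measurable]: "g \<in> borel_measurable borel"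
    and int: "integrable lborel (\<lambda>z. indicator ?U z *\<^sub>R (norm (g z))\<^sup>2)" for g :: "complex \<Rightarrow> complex"
  proof -
    have [measurable]: "g \<in> borel_measurable lborel" "?U \<in> sets lborel" using that(1) by simp_all
    have "(\<lambda>z. indicator ?U z *\<^sub>R g z) \<in> borel_measurable lborel" by measurable
    then have "set_borel_measurable lebesgue ?U g"
      unfolding set_borel_measurable_def by (rule measurable_completion)
    moreover have "set_integrable lebesgue ?U (\<lambda>z. (norm (g z))\<^sup>2)"
      unfolding set_integrable_def using int by (subst integrable_completion) auto
    ultimately show ?thesis by (simp add: L2_on_def)
  qed
  have "set_integrable lborel (cball 0 1) (\<lambda>z. (norm (f z))\<^sup>2)"
    unfolding set_integrable_def by (rule borel_integrable_compact) (auto intro!: continuous_intros cont)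
  then have "set_integrable lborel ?U (\<lambda>z. (norm (f z))\<^sup>2)" by (rule set_integrable_subset) auto
  then have L2f: "L2_on ?U f" unfolding set_integrable_def by (intro L2I) auto
  have "\<exists>g. L2_on ?U g \<and> weak_directional_deriv ?U v f g" if v: "v \<in> {1, \<i>}" for v
  proof -
    obtain w where fr: "axis_frame v w" using axis_frameE[OF v] .
    define good where "good = {z \<in> ?U. Re z \<notin> S \<and> Im z \<notin> S}"
    have "closed S" using fin by (rule finite_imp_closed)
    then have "open (?U \<inter> Re -` (- S) \<inter> Im -` (- S))"
      by (intro open_Int open_ball open_vimage open_Compl continuous_intros)
    moreover have "good = ?U \<inter> Re -` (- S) \<inter> Im -` (- S)" by (auto simp: good_def)
    ultimately have [measurable]: "good \<in> sets borel" by simp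
    define g where "g = (\<lambda>z. indicator good z *\<^sub>R frechet_derivative f (at z) v)"
    have g_meas [measurable]: "g \<in> borel_measurable borel"
    proof (rule borel_measurable_LIMSEQ_metric)
      fix n :: nat
      show "(\<lambda>z. indicator good z *\<^sub>R ((f (z + inverse (real (Suc n)) *\<^sub>R v) - f z) /\<^sub>R inverse (real (Suc n)))) \<in> borel_measurable borel"
        by measurable
    next
      fix z :: complex
      show "(\<lambda>n. indicator good z *\<^sub>R ((f (z + inverse (real (Suc n)) *\<^sub>R v) - f z) /\<^sub>R inverse (real (Suc n)))) \<longlonglongrightarrow> g z"
      proof (cases "z \<in> good")
        case True
        then have "((\<lambda>s. f (z + s *\<^sub>R v)) has_vector_derivative frechet_derivative f (at z) v) (at 0)"
          by (intro differentiable_line diff) (auto simp: good_def)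
        from vector_derivative_quotient_tendsto[OF this]
        have "((\<lambda>s. (f (z + s *\<^sub>R v) - f z) /\<^sub>R s) \<longlongrightarrow> frechet_derivative f (at z) v) (at 0)" by simp
        moreover have "filterlim (\<lambda>n. inverse (real (Suc n))) (at 0) sequentially"
          by (rule filterlim_atI[OF LIMSEQ_inverse_real_of_nat]) auto
        ultimately have "(\<lambda>n. (f (z + inverse (real (Suc n)) *\<^sub>R v) - f z) /\<^sub>R inverse (real (Suc n))) \<longlonglongrightarrow> frechet_derivative f (at z) v"
          by (rule filterlim_compose)
        then show ?thesis using True by (simp add: g_def)
      qed (simp add: g_def)
    qed
    have [measurable]: "g \<in> borel_measurable lborel" "?U \<in> sets lborel" using g_meas by simp_all
    have g_le: "(norm (g z))\<^sup>2 \<le> (M z)\<^sup>2" if "z \<in> ?U" for z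
      using bound[of z v] v that by (auto simp: g_def indicator_def good_def intro!: power_mono)
    have int2: "integrable lborel (\<lambda>z. indicator ?U z *\<^sub>R (norm (g z))\<^sup>2)"
    proof (rule integrableI_bounded)
      have "(\<integral>\<^sup>+z. ennreal (norm (indicator ?U z *\<^sub>R (norm (g z))\<^sup>2)) \<partial>lborel)
          \<le> (\<integral>\<^sup>+z. indicator ?U z * ennreal ((M z)\<^sup>2) \<partial>lborel)"
        using g_le by (intro nn_integral_mono) (auto simp: indicator_def ennreal_leI)
      then show "(\<integral>\<^sup>+z. ennreal (norm (indicator ?U z *\<^sub>R (norm (g z))\<^sup>2)) \<partial>lborel) < \<infinity>"
        using M by (rule le_less_trans)
    qed measurable
    have int1: "integrable lborel (\<lambda>z. indicator ?U z *\<^sub>R g z)"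
    proof (rule Bochner_Integration.integrable_bound)
      have "emeasure lborel ?U < \<infinity>" by (rule emeasure_bounded_finite) auto
      then have "integrable lborel (indicator ?U :: complex \<Rightarrow> real)"
        by (intro integrable_real_indicator) auto
      then show "integrable lborel (\<lambda>z. indicator ?U z + indicator ?U z *\<^sub>R (norm (g z))\<^sup>2 :: real)"
        using int2 by (rule Bochner_Integration.integrable_add)
      have "norm (g z) \<le> 1 + (norm (g z))\<^sup>2" for z
        using zero_le_power2[of "norm (g z) - 1/2"] by (simp add: power2_eq_square algebra_simps)
      then show "AE z in lborel. norm (indicator ?U z *\<^sub>R g z) \<le> norm (indicator ?U z + indicator ?U z *\<^sub>R (norm (g z))\<^sup>2)"
        by (intro AE_I2) (auto simp: indicator_def)
    qed measurable
    have "weak_directional_deriv ?U v f g"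
    proof (rule weak_directional_derivI[OF fr fin cont int1])
      fix z assume z: "z \<in> ?U" "z \<bullet> v \<notin> S" "z \<bullet> w \<notin> S"
      then have "Re z \<notin> S" "Im z \<notin> S" using fr by (auto simp: axis_frame_def inner_complex_def)
      then show "((\<lambda>s. f (z + s *\<^sub>R v)) has_vector_derivative g z) (at 0)"
        using differentiable_line[OF diff, of z v] z(1) by (simp add: g_def good_def)
    qed
    then show ?thesis using L2I[OF g_meas int2] by blast
  qed
  then show ?thesis using L2f unfolding W12_on_def by blast
qed

section \<open>Radial weights on the circle and in the plane\<close>

lemma ex_dyadic_scale:
  fixes \<rho> s :: real
  assumes "0 < \<rho>" "\<rho> \<le> s"
  obtains n where "s / 2 ^ Suc n < \<rho>" "\<rho> \<le> s / 2 ^ n"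
proof -
  obtain m where "s / \<rho> < 2 ^ m" using real_arch_pow[of 2 "s / \<rho>"] by auto
  then have ex: "\<exists>m. s / 2 ^ m < \<rho>" using assms by (auto simp: field_simps)
  define m where "m = (LEAST m. s / 2 ^ m < \<rho>)"
  have m: "s / 2 ^ m < \<rho>" unfolding m_def by (rule LeastI_ex[OF ex])
  then have "m \<noteq> 0" using assms by (cases m) auto
  then obtain n where n: "m = Suc n" by (cases m) auto
  have "\<not> s / 2 ^ n < \<rho>" using not_less_Least[of n "\<lambda>m. s / 2 ^ m < \<rho>"] n by (auto simp: m_def)
  then show ?thesis using that[of n] m n by auto
qed

text \<open>All singular integrals depend on the distance \<open>\<rho>\<close> to the point \<open>1\<close> only, so they are bounded by summing
over dyadic shells. The same lemma serves for arclength (\<open>d = 1\<close>) and for area (\<open>d = 2\<close>).\<close>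

lemma nn_integral_dyadic_le:
  fixes \<rho> :: "'a \<Rightarrow> real" and C s :: real and d :: nat and c :: "nat \<Rightarrow> real"
  assumes [measurable]: "\<rho> \<in> borel_measurable M" and "C \<ge> 0"
    and vol: "\<And>\<sigma>. 0 < \<sigma> \<Longrightarrow> emeasure M {x \<in> space M. \<rho> x \<le> \<sigma>} \<le> ennreal (C * \<sigma> ^ d)"
    and F: "\<And>n x. s / 2 ^ Suc n < \<rho> x \<Longrightarrow> \<rho> x \<le> s / 2 ^ n \<Longrightarrow> F x \<le> ennreal (c n)"
    and c: "\<And>n. c n \<ge> 0" and "s > 0"
    and summ: "summable (\<lambda>n. c n * (C * (s / 2 ^ n) ^ d))"
  shows "(\<integral>\<^sup>+x. F x * indicator {x. 0 < \<rho> x \<and> \<rho> x \<le> s} x \<partial>M)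
    \<le> ennreal (\<Sum>n. c n * (C * (s / 2 ^ n) ^ d))"
proof -
  have "(\<integral>\<^sup>+x. F x * indicator {x. 0 < \<rho> x \<and> \<rho> x \<le> s} x \<partial>M)
      \<le> (\<integral>\<^sup>+x. (\<Sum>n. ennreal (c n) * indicator {x \<in> space M. \<rho> x \<le> s / 2 ^ n} x) \<partial>M)"
  proof (rule nn_integral_mono)
    fix x assume x: "x \<in> space M"
    show "F x * indicator {x. 0 < \<rho> x \<and> \<rho> x \<le> s} x
      \<le> (\<Sum>n. ennreal (c n) * indicator {x \<in> space M. \<rho> x \<le> s / 2 ^ n} x)"
    proof (cases "0 < \<rho> x \<and> \<rho> x \<le> s")
      case True
      then obtain n where n: "s / 2 ^ Suc n < \<rho> x" "\<rho> x \<le> s / 2 ^ n" using ex_dyadic_scale by blast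
      have "F x * indicator {x. 0 < \<rho> x \<and> \<rho> x \<le> s} x \<le> (\<Sum>k\<in>{n}. ennreal (c k) * indicator {x \<in> space M. \<rho> x \<le> s / 2 ^ k} x)"
        using F[OF n] True n x by simp
      also have "\<dots> \<le> (\<Sum>n. ennreal (c n) * indicator {x \<in> space M. \<rho> x \<le> s / 2 ^ n} x)"
        by (rule sum_le_suminf) auto
      finally show ?thesis .
    qed auto
  qed
  also have "\<dots> = (\<Sum>n. \<integral>\<^sup>+x. ennreal (c n) * indicator {x \<in> space M. \<rho> x \<le> s / 2 ^ n} x \<partial>M)"
    by (rule nn_integral_suminf) measurable
  also have "\<dots> = (\<Sum>n. ennreal (c n) * emeasure M {x \<in> space M. \<rho> x \<le> s / 2 ^ n})"
    by (subst nn_integral_cmult_indicator) auto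
  also have "\<dots> \<le> (\<Sum>n. ennreal (c n * (C * (s / 2 ^ n) ^ d)))"
  proof (rule suminf_le)
    show "ennreal (c n) * emeasure M {x \<in> space M. \<rho> x \<le> s / 2 ^ n} \<le> ennreal (c n * (C * (s / 2 ^ n) ^ d))" for n
      using vol[of "s / 2 ^ n"] \<open>s > 0\<close> c[of n] \<open>C \<ge> 0\<close> by (subst ennreal_mult) (auto intro!: mult_left_mono)
  qed auto
  also have "\<dots> = ennreal (\<Sum>n. c n * (C * (s / 2 ^ n) ^ d))"
    using summ c \<open>C \<ge> 0\<close> \<open>s > 0\<close> by (intro suminf_ennreal2) auto
  finally show ?thesis .
qed

lemma nn_integral_inverse_sqrt_le:
  fixes \<rho> :: "'a \<Rightarrow> real" and C :: real
  assumes [measurable]: "\<rho> \<in> borel_measurable M" and "C \<ge> 0"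
    and vol: "\<And>\<sigma>. 0 < \<sigma> \<Longrightarrow> emeasure M {x \<in> space M. \<rho> x \<le> \<sigma>} \<le> ennreal (C * \<sigma>)"
  obtains B where "B \<ge> 0"
    "\<And>s. s > 0 \<Longrightarrow> (\<integral>\<^sup>+x. ennreal (1 / sqrt (\<rho> x)) * indicator {x. 0 < \<rho> x \<and> \<rho> x \<le> s} x \<partial>M) \<le> ennreal (B * sqrt s)"
proof
  define B where "B = (\<Sum>n. C * sqrt 2 * (1 / sqrt 2) ^ n)"
  have summ0: "summable (\<lambda>n. C * sqrt 2 * (1 / sqrt 2) ^ n)"
    by (intro summable_mult summable_geometric) auto
  show "B \<ge> 0" unfolding B_def using \<open>C \<ge> 0\<close> by (intro suminf_nonneg summ0) auto
  fix s :: real assume s: "s > 0"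
  define c where "c = (\<lambda>n. 1 / sqrt (s / 2 ^ Suc n))"
  have eq: "c n * (C * (s / 2 ^ n) ^ 1) = sqrt s * (C * sqrt 2 * (1 / sqrt 2) ^ n)" for n
  proof -
    have "sqrt 2 ^ n * sqrt 2 ^ n = (2::real) ^ n"
      by (simp add: power_mult_distrib[symmetric])
    moreover have "s = sqrt s * sqrt s" using s by simp
    ultimately show ?thesis
      using s by (simp add: c_def real_sqrt_divide real_sqrt_mult real_sqrt_power field_simps)
  qed
  have "(\<integral>\<^sup>+x. ennreal (1 / sqrt (\<rho> x)) * indicator {x. 0 < \<rho> x \<and> \<rho> x \<le> s} x \<partial>M)
    \<le> ennreal (\<Sum>n. c n * (C * (s / 2 ^ n) ^ 1))"
  proof (rule nn_integral_dyadic_le)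
    show "ennreal (1 / sqrt (\<rho> x)) \<le> ennreal (c n)" if "s / 2 ^ Suc n < \<rho> x" for n x
      unfolding c_def using that s
      by (intro ennreal_leI divide_left_mono real_sqrt_le_mono mult_pos_pos)
        (auto intro: less_trans[OF _ that])
    show "summable (\<lambda>n. c n * (C * (s / 2 ^ n) ^ 1))"
      unfolding eq using summ0 by (rule summable_mult)
  qed (use assms s in \<open>auto simp: c_def\<close>)
  also have "(\<Sum>n. c n * (C * (s / 2 ^ n) ^ 1)) = sqrt s * B"
    unfolding eq B_def using summ0 by (rule suminf_mult)
  finally show "(\<integral>\<^sup>+x. ennreal (1 / sqrt (\<rho> x)) * indicator {x. 0 < \<rho> x \<and> \<rho> x \<le> s} x \<partial>M) \<le> ennreal (B * sqrt s)"
    by (simp add: mult.commute)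
qed

text \<open>At the \<open>n\<close>-th dyadic scale the weight \<open>\<rho>\<^sup>-\<^sup>d\<close> cancels the volume, and the logarithm contributes a
multiple of \<open>n\<^sup>-\<^sup>b\<close>; this is where \<open>b > 1\<close> enters.\<close>

lemma nn_integral_log_weight_finite:
  fixes \<rho> :: "'a \<Rightarrow> real" and C b K :: real and d :: nat
  assumes [measurable]: "\<rho> \<in> borel_measurable M" and "C \<ge> 0"
    and vol: "\<And>\<sigma>. 0 < \<sigma> \<Longrightarrow> emeasure M {x \<in> space M. \<rho> x \<le> \<sigma>} \<le> ennreal (C * \<sigma> ^ d)"
    and b: "b > 1" and K: "K \<ge> 2"
  shows "(\<integral>\<^sup>+x. ennreal ((K - ln (\<rho> x)) powr (- b) / \<rho> x ^ d) * indicator {x. 0 < \<rho> x \<and> \<rho> x \<le> 2} x \<partial>M) < \<infinity>"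
proof -
  define c where "c = (\<lambda>n::nat. (K - ln 2 + n * ln 2) powr (- b) / (2 / 2 ^ Suc n) ^ d)"
  have ln2: "0 < ln (2::real)" "ln (2::real) \<le> 1" using ln_le_minus_one[of 2] by auto
  have eq: "c n * (C * (2 / 2 ^ n) ^ d) = 2 ^ d * C * (K - ln 2 + n * ln 2) powr (- b)" for n
    by (simp add: c_def field_simps power_mult_distrib)
  have summ: "summable (\<lambda>n. c n * (C * (2 / 2 ^ n) ^ d))"
    unfolding eq
  proof (rule summable_mult, rule summable_comparison_test)
    have "summable (\<lambda>n. real n powr (- b))" using b by (subst summable_real_powr_iff) auto
    then show "summable (\<lambda>n. ln 2 powr (- b) * real n powr (- b))" by (rule summable_mult)
    show "\<exists>N. \<forall>n\<ge>N. norm ((K - ln 2 + n * ln 2) powr (- b)) \<le> ln 2 powr (- b) * real n powr (- b)"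
    proof (intro exI[of _ 1] allI impI)
      fix n :: nat assume n: "1 \<le> n"
      have "(K - ln 2 + n * ln 2) powr (- b) \<le> (ln 2 * real n) powr (- b)"
        using b K ln2 n by (intro powr_mono2') auto
      then show "norm ((K - ln 2 + n * ln 2) powr (- b)) \<le> ln 2 powr (- b) * real n powr (- b)"
        using ln2 by (simp add: powr_mult)
    qed
  qed
  have "(\<integral>\<^sup>+x. ennreal ((K - ln (\<rho> x)) powr (- b) / \<rho> x ^ d) * indicator {x. 0 < \<rho> x \<and> \<rho> x \<le> 2} x \<partial>M)
      \<le> ennreal (\<Sum>n. c n * (C * (2 / 2 ^ n) ^ d))"
  proof (rule nn_integral_dyadic_le)
    fix n x assume x: "2 / 2 ^ Suc n < \<rho> x" "\<rho> x \<le> 2 / 2 ^ n"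
    have pos: "0 < \<rho> x" by (rule less_trans[OF _ x(1)]) auto
    have "ln (\<rho> x) \<le> ln (2 / 2 ^ n)" using x pos by simp
    also have "\<dots> = ln 2 - n * ln 2" by (simp add: ln_div ln_realpow)
    finally have "ln (\<rho> x) \<le> ln 2 - n * ln 2" .
    then have "(K - ln (\<rho> x)) powr (- b) \<le> (K - ln 2 + n * ln 2) powr (- b)"
      using b K ln2 by (intro powr_mono2') (auto intro: add_pos_nonneg)
    moreover have "(2 / 2 ^ Suc n) ^ d \<le> \<rho> x ^ d"
      using x by (intro power_mono) auto
    ultimately show "ennreal ((K - ln (\<rho> x)) powr (- b) / \<rho> x ^ d) \<le> ennreal (c n)"
      unfolding c_def by (intro ennreal_leI frac_le) auto
  qed (use assms summ in \<open>auto simp: c_def\<close>)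
  then show ?thesis by (simp add: le_less_trans)
qed

lemma emeasure_lborel_norm_le:
  assumes "0 < \<sigma>"
  shows "emeasure lborel {z::complex. norm (z - 1) \<le> \<sigma>} \<le> ennreal (4 * \<sigma>\<^sup>2)"
proof -
  have "emeasure lborel {z::complex. norm (z - 1) \<le> \<sigma>} \<le> emeasure lborel (cbox (Complex (1 - \<sigma>) (-\<sigma>)) (Complex (1 + \<sigma>) \<sigma>))"
  proof (rule emeasure_mono)
    show "{z::complex. norm (z - 1) \<le> \<sigma>} \<subseteq> cbox (Complex (1 - \<sigma>) (-\<sigma>)) (Complex (1 + \<sigma>) \<sigma>)"
    proof
      fix z :: complex assume "z \<in> {z. norm (z - 1) \<le> \<sigma>}"
      then have "\<bar>Re z - 1\<bar> \<le> \<sigma>" "\<bar>Im z\<bar> \<le> \<sigma>"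
        using abs_Re_le_cmod[of "z - 1"] abs_Im_le_cmod[of "z - 1"] by auto
      then show "z \<in> cbox (Complex (1 - \<sigma>) (-\<sigma>)) (Complex (1 + \<sigma>) \<sigma>)"
        by (auto simp: mem_box Basis_complex_def inner_complex_def)
    qed
  qed auto
  also have "\<dots> = ennreal (4 * \<sigma>\<^sup>2)"
    using assms
    by (subst emeasure_lborel_cbox)
       (auto simp: Basis_complex_def inner_complex_def power2_eq_square)
  finally show ?thesis .
qed

lemma sin_ge_half:
  fixes x :: real
  assumes "0 \<le> x" "x \<le> pi / 2"
  shows "x / 2 \<le> sin x"
proof (cases "x \<le> pi / 3")
  case True
  have "sin 0 - 0 / 2 \<le> sin x - x / 2"
  proof (rule DERIV_nonneg_imp_nondecreasing[OF assms(1)])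
    fix t assume t: "0 \<le> t" "t \<le> x"
    have "cos (pi / 3) \<le> cos t" using t True by (intro cos_monotone_0_pi_le) auto
    then show "\<exists>y. ((\<lambda>x. sin x - x / 2) has_real_derivative y) (at t) \<and> 0 \<le> y"
      by (intro exI[of _ "cos t - 1/2"]) (auto intro!: derivative_eq_intros simp: cos_60)
  qed
  then show ?thesis by simp
next
  case False
  have "sin (pi / 3) \<le> sin x" using False assms by (intro sin_monotone_2pi_le) auto
  moreover have "(1.7 / 2 :: real) \<le> sqrt 3 / 2"
    by (intro divide_right_mono real_le_rsqrt) (auto simp: power2_eq_square)
  moreover have "pi < 3.2" using pi_less_4 pi_approx by simp
  ultimately show ?thesis using assms by (simp add: sin_60)
qed

lemma norm_cis_minus_one:
  assumes "0 \<le> t" "t \<le> 2 * pi"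
  shows "norm (cis t - 1) = 2 * sin (t / 2)"
proof -
  have "(norm (cis t - 1))\<^sup>2 = (cos t - 1)\<^sup>2 + (sin t)\<^sup>2" by (simp add: cmod_power2)
  also have "\<dots> = 2 - 2 * cos t"
    using sin_cos_squared_add[of t] by (simp add: power2_eq_square algebra_simps)
  also have "\<dots> = (2 * sin (t / 2))\<^sup>2"
    using cos_double_sin[of "t / 2"] by (simp add: power2_eq_square)
  finally have "(norm (cis t - 1))\<^sup>2 = (2 * sin (t / 2))\<^sup>2" .
  moreover have "0 \<le> sin (t / 2)" using assms by (intro sin_ge_zero) auto
  ultimately show ?thesis using power2_eq_imp_eq[of "norm (cis t - 1)" "2 * sin (t / 2)"] by simp
qed

lemma sets_circle_arclength [measurable_cong]:
  "sets circle_arclength = sets (restrict_space borel (sphere 0 1))"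
  by (simp add: circle_arclength_def)

lemma space_circle_arclength: "space circle_arclength = sphere 0 1"
  by (simp add: circle_arclength_def space_restrict_space)

lemma measurable_cis_circle:
  "cis \<in> restrict_space lborel {0..<2 * pi} \<rightarrow>\<^sub>M restrict_space borel (sphere 0 1)"
proof (rule measurable_restrict_space2)
  show "cis \<in> borel_measurable (restrict_space lborel {0..<2 * pi})"
    by (intro measurable_restrict_space1) (auto intro!: borel_measurable_continuous_onI continuous_intros)
qed auto

text \<open>The chord between \<open>1\<close> and \<open>cis t\<close> has length \<open>2 sin (t / 2)\<close>, which is comparable to the arc.\<close>

lemma emeasure_circle_arclength_le:
  assumes "0 < \<sigma>"
  shows "emeasure circle_arclength {x \<in> space circle_arclength. norm (x - 1) \<le> \<sigma>} \<le> ennreal (4 * \<sigma>)"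
proof -
  let ?A = "{x \<in> space circle_arclength. norm (x - 1) \<le> \<sigma>}"
  have A: "?A \<in> sets (restrict_space borel (sphere 0 1))"
  proof -
    have "?A = {x. norm (x - 1) \<le> \<sigma>} \<inter> sphere 0 1" by (auto simp: space_circle_arclength)
    then show ?thesis by (auto simp: sets_restrict_space_iff)
  qed
  have "emeasure circle_arclength ?A
     = emeasure (restrict_space lborel {0..<2*pi}) (cis -` ?A \<inter> {0..<2*pi})"
    unfolding circle_arclength_def using A measurable_cis_circle
    by (subst emeasure_distr) (auto simp: space_restrict_space circle_arclength_def)
  also have "\<dots> = emeasure lborel (cis -` ?A \<inter> {0..<2*pi})"
    by (rule emeasure_restrict_space) auto
  also have "\<dots> \<le> emeasure lborel ({0..2*\<sigma>} \<union> {2*pi-2*\<sigma>..2*pi})"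
  proof (rule emeasure_mono)
    show "cis -` ?A \<inter> {0..<2*pi} \<subseteq> {0..2*\<sigma>} \<union> {2*pi-2*\<sigma>..2*pi}"
    proof
      fix t assume "t \<in> cis -` ?A \<inter> {0..<2*pi}"
      then have t: "0 \<le> t" "t < 2*pi" "2 * sin (t/2) \<le> \<sigma>"
        using norm_cis_minus_one[of t] by auto
      show "t \<in> {0..2*\<sigma>} \<union> {2*pi-2*\<sigma>..2*pi}"
      proof (cases "t \<le> pi")
        case True then show ?thesis using sin_ge_half[of "t/2"] t by auto
      next
        case False
        have "sin (t/2) = sin ((2*pi-t)/2)" by (simp add: diff_divide_distrib)
        then show ?thesis using sin_ge_half[of "(2*pi-t)/2"] t False by auto
      qed
    qed
  qed auto
  also have "\<dots> \<le> emeasure lborel {0..2*\<sigma>} + emeasure lborel {2*pi-2*\<sigma>..2*pi}"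
    by (rule emeasure_subadditive) auto
  also have "\<dots> = ennreal (4 * \<sigma>)" using assms by (simp flip: ennreal_plus)
  finally show ?thesis .
qed

lemma finite_measure_circle_arclength: "finite_measure circle_arclength"
proof
  have "cis -` sphere 0 1 \<inter> {0..<2*pi} = {0..<2*pi}" by auto
  then show "emeasure circle_arclength (space circle_arclength) \<noteq> \<infinity>"
    unfolding circle_arclength_def using measurable_cis_circle
    by (subst emeasure_distr)
       (auto simp: space_restrict_space emeasure_restrict_space sets_restrict_space_iff)
qed

section \<open>The logarithmic profile\<close>

text \<open>The abscissa on the cusp of the image of a point at distance \<open>\<rho>\<close> from \<open>1\<close>. The exponent is critical: the
square divided by \<open>\<rho>\<close> is not integrable at \<open>0\<close>, while the square of the derivative times \<open>\<rho>\<close> is. The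
constant \<open>K\<close> keeps the logarithm away from zero for \<open>\<rho> \<le> 2\<close> and makes the values small.\<close>

definition profile :: "real \<Rightarrow> real \<Rightarrow> real" where
  "profile K \<rho> = (if \<rho> = 0 then 0 else (K - ln \<rho>) powr (- (1/2)))"

lemma log_gap_ge_1:
  fixes K \<rho> :: real
  assumes "K \<ge> 2" "0 < \<rho>" "\<rho> \<le> 2"
  shows "1 \<le> K - ln \<rho>"
proof -
  have "ln \<rho> \<le> \<rho> - 1" using assms by (intro ln_le_minus_one) auto
  then show ?thesis using assms by simp
qed

lemma profile_0 [simp]: "profile K 0 = 0"
  by (simp add: profile_def)

lemma profile_pos: "K \<ge> 2 \<Longrightarrow> 0 < \<rho> \<Longrightarrow> \<rho> \<le> 2 \<Longrightarrow> 0 < profile K \<rho>"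
  using log_gap_ge_1[of K \<rho>] by (auto simp: profile_def)

lemma profile_nonneg: "0 \<le> profile K \<rho>"
  by (simp add: profile_def)

lemma profile_square:
  assumes "K \<ge> 2" "0 < \<rho>" "\<rho> \<le> 2"
  shows "(profile K \<rho>)\<^sup>2 = 1 / (K - ln \<rho>)"
proof -
  have "(profile K \<rho>)\<^sup>2 = (K - ln \<rho>) powr (- (1/2) + - (1/2))"
    using assms unfolding power2_eq_square powr_add by (simp add: profile_def)
  then show ?thesis using log_gap_ge_1[OF assms] by (simp add: powr_minus inverse_eq_divide)
qed

lemma profile_strict_mono:
  assumes "K \<ge> 2" "0 \<le> \<rho>" "\<rho> < \<sigma>" "\<sigma> \<le> 2"
  shows "profile K \<rho> < profile K \<sigma>"
proof (cases "\<rho> = 0")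
  case True
  then show ?thesis using assms profile_pos[of K \<sigma>] by simp
next
  case False
  then have "ln \<rho> < ln \<sigma>" using assms by simp
  then have "(K - ln \<rho>) powr (- (1/2)) < (K - ln \<sigma>) powr (- (1/2))"
    using log_gap_ge_1[of K \<sigma>] assms by (intro powr_less_mono2_neg) auto
  then show ?thesis using False assms by (simp add: profile_def)
qed

lemma profile_mono:
  assumes "K \<ge> 2" "0 \<le> \<rho>" "\<rho> \<le> \<sigma>" "\<sigma> \<le> 2"
  shows "profile K \<rho> \<le> profile K \<sigma>"
  using profile_strict_mono[OF assms(1,2), of \<sigma>] assms by (cases "\<rho> = \<sigma>") auto

lemma profile_tendsto_0: "(profile K \<longlongrightarrow> 0) (at_right 0)"
proof -
  have "((\<lambda>\<rho>. (K - ln \<rho>) powr (- (1/2))) \<longlongrightarrow> 0) (at_right 0)"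
  proof (rule tendsto_neg_powr)
    show "filterlim (\<lambda>\<rho>. K - ln \<rho>) at_top (at_right 0)"
      unfolding diff_conv_add_uminus
      by (intro filterlim_tendsto_add_at_top[OF tendsto_const] filterlim_compose[OF filterlim_uminus_at_top_at_bot] ln_at_0)
  qed simp
  moreover have "\<forall>\<^sub>F \<rho> in at_right 0. (K - ln \<rho>) powr (- (1/2)) = profile K \<rho>"
    by (auto simp: eventually_at_filter profile_def)
  ultimately show ?thesis by (rule Lim_transform_eventually)
qed

lemma continuous_on_profile:
  assumes "K \<ge> 2"
  shows "continuous_on {0..2} (profile K)"
  unfolding continuous_on_eq_continuous_within
proof
  fix \<rho> :: real assume \<rho>: "\<rho> \<in> {0..2}"
  show "continuous (at \<rho> within {0..2}) (profile K)"
  proof (cases "\<rho> = 0")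
    case True
    have "continuous (at_right 0) (profile K)"
      using profile_tendsto_0[of K] by (simp add: continuous_within)
    then show ?thesis using True at_within_Icc_at_right[of 0 "2::real"] by simp
  next
    case False
    then have pos: "0 < \<rho>" using \<rho> by auto
    have "isCont (\<lambda>\<rho>. (K - ln \<rho>) powr (- (1/2))) \<rho>"
      using pos log_gap_ge_1[OF assms pos] \<rho> by (intro continuous_intros) auto
    moreover have "\<forall>\<^sub>F x in nhds \<rho>. x \<in> {0<..}" using pos by (intro eventually_nhds_in_open) auto
    then have "\<forall>\<^sub>F x in nhds \<rho>. profile K x = (K - ln x) powr (- (1/2))"
      by eventually_elim (simp add: profile_def)
    ultimately have "isCont (profile K) \<rho>" using isCont_cong by force
    then show ?thesis by (rule continuous_at_imp_continuous_at_within)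
  qed
qed

text \<open>The right-hand side tends to infinity as \<open>d\<close> tends to \<open>0\<close>.\<close>

lemma nn_integral_profile_square:
  assumes K: "K \<ge> 2" and d: "0 < d" "d \<le> 1/2"
  shows "(\<integral>\<^sup>+s. ennreal ((profile K s)\<^sup>2 / s) * indicator {d..1/2} s \<partial>lborel)
     = ennreal (ln (K - ln d) - ln (K - ln (1/2)))"
proof -
  have "(\<integral>\<^sup>+s. ennreal ((profile K s)\<^sup>2 / s) * indicator {d..1/2} s \<partial>lborel)
     = (\<integral>\<^sup>+s. ennreal (1 / (s * (K - ln s))) * indicator {d..1/2} s \<partial>lborel)"
    using d K by (intro nn_integral_cong) (auto simp: indicator_def profile_square mult.commute)
  also have "\<dots> = ennreal (- ln (K - ln (1/2)) - (- ln (K - ln d)))"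
  proof (rule nn_integral_FTC_Icc[where F = "\<lambda>s. - ln (K - ln s)"])
    fix s assume s: "s \<in> {d..1/2}"
    then have p: "s > 0" "1 \<le> K - ln s" using d log_gap_ge_1[OF K, of s] by auto
    show "0 \<le> 1 / (s * (K - ln s))" using p by auto
    show "((\<lambda>s. - ln (K - ln s)) has_real_derivative 1 / (s * (K - ln s))) (at s)"
      using p by (auto intro!: derivative_eq_intros simp: field_simps)
  qed (use d in auto)
  finally show ?thesis by simp
qed

section \<open>Smooth bump functions\<close>

text \<open>A class of functions that is closed under differentiation and contains the standard smooth function that
vanishes to infinite order at \<open>0\<close> (for \<open>p = 1\<close>).\<close>

definition flat :: "real poly \<Rightarrow> real \<Rightarrow> real" where
  "flat p x = (if x > 0 then poly p (1 / x) * exp (- 1 / x) else 0)"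

lemma poly_over_exp_tendsto_0:
  fixes p :: "real poly"
  shows "((\<lambda>x. poly p x / exp x) \<longlongrightarrow> 0) at_top"
proof -
  have "((\<lambda>x. \<Sum>i\<le>degree p. coeff p i * (x ^ i / exp x)) \<longlongrightarrow> (\<Sum>i\<le>degree p. coeff p i * 0)) at_top"
    by (intro tendsto_intros tendsto_power_div_exp_0)
  then show ?thesis by (simp add: poly_altdef sum_divide_distrib)
qed

lemma flat_tendsto_0: "(flat p \<longlongrightarrow> 0) (at 0)"
proof (rule filterlim_split_at)
  have "\<forall>\<^sub>F x in at_left (0::real). 0 = flat p x"
    by (auto simp: flat_def eventually_at_filter)
  then show "(flat p \<longlongrightarrow> 0) (at_left 0)"
    by (rule tendsto_cong[THEN iffD1]) auto
  have "((\<lambda>x. poly p (inverse x) / exp (inverse x)) \<longlongrightarrow> 0) (at_right (0::real))"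
    by (rule filterlim_compose[OF poly_over_exp_tendsto_0 filterlim_inverse_at_top_right])
  moreover have "\<forall>\<^sub>F x in at_right (0::real). poly p (inverse x) / exp (inverse x) = flat p x"
    by (auto simp: flat_def eventually_at_filter inverse_eq_divide exp_minus field_simps)
  ultimately show "(flat p \<longlongrightarrow> 0) (at_right 0)"
    by (rule Lim_transform_eventually)
qed

lemma DERIV_flat: "(flat p has_real_derivative flat ((p - pderiv p) * [:0, 0, 1:]) x) (at x)"
proof (cases x "0::real" rule: linorder_cases)
  case less
  have "((\<lambda>x. 0) has_real_derivative flat ((p - pderiv p) * [:0, 0, 1:]) x) (at x)"
    using less by (simp add: flat_def)
  then show ?thesis
    by (rule has_field_derivative_transform_within_open[of _ _ _ "{..<0}"]) (use less in \<open>auto simp: flat_def\<close>)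
next
  case equal
  have "(\<lambda>h. (flat p (0 + h) - flat p 0) / h) = flat (p * [:0, 1:])"
    by (auto simp: flat_def fun_eq_iff)
  then show ?thesis
    using flat_tendsto_0[of "p * [:0, 1:]"] equal by (simp add: DERIV_def flat_def)
next
  case greater
  have "((\<lambda>x. poly p (1 / x) * exp (- 1 / x)) has_real_derivative flat ((p - pderiv p) * [:0, 0, 1:]) x) (at x)"
    using greater unfolding flat_def
    by (auto intro!: derivative_eq_intros DERIV_chain2[OF poly_DERIV] simp: field_simps power2_eq_square)
  then show ?thesis
    by (rule has_field_derivative_transform_within_open[of _ _ _ "{0<..}"]) (use greater in \<open>auto simp: flat_def\<close>)
qed

text \<open>Functions on the plane that are smooth by closure under directional derivatives. The last rule adds
primitives of functions of one affine coordinate.\<close>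

inductive smooth_alg :: "(complex \<Rightarrow> real) \<Rightarrow> bool" where
  flat: "smooth_alg (\<lambda>z. flat p (c + z \<bullet> a))"
| const: "smooth_alg (\<lambda>z. c)"
| add: "smooth_alg f \<Longrightarrow> smooth_alg g \<Longrightarrow> smooth_alg (\<lambda>z. f z + g z)"
| mult: "smooth_alg f \<Longrightarrow> smooth_alg g \<Longrightarrow> smooth_alg (\<lambda>z. f z * g z)"
| antideriv: "(\<And>x. (A has_real_derivative B x) (at x)) \<Longrightarrow> smooth_alg (\<lambda>z. B (e + z \<bullet> a))
    \<Longrightarrow> smooth_alg (\<lambda>z. A (e + z \<bullet> a))"

lemma has_derivative_affine_chain:
  fixes a :: complex
  assumes "(f has_real_derivative d) (at (c + z \<bullet> a))"
  shows "((\<lambda>z. f (c + z \<bullet> a)) has_derivative (\<lambda>v. d * (v \<bullet> a))) (at z)"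
proof -
  have "((\<lambda>z. c + z \<bullet> a) has_derivative (\<lambda>v. v \<bullet> a)) (at z)"
    by (auto intro!: derivative_eq_intros)
  from diff_chain_at[OF this, of f "\<lambda>x. d * x"] assms
  show ?thesis by (simp add: o_def has_field_derivative_def)
qed

lemma smooth_alg_derivative:
  assumes "smooth_alg f"
  shows "\<exists>f'. (\<forall>z. (f has_derivative f' z) (at z)) \<and> (\<forall>v. smooth_alg (\<lambda>z. f' z v))"
  using assms
proof induction
  case (flat p c a)
  show ?case
    by (intro exI[of _ "\<lambda>z v. flat ((p - pderiv p) * [:0, 0, 1:]) (c + z \<bullet> a) * (v \<bullet> a)"] conjI allI
        has_derivative_affine_chain DERIV_flat smooth_alg.mult smooth_alg.flat smooth_alg.const)
next
  case (const c)
  show ?case by (intro exI[of _ "\<lambda>z v. 0"]) (auto intro: smooth_alg.const)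
next
  case (add f g)
  then obtain f' g' where
    "\<forall>z. (f has_derivative f' z) (at z)" "\<forall>v. smooth_alg (\<lambda>z. f' z v)"
    "\<forall>z. (g has_derivative g' z) (at z)" "\<forall>v. smooth_alg (\<lambda>z. g' z v)" by blast
  then show ?case
    by (intro exI[of _ "\<lambda>z v. f' z v + g' z v"]) (auto intro!: has_derivative_add smooth_alg.add)
next
  case (mult f g)
  then obtain f' g' where
    "\<forall>z. (f has_derivative f' z) (at z)" "\<forall>v. smooth_alg (\<lambda>z. f' z v)"
    "\<forall>z. (g has_derivative g' z) (at z)" "\<forall>v. smooth_alg (\<lambda>z. g' z v)" by blast
  then show ?case using mult
    by (intro exI[of _ "\<lambda>z v. f z * g' z v + f' z v * g z"])
       (auto intro!: has_derivative_mult smooth_alg.add smooth_alg.mult)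
next
  case (antideriv A B e a)
  then show ?case
    using smooth_alg.mult[OF antideriv(2) smooth_alg.const]
    by (intro exI[of _ "\<lambda>z v. B (e + z \<bullet> a) * (v \<bullet> a)"])
       (auto intro!: has_derivative_affine_chain)
qed

lemma smooth_alg_smooth_on:
  assumes "smooth_alg f"
  shows "smooth_on UNIV f"
proof -
  have "Ck_on k UNIV f" for k
    using assms
  proof (induction k arbitrary: f)
    case 0
    obtain f' where f': "\<forall>z. (f has_derivative f' z) (at z)"
      using smooth_alg_derivative[OF 0] by blast
    then show ?case
      by (auto intro!: continuous_at_imp_continuous_on intro: has_derivative_continuous)
  next
    case (Suc k)
    obtain f' where f': "\<And>z. (f has_derivative f' z) (at z)" "\<And>v. smooth_alg (\<lambda>z. f' z v)"
      using smooth_alg_derivative[OF Suc.prems] by blast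
    have "frechet_derivative f (at z) = f' z" for z
      using frechet_derivative_at[OF f'(1)] by simp
    then show ?case using f' Suc.IH by (auto intro: differentiableI)
  qed
  then show ?thesis by (simp add: smooth_on_def)
qed

lemma ex_antiderivative:
  fixes f :: "real \<Rightarrow> real"
  assumes "continuous_on UNIV f"
  obtains F where "\<And>x. (F has_real_derivative f x) (at x)"
proof
  fix x :: real
  let ?a = "- \<bar>x\<bar> - 1" and ?b = "\<bar>x\<bar> + 1"
  have "((\<lambda>u. LBINT y=ereal 0..ereal u. f y) has_vector_derivative f x) (at x within {?a..?b})"
    using continuous_on_subset[OF assms, of "{?a..?b}"] by (intro interval_integral_FTC2) auto
  then have "((\<lambda>u. LBINT y=ereal 0..ereal u. f y) has_vector_derivative f x) (at x)"
    by (subst (asm) at_within_Icc_at) auto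
  then show "((\<lambda>u. LBINT y=ereal 0..ereal u. f y) has_real_derivative f x) (at x)"
    by (simp add: has_real_derivative_iff_has_vector_derivative)
qed

text \<open>The kernel is supplied together with a primitive \<open>A\<close>, because the test function needed
later is a smoothed indicator of a segment, that is, a difference of translates of \<open>A\<close>.\<close>

lemma ex_kernel:
  assumes \<delta>: "\<delta> > 0"
  obtains k A :: "real \<Rightarrow> real" where
    "continuous_on UNIV k" "\<And>x. k x \<ge> 0" "\<And>x. \<bar>x\<bar> \<ge> \<delta> \<Longrightarrow> k x = 0"
    "(\<integral>\<^sup>+x. ennreal (k x) \<partial>lborel) = 1"
    "\<And>x. (A has_real_derivative k x) (at x)"
    "\<And>e a. smooth_alg (\<lambda>z. k (e + z \<bullet> a))" "\<And>e a. smooth_alg (\<lambda>z. A (e + z \<bullet> a))"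
proof -
  define k0 where "k0 = (\<lambda>x. flat 1 (\<delta> + x) * flat 1 (\<delta> - x))"
  have contflat: "continuous_on UNIV (flat p)" for p
    using DERIV_isCont[OF DERIV_flat] by (auto intro: continuous_at_imp_continuous_on)
  have cont: "continuous_on UNIV k0"
    unfolding k0_def
    by (intro continuous_on_mult continuous_on_compose2[OF contflat] continuous_intros) auto
  have nn: "k0 x \<ge> 0" for x by (simp add: k0_def flat_def)
  have pos: "k0 x > 0" if "\<bar>x\<bar> < \<delta>" for x using that by (simp add: k0_def flat_def)
  have zero: "k0 x = 0" if "\<bar>x\<bar> \<ge> \<delta>" for x using that by (auto simp: k0_def flat_def)
  have sm: "smooth_alg (\<lambda>z. k0 (e + z \<bullet> a))" for e a
    using smooth_alg.mult[OF smooth_alg.flat[of 1 "\<delta> + e" a] smooth_alg.flat[of 1 "\<delta> - e" "- a"]]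
    by (simp add: k0_def algebra_simps)
  obtain A0 where A0: "\<And>x. (A0 has_real_derivative k0 x) (at x)"
    using ex_antiderivative[OF cont] by blast
  define Z where "Z = A0 \<delta> - A0 (- \<delta>)"
  have "A0 (- \<delta>) < A0 \<delta>"
  proof (rule DERIV_pos_imp_increasing_open[where f = A0])
    show "- \<delta> < \<delta>" using \<delta> by simp
    show "\<exists>y. (A0 has_real_derivative y) (at x) \<and> 0 < y" if "- \<delta> < x" "x < \<delta>" for x
      using A0[of x] pos[of x] that by (intro exI[of _ "k0 x"]) auto
    show "continuous_on {- \<delta>..\<delta>} A0"
      using DERIV_isCont[OF A0] by (auto intro: continuous_at_imp_continuous_on)
  qed
  then have Z: "Z > 0" by (simp add: Z_def)
  have "(\<integral>\<^sup>+x. ennreal (k0 x) \<partial>lborel) = (\<integral>\<^sup>+x. ennreal (k0 x) * indicator {- \<delta>..\<delta>} x \<partial>lborel)"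
    using zero by (intro nn_integral_cong) (auto simp: indicator_def abs_le_iff)
  also have "\<dots> = ennreal Z"
    unfolding Z_def using cont nn A0 \<delta>
    by (intro nn_integral_FTC_Icc) (auto intro!: borel_measurable_continuous_onI has_field_derivative_at_within)
  finally have int: "(\<integral>\<^sup>+x. ennreal (k0 x) \<partial>lborel) = ennreal Z" .
  show ?thesis
  proof (rule that[of "\<lambda>x. 1 / Z * k0 x" "\<lambda>x. 1 / Z * A0 x"])
    show "continuous_on UNIV (\<lambda>x. 1 / Z * k0 x)" using cont by (intro continuous_intros)
    show "1 / Z * k0 x \<ge> 0" for x using nn Z by simp
    show "1 / Z * k0 x = 0" if "\<bar>x\<bar> \<ge> \<delta>" for x using zero that by simp
    show "(\<integral>\<^sup>+x. ennreal (1 / Z * k0 x) \<partial>lborel) = 1"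
      using Z nn int cont borel_measurable_continuous_onI[OF cont]
      by (simp add: ennreal_mult nn_integral_cmult del: times_divide_eq_left)
         (simp flip: ennreal_mult)
    show "((\<lambda>x. 1 / Z * A0 x) has_real_derivative 1 / Z * k0 x) (at x)" for x
      using A0 by (rule DERIV_cmult)
    show "smooth_alg (\<lambda>z. 1 / Z * k0 (e + z \<bullet> a))" for e a
      by (intro smooth_alg.mult smooth_alg.const sm)
    show "smooth_alg (\<lambda>z. 1 / Z * A0 (e + z \<bullet> a))" for e a
      by (intro smooth_alg.mult smooth_alg.const smooth_alg.antideriv[OF A0] sm)
  qed
qed

section \<open>Mollification and increments along lines\<close>

lemma nn_integral_lborel_translate:
  fixes c :: "'a::euclidean_space"
  assumes [measurable]: "F \<in> borel_measurable borel"
  shows "(\<integral>\<^sup>+z. F (c + z) \<partial>lborel) = (\<integral>\<^sup>+z. F z \<partial>lborel)"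
proof -
  have "(\<integral>\<^sup>+z. F z \<partial>lborel) = (\<integral>\<^sup>+z. F z \<partial>distr lborel borel ((+) c))"
    by (simp add: lborel_distr_plus)
  also have "\<dots> = (\<integral>\<^sup>+z. F (c + z) \<partial>lborel)" by (subst nn_integral_distr) auto
  finally show ?thesis by simp
qed

lemma integral_lborel_translate:
  fixes c :: "'a::euclidean_space" and F :: "'a \<Rightarrow> 'b::{banach, second_countable_topology}"
  assumes [measurable]: "F \<in> borel_measurable borel"
  shows "(\<integral>z. F (c + z) \<partial>lborel) = (\<integral>z. F z \<partial>lborel)"
proof -
  have "(\<integral>z. F z \<partial>lborel) = (\<integral>z. F z \<partial>distr lborel borel ((+) c))"
    by (simp add: lborel_distr_plus)
  also have "\<dots> = (\<integral>z. F (c + z) \<partial>lborel)" by (subst integral_distr) auto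
  finally show ?thesis by simp
qed

lemma norm_integral_le_nn_integral:
  fixes f :: "'a \<Rightarrow> 'b::{banach, second_countable_topology}"
  shows "ennreal (norm (\<integral>x. f x \<partial>M)) \<le> (\<integral>\<^sup>+x. ennreal (norm (f x)) \<partial>M)"
  by (cases "integrable M f") (simp_all add: integral_norm_bound_ennreal not_integrable_integral_eq)

locale mollifier =
  fixes \<delta> :: real and k A :: "real \<Rightarrow> real"
  assumes \<delta>: "\<delta> > 0" and cont_k: "continuous_on UNIV k" and k_nonneg: "\<And>x. k x \<ge> 0"
    and k_zero: "\<And>x. \<bar>x\<bar> \<ge> \<delta> \<Longrightarrow> k x = 0" and k_int: "(\<integral>\<^sup>+x. ennreal (k x) \<partial>lborel) = 1"
    and A: "\<And>x. (A has_real_derivative k x) (at x)"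
    and smooth_k: "\<And>e a. smooth_alg (\<lambda>z. k (e + z \<bullet> a))"
    and smooth_A: "\<And>e a. smooth_alg (\<lambda>z. A (e + z \<bullet> a))"
begin

definition \<eta> :: "complex \<Rightarrow> real" where "\<eta> z = k (Re z) * k (Im z)"

lemma k_measurable [measurable]: "k \<in> borel_measurable borel"
  using cont_k by (rule borel_measurable_continuous_onI)

lemma \<eta>_measurable [measurable]: "\<eta> \<in> borel_measurable borel"
  unfolding \<eta>_def by measurable

lemma cont_\<eta>: "continuous_on UNIV \<eta>"
  unfolding \<eta>_def by (intro continuous_intros continuous_on_compose2[OF cont_k]) auto

lemma \<eta>_nonneg: "\<eta> z \<ge> 0"
  by (simp add: \<eta>_def k_nonneg)

lemma \<eta>_zero: "\<bar>Re z\<bar> \<ge> \<delta> \<or> \<bar>Im z\<bar> \<ge> \<delta> \<Longrightarrow> \<eta> z = 0"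
  by (auto simp: \<eta>_def k_zero)

lemma \<eta>_frame: "axis_frame v w \<Longrightarrow> \<eta> z = k (z \<bullet> v) * k (z \<bullet> w)"
  by (auto simp: \<eta>_def axis_frame_def inner_complex_def)

lemma \<eta>_int: "(\<integral>\<^sup>+z. ennreal (\<eta> z) \<partial>lborel) = 1"
proof -
  have "axis_frame 1 \<i>" by (simp add: axis_frame_def)
  then have "(\<integral>\<^sup>+z. ennreal (\<eta> z) \<partial>lborel) = (\<integral>\<^sup>+t. \<integral>\<^sup>+s. ennreal (k s) * ennreal (k t) \<partial>lborel \<partial>lborel)"
    by (subst nn_integral_axis_frame) (auto simp: \<eta>_def ennreal_mult k_nonneg)
  also have "\<dots> = 1" by (simp add: nn_integral_multc k_int)
  finally show ?thesis .
qed

text \<open>The integral of the bump \<open>\<eta>\<close> translated along the segment from \<open>c\<close> to \<open>c + t v\<close>. Its derivative along \<open>v\<close> is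
the difference of the bumps at the two ends.\<close>

definition strip_test :: "complex \<Rightarrow> complex \<Rightarrow> complex \<Rightarrow> real \<Rightarrow> complex \<Rightarrow> real" where
  "strip_test v w c t z = (A (z \<bullet> v - c \<bullet> v) - A (z \<bullet> v - c \<bullet> v - t)) * k (z \<bullet> w - c \<bullet> w)"

lemma strip_test_smooth: "smooth_on UNIV (strip_test v w c t)"
proof -
  have "smooth_alg (\<lambda>z. (A (- (c \<bullet> v) + z \<bullet> v) + (-1) * A (- (c \<bullet> v) - t + z \<bullet> v)) * k (- (c \<bullet> w) + z \<bullet> w))"
    by (intro smooth_alg.mult smooth_alg.add smooth_alg.const smooth_k smooth_A)
  moreover have "(\<lambda>z. (A (- (c \<bullet> v) + z \<bullet> v) + (-1) * A (- (c \<bullet> v) - t + z \<bullet> v)) * k (- (c \<bullet> w) + z \<bullet> w)) = strip_test v w c t"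
    by (simp add: strip_test_def fun_eq_iff algebra_simps)
  ultimately show ?thesis using smooth_alg_smooth_on by metis
qed

lemma strip_test_derivative:
  assumes fr: "axis_frame v w"
  shows "frechet_derivative (strip_test v w c t) (at z) v = \<eta> (z - c) - \<eta> (z - (c + t *\<^sub>R v))"
proof -
  note ip = axis_frame_inner[OF fr]
  have "((\<lambda>s. strip_test v w c t (z + s *\<^sub>R v)) has_vector_derivative frechet_derivative (strip_test v w c t) (at z) v) (at 0)"
    by (rule smooth_on_directional_derivative(3)[OF strip_test_smooth])
  moreover have "((\<lambda>s. strip_test v w c t (z + s *\<^sub>R v)) has_vector_derivative
      (k (z \<bullet> v - c \<bullet> v) - k (z \<bullet> v - c \<bullet> v - t)) * k (z \<bullet> w - c \<bullet> w)) (at 0)"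
    unfolding strip_test_def has_real_derivative_iff_has_vector_derivative[symmetric]
    by (auto intro!: derivative_eq_intros DERIV_chain2[OF A] simp: inner_add_left ip)
  ultimately have "frechet_derivative (strip_test v w c t) (at z) v
      = (k (z \<bullet> v - c \<bullet> v) - k (z \<bullet> v - c \<bullet> v - t)) * k (z \<bullet> w - c \<bullet> w)"
    by (rule vector_derivative_unique_at)
  then show ?thesis
    using \<eta>_frame[OF fr] by (simp add: inner_diff_left inner_add_left ip algebra_simps)
qed

lemma strip_test_eq_nn_integral:
  assumes fr: "axis_frame v w" and t: "t \<ge> 0"
  shows "ennreal (strip_test v w c t z) = (\<integral>\<^sup>+s. ennreal (\<eta> (z - (c + s *\<^sub>R v))) * indicator {0..t} s \<partial>lborel)"
proof -
  note ip = axis_frame_inner[OF fr]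
  define x where "x = z \<bullet> v - c \<bullet> v"
  have "(\<integral>\<^sup>+s. ennreal (k (x - s)) * indicator {0..t} s \<partial>lborel) = ennreal (- A (x - t) - (- A (x - 0)))"
  proof (rule nn_integral_FTC_Icc[where F = "\<lambda>s. - A (x - s)"])
    show "((\<lambda>s. - A (x - s)) has_real_derivative k (x - s)) (at s)" for s
      by (auto intro!: derivative_eq_intros DERIV_chain2[OF A])
  qed (use t k_nonneg in auto)
  then have 1: "(\<integral>\<^sup>+s. ennreal (k (x - s)) * indicator {0..t} s \<partial>lborel) = ennreal (A x - A (x - t))" by simp
  have "A (x - t) \<le> A x"
    by (rule DERIV_nonneg_imp_nondecreasing[of "x - t" x A]) (use t A k_nonneg in auto)
  then have "ennreal (strip_test v w c t z) = ennreal (A x - A (x - t)) * ennreal (k (z \<bullet> w - c \<bullet> w))"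
    by (simp add: strip_test_def x_def ennreal_mult k_nonneg)
  also have "\<dots> = (\<integral>\<^sup>+s. ennreal (k (x - s)) * indicator {0..t} s * ennreal (k (z \<bullet> w - c \<bullet> w)) \<partial>lborel)"
    unfolding 1[symmetric] by (rule nn_integral_multc[symmetric]) measurable
  also have "\<dots> = (\<integral>\<^sup>+s. ennreal (\<eta> (z - (c + s *\<^sub>R v))) * indicator {0..t} s \<partial>lborel)"
    using \<eta>_frame[OF fr]
    by (intro nn_integral_cong)
       (simp add: x_def inner_diff_left inner_add_left ip ennreal_mult k_nonneg algebra_simps)
  finally show ?thesis .
qed

lemma strip_test_nonneg:
  assumes "t \<ge> 0"
  shows "strip_test v w c t z \<ge> 0"
proof -
  have "A (z \<bullet> v - c \<bullet> v - t) \<le> A (z \<bullet> v - c \<bullet> v)"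
    by (rule DERIV_nonneg_imp_nondecreasing[of _ _ A]) (use assms A k_nonneg in auto)
  then show ?thesis by (simp add: strip_test_def k_nonneg)
qed

lemma strip_test_is_test_function:
  assumes fr: "axis_frame v w" and t: "t \<ge> 0"
    and inside: "\<And>s y. s \<in> {0..t} \<Longrightarrow> \<bar>Re y\<bar> \<le> \<delta> \<Longrightarrow> \<bar>Im y\<bar> \<le> \<delta> \<Longrightarrow> c + s *\<^sub>R v + y \<in> U"
  shows "test_function U (strip_test v w c t)"
proof -
  define Q where "Q = {z::complex. - \<delta> \<le> z \<bullet> v - c \<bullet> v \<and> z \<bullet> v - c \<bullet> v \<le> t + \<delta> \<and> \<bar>z \<bullet> w - c \<bullet> w\<bar> \<le> \<delta>}"
  have "closed Q"
    unfolding Q_def by (intro closed_Collect_conj closed_Collect_le continuous_intros)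
  have QU: "Q \<subseteq> U"
  proof
    fix z assume z: "z \<in> Q"
    define s where "s = max 0 (min t (z \<bullet> v - c \<bullet> v))"
    define y where "y = z - c - s *\<^sub>R v"
    have s: "s \<in> {0..t}" using t by (auto simp: s_def)
    have "\<bar>y \<bullet> v\<bar> \<le> \<delta>" "\<bar>y \<bullet> w\<bar> \<le> \<delta>"
      using z t \<delta> by (auto simp: y_def s_def Q_def inner_diff_left axis_frame_inner[OF fr] split: split_max split_min)
    then have "\<bar>Re y\<bar> \<le> \<delta>" "\<bar>Im y\<bar> \<le> \<delta>" using fr by (auto simp: axis_frame_def inner_complex_def)
    from inside[OF s this] show "z \<in> U" by (simp add: y_def)
  qed
  have bQ: "bounded Q"
  proof (rule boundedI)
    fix z assume z: "z \<in> Q"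
    have "norm z \<le> norm ((z \<bullet> v) *\<^sub>R v) + norm ((z \<bullet> w) *\<^sub>R w)"
      using axis_frame_decomp[OF fr, of z] norm_triangle_ineq[of "(z \<bullet> v) *\<^sub>R v" "(z \<bullet> w) *\<^sub>R w"] by simp
    then show "norm z \<le> \<bar>c \<bullet> v\<bar> + t + \<delta> + \<bar>c \<bullet> w\<bar> + \<delta>"
      using z t \<delta> axis_frame_inner[OF fr] by (auto simp: Q_def)
  qed
  have supp: "{z. strip_test v w c t z \<noteq> 0} \<subseteq> Q"
  proof
    fix z assume "z \<in> {z. strip_test v w c t z \<noteq> 0}"
    then have nz: "strip_test v w c t z \<noteq> 0" by simp
    then have "\<bar>z \<bullet> w - c \<bullet> w\<bar> < \<delta>" using k_zero[of "z \<bullet> w - c \<bullet> w"] by (force simp: strip_test_def)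
    moreover have "\<not> (z \<bullet> v - c \<bullet> v < - \<delta> \<or> t + \<delta> < z \<bullet> v - c \<bullet> v)"
    proof
      assume *: "z \<bullet> v - c \<bullet> v < - \<delta> \<or> t + \<delta> < z \<bullet> v - c \<bullet> v"
      have "\<eta> (z - (c + s *\<^sub>R v)) = 0" if "s \<in> {0..t}" for s
        using * that \<delta> k_zero[of "z \<bullet> v - c \<bullet> v - s"]
        by (auto simp: \<eta>_frame[OF fr] inner_diff_left inner_add_left axis_frame_inner[OF fr] algebra_simps)
      then have "ennreal (strip_test v w c t z) = (\<integral>\<^sup>+s. 0 \<partial>(lborel :: real measure))"
        unfolding strip_test_eq_nn_integral[OF fr t] by (intro nn_integral_cong) (auto simp: indicator_def)
      then show False using nz strip_test_nonneg[OF t, of v w c z] by simp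
    qed
    ultimately show "z \<in> Q" by (auto simp: Q_def)
  qed
  let ?C = "closure {z. strip_test v w c t z \<noteq> 0}"
  have CQ: "?C \<subseteq> Q" using closure_minimal[OF supp \<open>closed Q\<close>] .
  have "compact Q" using \<open>closed Q\<close> bQ by (simp add: compact_eq_bounded_closed)
  then have "compact (Q \<inter> ?C)" by (rule compact_Int_closed) simp
  moreover have "Q \<inter> ?C = ?C" using CQ by (rule Int_absorb1)
  ultimately show ?thesis
    using strip_test_smooth CQ QU unfolding test_function_def by auto
qed

definition moll :: "(complex \<Rightarrow> complex) \<Rightarrow> complex \<Rightarrow> complex" where
  "moll h c = (\<integral>y. \<eta> y *\<^sub>R (indicator (ball 0 1) (c + y) *\<^sub>R h (c + y)) \<partial>lborel)"

definition moll_nn :: "(complex \<Rightarrow> ennreal) \<Rightarrow> complex \<Rightarrow> ennreal" where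
  "moll_nn G c = (\<integral>\<^sup>+y. ennreal (\<eta> y) * G (c + y) \<partial>lborel)"

lemma moll_nn_measurable [measurable]:
  assumes [measurable]: "G \<in> borel_measurable borel"
  shows "moll_nn G \<in> borel_measurable borel"
  unfolding moll_nn_def by measurable

text \<open>Testing the weak derivative with \<open>strip_test\<close> turns the left-hand side of the definition into the increment
of the mollified function and the right-hand side into an average of \<open>g\<close> over the segment. Working with a
nonnegative Borel function \<open>G\<close> that agrees with the norm of \<open>g\<close> almost everywhere makes the
interchange of integrals free.\<close>

lemma moll_increment_le:
  assumes fr: "axis_frame v w" and cont: "continuous_on (cball 0 1) h"
    and weak: "weak_directional_deriv (ball 0 1) v h g"
    and [measurable]: "G \<in> borel_measurable borel"
    and G: "AE z in lborel. indicator (ball 0 1) z * ennreal (norm (g z)) = G z"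
    and t: "t \<ge> 0"
    and inside: "\<And>s y. s \<in> {0..t} \<Longrightarrow> \<bar>Re y\<bar> \<le> \<delta> \<Longrightarrow> \<bar>Im y\<bar> \<le> \<delta> \<Longrightarrow> c + s *\<^sub>R v + y \<in> ball 0 1"
  shows "ennreal (norm (moll h (c + t *\<^sub>R v) - moll h c)) \<le> (\<integral>\<^sup>+s. moll_nn G (c + s *\<^sub>R v) * indicator {0..t} s \<partial>lborel)"
proof -
  let ?U = "ball 0 1 :: complex set"
  let ?h = "\<lambda>z. indicator ?U z *\<^sub>R h z"
  have "set_integrable lborel (cball 0 1) h"
    unfolding set_integrable_def by (rule borel_integrable_compact) (auto intro: cont)
  then have int_h: "set_integrable lborel ?U h" by (rule set_integrable_subset) auto
  have [measurable]: "?h \<in> borel_measurable borel"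
    using int_h unfolding set_integrable_def by (auto dest: borel_measurable_integrable)
  have moll_alt: "moll h q = (\<integral>z. \<eta> (z - q) *\<^sub>R ?h z \<partial>lborel)" for q
  proof -
    have "(\<lambda>z. \<eta> (z - q) *\<^sub>R ?h z) \<in> borel_measurable borel" by measurable
    from integral_lborel_translate[OF this, of q] show ?thesis unfolding moll_def by simp
  qed
  have int_eta: "integrable lborel (\<lambda>z. \<eta> (z - q) *\<^sub>R ?h z)" for q
  proof -
    have "set_integrable lborel (cball 0 1) (\<lambda>z. \<eta> (z - q) *\<^sub>R h z)"
      unfolding set_integrable_def
      by (rule borel_integrable_compact)
         (auto intro!: continuous_intros cont continuous_on_compose2[OF cont_\<eta>])
    then have "set_integrable lborel ?U (\<lambda>z. \<eta> (z - q) *\<^sub>R h z)" by (rule set_integrable_subset) auto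
    then show ?thesis by (simp add: set_integrable_def mult.commute)
  qed
  define \<zeta> where "\<zeta> = strip_test v w c t"
  have "test_function ?U \<zeta>" unfolding \<zeta>_def using fr t inside by (rule strip_test_is_test_function)
  then have eq: "set_lebesgue_integral lebesgue ?U (\<lambda>z. frechet_derivative \<zeta> (at z) v *\<^sub>R h z) =
        - set_lebesgue_integral lebesgue ?U (\<lambda>z. \<zeta> z *\<^sub>R g z)"
    using weak unfolding weak_directional_deriv_def by blast
  have "set_lebesgue_integral lebesgue ?U (\<lambda>z. frechet_derivative \<zeta> (at z) v *\<^sub>R h z)
      = (\<integral>z. \<eta> (z - c) *\<^sub>R ?h z - \<eta> (z - (c + t *\<^sub>R v)) *\<^sub>R ?h z \<partial>lebesgue)"
    unfolding set_lebesgue_integral_def \<zeta>_def strip_test_derivative[OF fr]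
    by (intro Bochner_Integration.integral_cong) (auto simp: scaleR_diff_left algebra_simps)
  also have "\<dots> = (\<integral>z. \<eta> (z - c) *\<^sub>R ?h z - \<eta> (z - (c + t *\<^sub>R v)) *\<^sub>R ?h z \<partial>lborel)"
    by (rule integral_completion) measurable
  also have "\<dots> = moll h c - moll h (c + t *\<^sub>R v)"
    unfolding moll_alt by (rule Bochner_Integration.integral_diff[OF int_eta int_eta])
  finally have "ennreal (norm (moll h (c + t *\<^sub>R v) - moll h c))
      = ennreal (norm (set_lebesgue_integral lebesgue ?U (\<lambda>z. \<zeta> z *\<^sub>R g z)))"
    using eq by (metis norm_minus_cancel norm_minus_commute)
  also have "\<dots> \<le> (\<integral>\<^sup>+z. ennreal (norm (indicator ?U z *\<^sub>R (\<zeta> z *\<^sub>R g z))) \<partial>lebesgue)"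
    unfolding set_lebesgue_integral_def by (rule norm_integral_le_nn_integral)
  also have "\<dots> = (\<integral>\<^sup>+z. ennreal (\<zeta> z) * G z \<partial>lebesgue)"
  proof (rule nn_integral_cong_AE)
    have "AE z in lebesgue. indicator ?U z * ennreal (norm (g z)) = G z" using G by (rule AE_completion)
    then show "AE z in lebesgue. ennreal (norm (indicator ?U z *\<^sub>R (\<zeta> z *\<^sub>R g z))) = ennreal (\<zeta> z) * G z"
    proof eventually_elim
      case (elim z)
      then show ?case
        using strip_test_nonneg[OF t, of v w c z]
        by (auto simp: \<zeta>_def ennreal_mult indicator_def split: if_splits)
    qed
  qed
  also have "\<dots> = (\<integral>\<^sup>+z. ennreal (\<zeta> z) * G z \<partial>lborel)"
    by (rule nn_integral_completion)
  also have "\<dots> = (\<integral>\<^sup>+z. \<integral>\<^sup>+s. ennreal (\<eta> (z - (c + s *\<^sub>R v))) * indicator {0..t} s * G z \<partial>lborel \<partial>lborel)"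
    unfolding \<zeta>_def strip_test_eq_nn_integral[OF fr t] by (subst nn_integral_multc) auto
  also have "\<dots> = (\<integral>\<^sup>+s. \<integral>\<^sup>+z. ennreal (\<eta> (z - (c + s *\<^sub>R v))) * indicator {0..t} s * G z \<partial>lborel \<partial>lborel)"
    by (rule lborel_pair.Fubini') measurable
  also have "\<dots> = (\<integral>\<^sup>+s. moll_nn G (c + s *\<^sub>R v) * indicator {0..t} s \<partial>lborel)"
  proof (rule nn_integral_cong)
    fix s :: real
    have "(\<integral>\<^sup>+z. ennreal (\<eta> (z - (c + s *\<^sub>R v))) * indicator {0..t} s * G z \<partial>lborel)
        = (\<integral>\<^sup>+z. ennreal (\<eta> (z - (c + s *\<^sub>R v))) * G z * indicator {0..t} s \<partial>lborel)"
      by (intro nn_integral_cong) (simp add: ac_simps)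
    also have "\<dots> = (\<integral>\<^sup>+z. ennreal (\<eta> (z - (c + s *\<^sub>R v))) * G z \<partial>lborel) * indicator {0..t} s"
      by (rule nn_integral_multc) measurable
    also have "(\<integral>\<^sup>+z. ennreal (\<eta> (z - (c + s *\<^sub>R v))) * G z \<partial>lborel) = moll_nn G (c + s *\<^sub>R v)"
      unfolding moll_nn_def
      using nn_integral_lborel_translate[of "\<lambda>z. ennreal (\<eta> (z - (c + s *\<^sub>R v))) * G z" "c + s *\<^sub>R v"]
      by simp
    finally show "(\<integral>\<^sup>+z. ennreal (\<eta> (z - (c + s *\<^sub>R v))) * indicator {0..t} s * G z \<partial>lborel)
      = moll_nn G (c + s *\<^sub>R v) * indicator {0..t} s" .
  qed
  finally show ?thesis .
qed

text \<open>Mollification is an average over translations, so it does not increase the \<open>L\<^sup>2\<close> norm. This makes the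
energy bound uniform in the mollification.\<close>

lemma moll_nn_square_le:
  assumes [measurable]: "G \<in> borel_measurable borel"
  shows "(\<integral>\<^sup>+c. (moll_nn G c)\<^sup>2 \<partial>lborel) \<le> (\<integral>\<^sup>+z. (G z)\<^sup>2 \<partial>lborel)"
proof -
  have pt: "(moll_nn G c)\<^sup>2 \<le> (\<integral>\<^sup>+y. ennreal (\<eta> y) * (G (c + y))\<^sup>2 \<partial>lborel)" for c
  proof -
    have sq: "(ennreal (sqrt (\<eta> y)))\<^sup>2 = ennreal (\<eta> y)" for y
      using \<eta>_nonneg by (simp add: ennreal_power)
    have "moll_nn G c = (\<integral>\<^sup>+y. ennreal (sqrt (\<eta> y)) * (ennreal (sqrt (\<eta> y)) * G (c + y)) \<partial>lborel)"
      unfolding moll_nn_def by (intro nn_integral_cong) (simp add: mult.assoc[symmetric] power2_eq_square[symmetric] sq)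
    then have "(moll_nn G c)\<^sup>2 \<le> (\<integral>\<^sup>+y. (ennreal (sqrt (\<eta> y)))\<^sup>2 \<partial>lborel) * (\<integral>\<^sup>+y. (ennreal (sqrt (\<eta> y)) * G (c + y))\<^sup>2 \<partial>lborel)"
      by (simp only:) (rule Cauchy_Schwarz_nn_integral; measurable)
    also have "\<dots> = (\<integral>\<^sup>+y. ennreal (\<eta> y) * (G (c + y))\<^sup>2 \<partial>lborel)"
      by (simp add: sq \<eta>_int power_mult_distrib)
    finally show ?thesis .
  qed
  have "(\<integral>\<^sup>+c. (moll_nn G c)\<^sup>2 \<partial>lborel) \<le> (\<integral>\<^sup>+c. \<integral>\<^sup>+y. ennreal (\<eta> y) * (G (c + y))\<^sup>2 \<partial>lborel \<partial>lborel)"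
    by (intro nn_integral_mono pt)
  also have "\<dots> = (\<integral>\<^sup>+y. \<integral>\<^sup>+c. ennreal (\<eta> y) * (G (c + y))\<^sup>2 \<partial>lborel \<partial>lborel)"
    by (rule lborel_pair.Fubini') measurable
  also have "\<dots> = (\<integral>\<^sup>+y. ennreal (\<eta> y) * (\<integral>\<^sup>+z. (G z)\<^sup>2 \<partial>lborel) \<partial>lborel)"
  proof (rule nn_integral_cong)
    fix y
    have "(\<integral>\<^sup>+c. ennreal (\<eta> y) * (G (c + y))\<^sup>2 \<partial>lborel) = ennreal (\<eta> y) * (\<integral>\<^sup>+c. (G (c + y))\<^sup>2 \<partial>lborel)"
      by (rule nn_integral_cmult) measurable
    also have "(\<integral>\<^sup>+c. (G (c + y))\<^sup>2 \<partial>lborel) = (\<integral>\<^sup>+z. (G z)\<^sup>2 \<partial>lborel)"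
      using nn_integral_lborel_translate[of "\<lambda>z. (G z)\<^sup>2" y] by (simp add: add.commute)
    finally show "(\<integral>\<^sup>+c. ennreal (\<eta> y) * (G (c + y))\<^sup>2 \<partial>lborel) = ennreal (\<eta> y) * (\<integral>\<^sup>+z. (G z)\<^sup>2 \<partial>lborel)" .
  qed
  also have "\<dots> = (\<integral>\<^sup>+z. (G z)\<^sup>2 \<partial>lborel)"
    by (simp add: nn_integral_multc \<eta>_int)
  finally show ?thesis .
qed

lemma moll_approx:
  assumes cont: "continuous_on (cball 0 1) h" and e: "e \<ge> 0"
    and inside: "\<And>y. \<bar>Re y\<bar> \<le> \<delta> \<Longrightarrow> \<bar>Im y\<bar> \<le> \<delta> \<Longrightarrow> c + y \<in> ball 0 1 \<and> norm (h (c + y) - q) \<le> e"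
  shows "norm (moll h c - q) \<le> e"
proof -
  let ?U = "ball 0 1 :: complex set"
  have "set_integrable lborel (cball 0 1) h"
    unfolding set_integrable_def by (rule borel_integrable_compact) (auto intro: cont)
  then have int_h: "set_integrable lborel ?U h" by (rule set_integrable_subset) auto
  have [measurable]: "(\<lambda>z. indicator ?U z *\<^sub>R h z) \<in> borel_measurable borel"
    using int_h unfolding set_integrable_def by (auto dest: borel_measurable_integrable)
  have int_eta: "integrable lborel \<eta>"
    by (rule integrableI_nonneg) (auto simp: \<eta>_nonneg \<eta>_int)
  have eta1: "(\<integral>y. \<eta> y \<partial>lborel) = 1"
    by (subst integral_eq_nn_integral) (auto simp: \<eta>_nonneg \<eta>_int)
  have bd: "norm (\<eta> y *\<^sub>R (indicator ?U (c + y) *\<^sub>R h (c + y) - q)) \<le> e * \<eta> y" for y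
  proof (cases "\<bar>Re y\<bar> \<le> \<delta> \<and> \<bar>Im y\<bar> \<le> \<delta>")
    case True
    then have "norm (indicator ?U (c + y) *\<^sub>R h (c + y) - q) \<le> e" using inside[of y] by auto
    from mult_left_mono[OF this \<eta>_nonneg[of y]] show ?thesis
      using \<eta>_nonneg[of y] by (simp add: mult.commute)
  qed (use \<eta>_zero[of y] in auto)
  have int1: "integrable lborel (\<lambda>y. \<eta> y *\<^sub>R (indicator ?U (c + y) *\<^sub>R h (c + y) - q))"
  proof (rule Bochner_Integration.integrable_bound)
    show "integrable lborel (\<lambda>y. e * \<eta> y)" using int_eta by simp
    have [measurable]: "(\<lambda>y. indicator ?U (c + y) *\<^sub>R h (c + y)) \<in> borel_measurable borel"
      using measurable_compose[of "\<lambda>y. c + y" borel borel "\<lambda>z. indicator ?U z *\<^sub>R h z"] by simp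
    show "(\<lambda>y. \<eta> y *\<^sub>R (indicator ?U (c + y) *\<^sub>R h (c + y) - q)) \<in> borel_measurable lborel"
      by measurable
    show "AE y in lborel. norm (\<eta> y *\<^sub>R (indicator ?U (c + y) *\<^sub>R h (c + y) - q)) \<le> norm (e * \<eta> y)"
      using bd e \<eta>_nonneg by (intro AE_I2) (auto intro: order_trans[OF _ abs_ge_self])
  qed
  have "moll h c = (\<integral>y. \<eta> y *\<^sub>R (indicator ?U (c + y) *\<^sub>R h (c + y) - q) + \<eta> y *\<^sub>R q \<partial>lborel)"
    unfolding moll_def by (intro Bochner_Integration.integral_cong) (auto simp: scaleR_diff_right)
  also have "\<dots> = (\<integral>y. \<eta> y *\<^sub>R (indicator ?U (c + y) *\<^sub>R h (c + y) - q) \<partial>lborel) + q"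
    using int1 int_eta by (subst Bochner_Integration.integral_add) (auto simp: eta1)
  finally have "norm (moll h c - q) = norm (\<integral>y. \<eta> y *\<^sub>R (indicator ?U (c + y) *\<^sub>R h (c + y) - q) \<partial>lborel)"
    by simp
  also have "\<dots> \<le> (\<integral>y. e * \<eta> y \<partial>lborel)"
    using int_eta by (intro Bochner_Integration.integral_norm_bound_integral[OF int1 _ bd]) auto
  also have "\<dots> = e" by (simp add: eta1)
  finally show ?thesis .
qed

end

lemma mollifier_exists:
  assumes "\<delta> > 0"
  obtains k A where "mollifier \<delta> k A"
proof -
  obtain k A where "continuous_on UNIV k" "\<And>x. k x \<ge> 0" "\<And>x. \<bar>x\<bar> \<ge> \<delta> \<Longrightarrow> k x = 0"
    "(\<integral>\<^sup>+x. ennreal (k x) \<partial>lborel) = 1"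
    "\<And>x. (A has_real_derivative k x) (at x)"
    "\<And>e a. smooth_alg (\<lambda>z. k (e + z \<bullet> a))" "\<And>e a. smooth_alg (\<lambda>z. A (e + z \<bullet> a))"
    using ex_kernel[OF assms] by blast
  then have "mollifier \<delta> k A" using assms by unfold_locales
  then show ?thesis by (rule that)
qed

section \<open>Geometry of the boundary near the cusp and away from it\<close>

text \<open>The data of the cusp at \<open>p\<close> in the given position; \<open>coord\<close> below is the rigid motion that brings it to the standard
position.\<close>

locale cusp_geometry =
  fixes \<Omega> :: "complex set" and p u :: complex and r \<beta> :: real
  assumes open_\<Omega>: "open \<Omega>" and norm_u: "norm u = 1" and r_pos: "r > 0" and \<beta>_gt_1: "\<beta> > 1"
    and cusp: "(- \<Omega>) \<inter> ball p r = ((\<lambda>z. p + u * z) ` cusp_region \<beta>) \<inter> ball p r"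
begin

definition coord :: "complex \<Rightarrow> complex" where "coord w = cnj u * (w - p)"

lemma u_cnj: "u * cnj u = 1"
  using norm_u by (simp add: complex_norm_square[symmetric])

lemma coord_inverse: "p + u * coord w = w" "coord (p + u * z) = z"
  using u_cnj by (simp_all add: coord_def mult.assoc[symmetric]) (simp add: mult.commute)

lemma norm_coord: "norm (coord w) = dist p w" "dist p (p + u * z) = norm z"
  by (simp_all add: coord_def norm_mult norm_u dist_norm norm_minus_commute)

lemma norm_coord_diff: "norm (coord w - coord w') = dist w w'"
proof -
  have "coord w - coord w' = cnj u * (w - w')" by (simp add: coord_def algebra_simps)
  then show ?thesis by (simp add: norm_mult norm_u dist_norm)
qed

lemma continuous_coord: "continuous_on S coord"
  unfolding coord_def by (intro continuous_intros)

lemma notin_\<Omega>_iff: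
  assumes "w \<in> ball p r"
  shows "w \<notin> \<Omega> \<longleftrightarrow> 0 \<le> Re (coord w) \<and> \<bar>Im (coord w)\<bar> \<le> Re (coord w) powr \<beta>"
proof -
  have "w \<notin> \<Omega> \<longleftrightarrow> w \<in> (\<lambda>z. p + u * z) ` cusp_region \<beta>"
    using arg_cong[OF cusp, of "\<lambda>A. w \<in> A"] assms by simp
  also have "\<dots> \<longleftrightarrow> coord w \<in> cusp_region \<beta>"
  proof
    assume "w \<in> (\<lambda>z. p + u * z) ` cusp_region \<beta>"
    then show "coord w \<in> cusp_region \<beta>" by (auto simp: coord_inverse)
  next
    assume "coord w \<in> cusp_region \<beta>"
    then have "p + u * coord w \<in> (\<lambda>z. p + u * z) ` cusp_region \<beta>" by (rule imageI)
    then show "w \<in> (\<lambda>z. p + u * z) ` cusp_region \<beta>" by (simp only: coord_inverse)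
  qed
  finally show ?thesis by (simp add: cusp_region_def)
qed

text \<open>The interior of the cusp is open and disjoint from the domain. This is the separation that
keeps the two branches apart.\<close>

lemma closure_\<Omega>_local:
  assumes w: "w \<in> ball p r" "w \<in> closure \<Omega>" and pos: "0 < Re (coord w)"
  shows "Re (coord w) powr \<beta> \<le> \<bar>Im (coord w)\<bar>"
proof (rule ccontr)
  assume neg: "\<not> ?thesis"
  define W where "W = ball p r \<inter> {w. 0 < Re (coord w)} \<inter> {w. \<bar>Im (coord w)\<bar> < max 0 (Re (coord w)) powr \<beta>}"
  have "open W"
    unfolding W_def coord_def using \<beta>_gt_1
    by (intro open_Int open_ball open_Collect_less continuous_intros continuous_on_powr') auto
  moreover have "w \<in> W" using assms neg by (auto simp: W_def)
  moreover have "w' \<notin> \<Omega>" if "w' \<in> W" for w' using notin_\<Omega>_iff[of w'] that by (auto simp: W_def)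
  ultimately show False using w(2) open_Int_closure_eq_empty[of W \<Omega>] by blast
qed

lemma frontier_\<Omega>_local:
  assumes w: "w \<in> ball p r"
  shows "w \<in> frontier \<Omega> \<longleftrightarrow> 0 \<le> Re (coord w) \<and> \<bar>Im (coord w)\<bar> = Re (coord w) powr \<beta>"
proof
  assume "w \<in> frontier \<Omega>"
  then have 1: "w \<in> closure \<Omega>" "w \<notin> \<Omega>" using open_\<Omega> by (auto simp: frontier_def interior_open)
  then have 2: "0 \<le> Re (coord w)" "\<bar>Im (coord w)\<bar> \<le> Re (coord w) powr \<beta>" using notin_\<Omega>_iff w by auto
  then show "0 \<le> Re (coord w) \<and> \<bar>Im (coord w)\<bar> = Re (coord w) powr \<beta>"
    using closure_\<Omega>_local[OF w 1(1)] by (cases "Re (coord w) = 0") auto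
next
  assume R: "0 \<le> Re (coord w) \<and> \<bar>Im (coord w)\<bar> = Re (coord w) powr \<beta>"
  have "w \<notin> \<Omega>" using notin_\<Omega>_iff w R by auto
  moreover have "w \<in> closure \<Omega>"
  proof (rule closure_approachable[THEN iffD2], intro allI impI)
    fix e :: real assume e: "e > 0"
    define s where "s = (if Im (coord w) \<ge> 0 then 1 else - 1 :: real)"
    obtain e' where e': "0 < e'" "e' < e" "e' < r - dist p w"
      using e w dense[of 0 "min e (r - dist p w)"] by auto
    define w' where "w' = p + u * (coord w + Complex 0 (s * e'))"
    have cw': "coord w' = coord w + Complex 0 (s * e')" using coord_inverse by (simp add: w'_def)
    then have d: "dist w' w = e'"
      using norm_coord_diff[of w' w] e' by (auto simp: s_def cmod_def split: if_splits)
    have "w' \<in> ball p r" using dist_triangle[of p w' w] d e' by (simp add: dist_commute)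
    moreover have "\<bar>Im (coord w')\<bar> = \<bar>Im (coord w)\<bar> + e'" using cw' e' by (simp add: s_def)
    moreover have "Re (coord w') = Re (coord w)" using cw' by simp
    ultimately have "w' \<in> \<Omega>" using notin_\<Omega>_iff[of w'] R e' by auto
    then show "\<exists>y\<in>\<Omega>. dist y w < e" using d e' by auto
  qed
  ultimately show "w \<in> frontier \<Omega>" using open_\<Omega> by (simp add: frontier_def interior_open)
qed

definition upper :: "real \<Rightarrow> complex" where "upper x = p + u * Complex x (x powr \<beta>)"
definition lower :: "real \<Rightarrow> complex" where "lower x = p + u * Complex x (- (x powr \<beta>))"

lemma coord_upper: "coord (upper x) = Complex x (x powr \<beta>)"
  and coord_lower: "coord (lower x) = Complex x (- (x powr \<beta>))"
  by (simp_all add: upper_def lower_def coord_inverse)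

lemma upper_0: "upper 0 = p" and lower_0: "lower 0 = p"
  using \<beta>_gt_1 by (simp_all add: upper_def lower_def complex_eq_iff)

lemma continuous_upper: "continuous_on {0..} upper" and continuous_lower: "continuous_on {0..} lower"
  unfolding upper_def lower_def Complex_eq
  using \<beta>_gt_1 by (auto intro!: continuous_intros continuous_on_powr')

lemma norm_cusp_le:
  assumes "0 \<le> x" "x \<le> x1"
  shows "norm (Complex x (x powr \<beta>)) \<le> x1 + x1 powr \<beta>" "norm (Complex x (- (x powr \<beta>))) \<le> x1 + x1 powr \<beta>"
proof -
  have "x powr \<beta> \<le> x1 powr \<beta>" using assms \<beta>_gt_1 by (intro powr_mono2) auto
  then show "norm (Complex x (x powr \<beta>)) \<le> x1 + x1 powr \<beta>" "norm (Complex x (- (x powr \<beta>))) \<le> x1 + x1 powr \<beta>"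
    using cmod_le[of "Complex x (x powr \<beta>)"] cmod_le[of "Complex x (- (x powr \<beta>))"] assms by auto
qed

text \<open>The part of the boundary near the cusp point, a half-open piece of each branch.\<close>

definition tip :: "real \<Rightarrow> complex set" where "tip x1 = upper ` {0..<x1} \<union> lower ` {0..<x1}"

text \<open>In particular the tip is relatively open in the boundary, so its complement is compact.\<close>

lemma tip_eq:
  assumes "x1 + x1 powr \<beta> < r" "0 < x1"
  shows "tip x1 = frontier \<Omega> \<inter> (ball p r \<inter> {w. Re (coord w) < x1})"
proof (intro set_eqI iffI)
  fix w assume "w \<in> tip x1"
  then obtain x where x: "0 \<le> x" "x < x1" and w: "coord w = Complex x (x powr \<beta>) \<or> coord w = Complex x (- (x powr \<beta>))"
    using coord_upper coord_lower by (auto simp: tip_def)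
  have "norm (coord w) < r" using norm_cusp_le[of x x1] x w assms by auto
  then have b: "w \<in> ball p r" by (simp add: norm_coord)
  then show "w \<in> frontier \<Omega> \<inter> (ball p r \<inter> {w. Re (coord w) < x1})"
    using frontier_\<Omega>_local[OF b] w x by auto
next
  fix w assume w: "w \<in> frontier \<Omega> \<inter> (ball p r \<inter> {w. Re (coord w) < x1})"
  let ?x = "Re (coord w)"
  have x: "0 \<le> ?x" "\<bar>Im (coord w)\<bar> = ?x powr \<beta>" "?x < x1" using w frontier_\<Omega>_local[of w] by auto
  then have "coord w = Complex ?x (?x powr \<beta>) \<or> coord w = Complex ?x (- (?x powr \<beta>))"
    by (auto simp: complex_eq_iff)
  then have "w = upper ?x \<or> w = lower ?x"
    unfolding upper_def lower_def using coord_inverse(1)[of w] by metis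
  then show "w \<in> tip x1" using x by (auto simp: tip_def)
qed

end

lemma homeomorphism_punctured_loop:
  fixes g :: "real \<Rightarrow> complex"
  assumes g: "simple_path g" and ends: "g 0 = p" "g 1 = p"
  obtains k where "homeomorphism {0<..<1} (path_image g - {p}) g k"
proof (rule homeomorphism_injective_closed_map)
  have cont: "continuous_on {0..1} g" using g by (simp add: simple_path_def path_def)
  have lf: "x = y \<or> x = 0 \<and> y = 1 \<or> x = 1 \<and> y = 0" if "x \<in> {0..1}" "y \<in> {0..1}" "g x = g y" for x y
    using g that unfolding simple_path_def loop_free_def by blast
  have interior: "g x \<noteq> p" if "x \<in> {0<..<1}" for x using lf[of x 0] that ends by auto
  show "continuous_on {0<..<1} g" by (rule continuous_on_subset[OF cont]) auto
  show img: "g ` {0<..<1} = path_image g - {p}"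
  proof (intro equalityI subsetI)
    fix w assume "w \<in> path_image g - {p}"
    then obtain x where "x \<in> {0..1}" "w = g x" "w \<noteq> p" by (auto simp: path_image_def)
    then have "x \<in> {0<..<1}" using ends by (cases "x = 0"; cases "x = 1") auto
    then show "w \<in> g ` {0<..<1}" using \<open>w = g x\<close> by blast
  next
    fix w assume "w \<in> g ` {0<..<1}"
    then show "w \<in> path_image g - {p}" using interior by (force simp: path_image_def)
  qed
  show "inj_on g {0<..<1}"
  proof (rule inj_onI)
    fix x y :: real assume "x \<in> {0<..<1}" "y \<in> {0<..<1}" "g x = g y"
    then show "x = y" using lf[of x y] by auto
  qed
  fix U :: "real set" assume "closedin (top_of_set {0<..<1}) U"
  then obtain T where T: "closed T" "U = {0<..<1} \<inter> T" by (auto simp: closedin_closed)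
  define V where "V = insert p (g ` ({0..1} \<inter> T))"
  have "compact (g ` ({0..1} \<inter> T))"
    using T by (intro compact_continuous_image continuous_on_subset[OF cont] compact_Int_closed) auto
  then have "closed V" unfolding V_def by (intro closed_insert compact_imp_closed)
  moreover have "g ` U = (path_image g - {p}) \<inter> V"
  proof (intro equalityI subsetI)
    fix w assume "w \<in> g ` U"
    then show "w \<in> (path_image g - {p}) \<inter> V" using T img by (auto simp: V_def)
  next
    fix w assume w: "w \<in> (path_image g - {p}) \<inter> V"
    then obtain x where x: "x \<in> {0..1}" "x \<in> T" "w = g x" by (auto simp: V_def)
    then have "x \<in> {0<..<1}" using ends w by (cases "x = 0"; cases "x = 1") auto
    then show "w \<in> g ` U" using x T by auto
  qed
  ultimately show "closedin (top_of_set (path_image g - {p})) (g ` U)" by (auto simp: closedin_closed)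
qed (use that in blast)

text \<open>A continuous bijection from an interval onto a Jordan curve without a point is a homeomorphism: composed with the
inverse of the Jordan parametrization it becomes an injective map between intervals.\<close>

lemma continuous_inverse_parametrization:
  fixes g \<gamma> :: "real \<Rightarrow> complex"
  assumes "simple_path g" "pathfinish g = pathstart g" "p \<in> path_image g"
    and \<gamma>: "continuous_on {0<..<1} \<gamma>" "inj_on \<gamma> {0<..<1}" "\<gamma> ` {0<..<1} = path_image g - {p}"
  obtains k where "continuous_on (path_image g - {p}) k" "\<And>t. t \<in> {0<..<1} \<Longrightarrow> k (\<gamma> t) = t"
proof -
  obtain a where a: "a \<in> {0..1}" "g a = p" using assms(3) by (auto simp: path_image_def)
  define h where "h = shiftpath a g"
  have h: "simple_path h" "path_image h = path_image g" "h 0 = p" "h 1 = p"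
    using assms(1,2) a simple_path_shiftpath[of g a] path_image_shiftpath[of a g]
      endpoints_shiftpath[of g a, unfolded pathstart_def pathfinish_def]
    unfolding h_def pathstart_def pathfinish_def by simp_all
  obtain k0 where k0: "homeomorphism {0<..<1} (path_image g - {p}) h k0"
    using homeomorphism_punctured_loop[OF h(1,3,4)] unfolding h(2) by blast
  have k0c: "continuous_on (path_image g - {p}) k0" and k0i: "k0 ` (path_image g - {p}) = {0<..<1}"
    and k0h: "\<And>w. w \<in> path_image g - {p} \<Longrightarrow> h (k0 w) = w"
    using homeomorphism_cont2[OF k0] homeomorphism_image2[OF k0] homeomorphism_apply2[OF k0] by auto
  define \<tau> where "\<tau> = k0 \<circ> \<gamma>"
  have "continuous_on {0<..<1} \<tau>"
    unfolding \<tau>_def using \<gamma> k0c by (intro continuous_on_compose) auto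
  moreover have "\<tau> ` {0<..<1} = {0<..<1}" unfolding \<tau>_def using \<gamma>(3) k0i by (metis image_comp)
  moreover have "inj_on \<tau> {0<..<1}"
    unfolding \<tau>_def
  proof (rule comp_inj_on[OF \<gamma>(2)])
    show "inj_on k0 (\<gamma> ` {0<..<1})" unfolding \<gamma>(3) by (metis inj_onI k0h)
  qed
  ultimately obtain \<tau>' where \<tau>': "homeomorphism {0<..<1} {0<..<1} \<tau> \<tau>'"
    using homeomorphism_into_1d[OF convex_imp_path_connected[OF convex_real_interval(8)]] by blast
  show ?thesis
  proof
    show "continuous_on (path_image g - {p}) (\<tau>' \<circ> k0)"
      using k0c homeomorphism_cont2[OF \<tau>'] unfolding k0i[symmetric] by (rule continuous_on_compose)
    show "(\<tau>' \<circ> k0) (\<gamma> t) = t" if "t \<in> {0<..<1}" for t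
      using homeomorphism_apply1[OF \<tau>' that] by (simp add: \<tau>_def)
  qed
qed

lemma smooth_on_lipschitz:
  fixes \<gamma> :: "real \<Rightarrow> complex"
  assumes sm: "smooth_on S \<gamma>" and S: "{a..b} \<subseteq> S"
  obtains M where "M-lipschitz_on {a..b} \<gamma>"
proof -
  have "Ck_on (Suc 0) S \<gamma>" using sm by (simp add: smooth_on_def)
  then have diff: "\<And>t. t \<in> S \<Longrightarrow> \<gamma> differentiable (at t)"
    and contd: "continuous_on S (\<lambda>t. frechet_derivative \<gamma> (at t) 1)" by auto
  have "compact ((\<lambda>t. frechet_derivative \<gamma> (at t) 1) ` {a..b})"
    by (intro compact_continuous_image continuous_on_subset[OF contd S]) auto
  then have "bounded ((\<lambda>t. frechet_derivative \<gamma> (at t) 1) ` {a..b})" by (rule compact_imp_bounded)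
  then obtain M where M: "\<forall>t\<in>{a..b}. norm (frechet_derivative \<gamma> (at t) 1) \<le> M"
    unfolding bounded_iff by auto
  have M': "norm (frechet_derivative \<gamma> (at t) 1) \<le> \<bar>M\<bar>" if "t \<in> {a..b}" for t
    using M that by force
  have "\<bar>M\<bar>-lipschitz_on {a..b} \<gamma>"
  proof (rule bounded_derivative_imp_lipschitz)
    fix t assume t: "t \<in> {a..b}"
    then have d: "(\<gamma> has_derivative frechet_derivative \<gamma> (at t)) (at t)"
      using diff S frechet_derivative_works by blast
    then show "(\<gamma> has_derivative frechet_derivative \<gamma> (at t)) (at t within {a..b})"
      by (rule has_derivative_at_withinI)
    show "onorm (frechet_derivative \<gamma> (at t)) \<le> \<bar>M\<bar>"
    proof (rule onorm_le)
      fix s :: real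
      have "frechet_derivative \<gamma> (at t) s = s *\<^sub>R frechet_derivative \<gamma> (at t) 1"
        using linear_cmul[OF has_derivative_linear[OF d], of s 1] by simp
      then show "norm (frechet_derivative \<gamma> (at t) s) \<le> \<bar>M\<bar> * norm s"
        using mult_left_mono[OF M'[OF t], of "\<bar>s\<bar>"] by (simp add: mult.commute)
    qed
  qed auto
  then show ?thesis by (rule that)
qed

context cusp_geometry
begin

text \<open>The parameters of \<open>\<gamma>\<close> that are not mapped to the tip form a compact set \<open>K\<close>. It is an interval: a gap would be
filled by parameters of one whole branch, which would then stay away from the cusp point although it runs
into it. The end points of \<open>K\<close> are limits of parameters of the tip, hence they are mapped to the two
ends of the branches.\<close>

lemma complementary_arc:
  fixes l x1 :: real
  assumes jd: "jordan_domain \<Omega>" and p: "p \<in> frontier \<Omega>"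
    and sm: "smooth_curve_except_at (frontier \<Omega>) p"
    and x1: "x1 > 0" "x1 + x1 powr \<beta> < r" and l: "l > 0"
  obtains \<Gamma> :: "real \<Rightarrow> complex" and M where "M-lipschitz_on {-l..l} \<Gamma>" "inj_on \<Gamma> {-l..l}"
    "\<Gamma> ` {-l..l} = frontier \<Omega> - tip x1" "\<Gamma> l = upper x1" "\<Gamma> (-l) = lower x1"
    "\<And>y. y \<in> {-l<..<l} \<Longrightarrow> \<Gamma> differentiable (at y)"
proof -
  let ?J = "frontier \<Omega>"
  obtain g where g: "simple_path g" "pathfinish g = pathstart g" "\<Omega> \<in> components (- path_image g)" "bounded \<Omega>"
    using jd by (auto simp: jordan_domain_def)
  have J: "?J = path_image g"
    using Jordan_Brouwer_frontier[OF homeomorphic_simple_path_image_circle[OF g(1,2), of 1] g(3)] by simp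
  obtain \<gamma> where \<gamma>': "smooth_on {0<..<1} \<gamma> \<and> (\<forall>t\<in>{0<..<1}. vector_derivative \<gamma> (at t) \<noteq> 0) \<and>
      inj_on \<gamma> {0<..<1} \<and> \<gamma> ` {0<..<1} = ?J - {p}"
    using sm unfolding smooth_curve_except_at_def by (rule exE)
  note \<gamma> = \<gamma>'[THEN conjunct1] \<gamma>'[THEN conjunct2, THEN conjunct2, THEN conjunct1]
    \<gamma>'[THEN conjunct2, THEN conjunct2, THEN conjunct2]
  have \<gamma>c: "continuous_on {0<..<1} \<gamma>" using \<gamma>(1) by (auto simp: smooth_on_def dest: spec[of _ 0])
  obtain k where kc: "continuous_on (?J - {p}) k" and k\<gamma>: "\<And>t. t \<in> {0<..<1} \<Longrightarrow> k (\<gamma> t) = t"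
    using continuous_inverse_parametrization[OF g(1,2) _ \<gamma>c \<gamma>(2)] p \<gamma>(3) unfolding J by blast
  have k: "k w \<in> {0<..<1} \<and> \<gamma> (k w) = w" if "w \<in> ?J - {p}" for w
    using that \<gamma>(3) k\<gamma> by (metis imageE)
  have p_tip: "p \<in> tip x1" using upper_0 x1 by (force simp: tip_def)
  have k': "k w \<in> {0<..<1} \<and> \<gamma> (k w) = w" if "w \<in> ?J - tip x1" for w
    using k[of w] that p_tip by auto
  have sub: "?J - tip x1 \<subseteq> ?J - {p}" using p_tip by auto
  have "open (ball p r \<inter> {w. Re (coord w) < x1})"
    unfolding coord_def by (intro open_Int open_ball open_Collect_less continuous_intros)
  moreover have "?J - tip x1 = ?J - (ball p r \<inter> {w. Re (coord w) < x1})"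
    using tip_eq[OF x1(2,1)] by auto
  moreover have "compact ?J" using g(4) by (rule compact_frontier_bounded)
  ultimately have cpt: "compact (?J - tip x1)" by (metis compact_diff)
  define K where "K = k ` (?J - tip x1)"
  have cptK: "compact K"
    unfolding K_def using cpt by (intro compact_continuous_image continuous_on_subset[OF kc sub])
  have K01: "K \<subseteq> {0<..<1}" using k' by (auto simp: K_def)
  have K_iff: "t \<in> K \<longleftrightarrow> \<gamma> t \<notin> tip x1" if "t \<in> {0<..<1}" for t
  proof
    assume "t \<in> K"
    then obtain w where "w \<in> ?J - tip x1" "t = k w" by (auto simp: K_def)
    then show "\<gamma> t \<notin> tip x1" using k' by auto
  next
    assume "\<gamma> t \<notin> tip x1"
    then have "\<gamma> t \<in> ?J - tip x1" using \<gamma>(3) that by auto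
    then show "t \<in> K" unfolding K_def using k\<gamma>[OF that] by (metis imageI)
  qed
  have inball: "upper x1 \<in> ball p r" "lower x1 \<in> ball p r"
    using norm_cusp_le[of x1 x1] x1 by (auto simp: norm_coord(1)[symmetric] coord_upper coord_lower)
  have ends: "upper x1 \<in> ?J - tip x1" "lower x1 \<in> ?J - tip x1"
    using inball frontier_\<Omega>_local x1 by (auto simp: tip_eq[OF x1(2,1)] coord_upper coord_lower)
  have ne: "upper x1 \<noteq> lower x1" using coord_upper[of x1] coord_lower[of x1] x1 by auto
  have "K \<noteq> {}" using ends by (auto simp: K_def)
  obtain a where a: "a \<in> K" "\<And>t. t \<in> K \<Longrightarrow> a \<le> t"
    using compact_attains_inf[OF cptK \<open>K \<noteq> {}\<close>] by blast
  obtain b where b: "b \<in> K" "\<And>t. t \<in> K \<Longrightarrow> t \<le> b"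
    using compact_attains_sup[OF cptK \<open>K \<noteq> {}\<close>] by blast
  have ab01: "0 < a" "b < 1" "a \<le> b" using K01 a b by auto
  \<comment> \<open>A connected branch that contains the gap point \<open>t\<close> cannot leave the interval between \<open>a\<close> and \<open>b\<close>.\<close>
  have no_gap: False
    if t: "a < t" "t < b" and c: "continuous_on {0..} c" "c 0 = p" "c ` {0<..<x1} \<subseteq> tip x1 - {p}"
      and ct: "\<gamma> t \<in> c ` {0<..<x1}" for t c
  proof -
    define I where "I = k ` c ` {0<..<x1}"
    have tipJ: "tip x1 \<subseteq> ?J" using tip_eq[OF x1(2,1)] by auto
    have cJ: "c ` {0<..<x1} \<subseteq> ?J - {p}" using c(3) tipJ by auto
    have "connected I"
      unfolding I_def
      by (intro connected_continuous_image continuous_on_subset[OF kc cJ] continuous_on_subset[OF c(1)]) auto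
    have tI: "t \<in> I" using ct k\<gamma>[of t] t ab01 unfolding I_def by force
    have I01: "s \<in> {0<..<1}" "\<gamma> s \<in> tip x1" if "s \<in> I" for s
      using that k cJ c(3) by (auto simp: I_def)
    have IK: "s \<notin> K" if "s \<in> I" for s using I01[OF that] K_iff by blast
    have "s \<in> {a..b}" if s: "s \<in> I" for s
    proof (rule ccontr)
      assume "s \<notin> {a..b}"
      then consider "s < a" | "b < s" by fastforce
      then show False
      proof cases
        case 1
        then have "a \<in> I" using connectedD_interval[OF \<open>connected I\<close> s tI, of a] t by auto
        then show False using IK a by blast
      next
        case 2
        then have "b \<in> I" using connectedD_interval[OF \<open>connected I\<close> tI s, of b] t by auto
        then show False using IK b by blast
      qed
    qed
    then have I_ab: "I \<subseteq> {a..b}" by auto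
    have csub: "c ` {0<..<x1} \<subseteq> \<gamma> ` {a..b}"
    proof
      fix w assume w: "w \<in> c ` {0<..<x1}"
      then have "k w \<in> {a..b}" using I_ab unfolding I_def by (intro subsetD[OF I_ab]) (auto simp: I_def)
      moreover have "w \<in> ?J - {p}" using w cJ by (rule subsetD[rotated])
      then have "w = \<gamma> (k w)" using k by simp
      ultimately show "w \<in> \<gamma> ` {a..b}" by (rule rev_image_eqI)
    qed
    have "compact (\<gamma> ` {a..b})"
      using ab01 by (intro compact_continuous_image continuous_on_subset[OF \<gamma>c]) auto
    then have "c ` closure {0<..<x1} \<subseteq> \<gamma> ` {a..b}"
      using x1 by (intro image_closure_subset[OF _ _ csub] continuous_on_subset[OF c(1)] compact_imp_closed) auto
    then have "c 0 \<in> \<gamma> ` {a..b}" using x1 by (auto simp: image_subset_iff)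
    moreover have "\<gamma> ` {a..b} \<subseteq> ?J - {p}" using ab01 unfolding \<gamma>(3)[symmetric] by (intro image_mono) auto
    ultimately show False using c(2) by auto
  qed
  have branch: "upper ` {0<..<x1} \<subseteq> tip x1 - {p}" "lower ` {0<..<x1} \<subseteq> tip x1 - {p}"
  proof -
    have "upper x \<noteq> p" "lower x \<noteq> p" if "0 < x" for x
      using coord_upper[of x] coord_lower[of x] that by (auto simp: coord_def complex_eq_iff)
    then show "upper ` {0<..<x1} \<subseteq> tip x1 - {p}" "lower ` {0<..<x1} \<subseteq> tip x1 - {p}"
      by (auto simp: tip_def)
  qed
  have K_eq: "K = {a..b}"
  proof (intro equalityI subsetI)
    fix t assume t: "t \<in> {a..b}"
    show "t \<in> K"
    proof (rule ccontr)
      assume nK: "t \<notin> K"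
      then have t': "a < t" "t < b" using t a(1) b(1) by (metis atLeastAtMost_iff less_eq_real_def)+
      then have t01: "t \<in> {0<..<1}" using ab01 by auto
      then have "\<gamma> t \<in> tip x1" "\<gamma> t \<noteq> p" using K_iff nK \<gamma>(3) by auto
      then obtain x where x: "0 \<le> x" "x < x1" "\<gamma> t = upper x \<or> \<gamma> t = lower x"
        unfolding tip_def by auto
      with \<open>\<gamma> t \<noteq> p\<close> upper_0 lower_0 have "x \<noteq> 0" by auto
      with x have "0 < x" by simp
      with x have "\<gamma> t \<in> upper ` {0<..<x1} \<or> \<gamma> t \<in> lower ` {0<..<x1}" by auto
      then show False
        using no_gap[OF t' continuous_upper upper_0 branch(1)] no_gap[OF t' continuous_lower lower_0 branch(2)] by blast
    qed
  qed (use a b in auto)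
  have range_ab: "\<gamma> ` {a..b} = ?J - tip x1"
    unfolding K_eq[symmetric] K_def using k' by (force simp: image_iff)
  have closed_end: "\<gamma> e \<in> {upper x1, lower x1}"
    if e: "e \<in> K" and V: "V \<subseteq> {0<..<1} - K" "e \<in> closure V" "closure V \<subseteq> {0<..<1}" for e V
  proof -
    let ?T = "upper ` {0..x1} \<union> lower ` {0..x1}"
    have "compact ?T"
      by (intro compact_Un compact_continuous_image continuous_on_subset[OF continuous_upper]
           continuous_on_subset[OF continuous_lower]) auto
    moreover have "\<gamma> ` V \<subseteq> ?T" using V(1) K_iff by (force simp: tip_def)
    ultimately have "\<gamma> ` closure V \<subseteq> ?T"
      by (intro image_closure_subset continuous_on_subset[OF \<gamma>c V(3)] compact_imp_closed) auto
    then have "\<gamma> e \<in> ?T" using V(2) by auto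
    moreover have "\<gamma> e \<notin> tip x1" using K_iff e K01 by auto
    ultimately show ?thesis by (force simp: tip_def less_le)
  qed
  have ea: "\<gamma> a \<in> {upper x1, lower x1}"
    by (rule closed_end[of a "{a/2<..<a}"]) (use a ab01 K_eq in auto)
  have eb: "\<gamma> b \<in> {upper x1, lower x1}"
    by (rule closed_end[of b "{b<..<(1+b)/2}"]) (use b ab01 K_eq in auto)
  have "k (upper x1) \<in> K" "k (lower x1) \<in> K" using ends by (auto simp: K_def)
  moreover have "k (upper x1) \<noteq> k (lower x1)" using k' ends ne by metis
  ultimately have "a < b" using K_eq by (auto simp: less_le)
  then have "\<gamma> a \<noteq> \<gamma> b" using inj_onD[OF \<gamma>(2), of a b] ab01 by auto
  then have "(\<gamma> a = lower x1 \<and> \<gamma> b = upper x1) \<or> (\<gamma> b = lower x1 \<and> \<gamma> a = upper x1)"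
    using ea eb by auto
  then have "\<exists>e0 e1. ((e0 = a \<and> e1 = b) \<or> (e0 = b \<and> e1 = a)) \<and> \<gamma> e0 = lower x1 \<and> \<gamma> e1 = upper x1"
    by metis
  then obtain e0 e1 where e: "(e0 = a \<and> e1 = b) \<or> (e0 = b \<and> e1 = a)" "\<gamma> e0 = lower x1" "\<gamma> e1 = upper x1"
    by (elim exE conjE)
  define \<sigma> where "\<sigma> = (\<lambda>y. e0 + (e1 - e0) * ((y + l) / (2 * l)))"
  have ne01: "e1 - e0 \<noteq> 0" using e \<open>a < b\<close> by auto
  have \<sigma>_in: "\<sigma> y \<in> {a..b}" if "y \<in> {-l..l}" for y
  proof -
    define q where "q = (y + l) / (2 * l)"
    have q: "0 \<le> q" "q \<le> 1" using that l by (auto simp: q_def)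
    have "0 \<le> (b - a) * q" "(b - a) * q \<le> b - a" using q \<open>a < b\<close> by (auto simp: mult_left_le)
    moreover have "\<sigma> y = e0 + (e1 - e0) * q" by (simp add: \<sigma>_def q_def)
    then have "\<sigma> y = a + (b - a) * q \<or> \<sigma> y = b - (b - a) * q"
      using e(1) by (auto simp: algebra_simps)
    ultimately show ?thesis by auto
  qed
  have \<sigma>_onto: "\<exists>y\<in>{-l..l}. \<sigma> y = t" if "t \<in> {a..b}" for t
  proof
    define q where "q = (t - e0) / (e1 - e0)"
    have q: "0 \<le> q" "q \<le> 1"
      using that e(1) \<open>a < b\<close> unfolding q_def by (auto simp: divide_simps)
    have "2 * l * q \<le> 2 * l" "0 \<le> 2 * l * q" using q l by (auto simp: mult_left_le)
    then show "2 * l * q - l \<in> {-l..l}" by auto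
    show "\<sigma> (2 * l * q - l) = t" using l ne01 by (simp add: \<sigma>_def q_def)
  qed
  have \<sigma>_img: "\<sigma> ` {-l..l} = {a..b}" using \<sigma>_in \<sigma>_onto by fastforce
  have \<sigma>_inj: "inj_on \<sigma> {-l..l}" by (rule inj_onI) (use ne01 l in \<open>simp add: \<sigma>_def\<close>)
  have ab_sub: "{a..b} \<subseteq> {0<..<1}" using ab01 by auto
  obtain M where M: "M-lipschitz_on {a..b} \<gamma>" using smooth_on_lipschitz[OF \<gamma>(1) ab_sub] .
  have \<sigma>_lip: "\<bar>(e1 - e0) / (2 * l)\<bar>-lipschitz_on {-l..l} \<sigma>"
  proof (rule lipschitz_onI)
    fix x y
    have "\<sigma> x - \<sigma> y = (e1 - e0) / (2 * l) * (x - y)" using l by (simp add: \<sigma>_def field_simps)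
    then show "dist (\<sigma> x) (\<sigma> y) \<le> \<bar>(e1 - e0) / (2 * l)\<bar> * dist x y"
      by (simp add: dist_real_def abs_mult)
  qed auto
  show ?thesis
  proof
    show "(M * \<bar>(e1 - e0) / (2 * l)\<bar>)-lipschitz_on {-l..l} (\<gamma> \<circ> \<sigma>)"
      by (rule lipschitz_on_compose[OF \<sigma>_lip]) (simp add: \<sigma>_img M)
    show "inj_on (\<gamma> \<circ> \<sigma>) {-l..l}"
      by (rule comp_inj_on[OF \<sigma>_inj]) (use \<sigma>_img ab_sub \<gamma>(2) in \<open>auto intro: inj_on_subset\<close>)
    show "(\<gamma> \<circ> \<sigma>) ` {-l..l} = ?J - tip x1" using \<sigma>_img range_ab by (metis image_comp)
    show "(\<gamma> \<circ> \<sigma>) l = upper x1" "(\<gamma> \<circ> \<sigma>) (-l) = lower x1" using e l by (auto simp: \<sigma>_def)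
    fix y assume "y \<in> {-l<..<l}"
    then have "\<sigma> y \<in> {0<..<1}" using \<sigma>_in[of y] ab_sub by auto
    moreover have "Ck_on (Suc 0) {0<..<1} \<gamma>" using \<gamma>(1) unfolding smooth_on_def by blast
    ultimately have "\<gamma> differentiable (at (\<sigma> y))" by auto
    moreover have "\<sigma> differentiable (at y)" unfolding \<sigma>_def using l by (auto intro!: derivative_intros)
    ultimately show "(\<gamma> \<circ> \<sigma>) differentiable (at y)" by (rule differentiable_chain_at[rotated])
  qed
qed

end

section \<open>Lower energy bound for maps into the cusp domain\<close>

lemma L2_on_borel_representative:
  assumes "L2_on U g"
  obtains G :: "complex \<Rightarrow> ennreal" where "G \<in> borel_measurable borel"
    "AE z in lborel. indicator U z * ennreal (norm (g z)) = G z"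
    "(\<integral>\<^sup>+z. (G z)\<^sup>2 \<partial>lborel) < \<infinity>"
proof -
  define f where "f = (\<lambda>z. indicator U z * ennreal (norm (g z)))"
  have "(\<lambda>z. indicator U z *\<^sub>R g z) \<in> borel_measurable lebesgue"
    using assms unfolding L2_on_def set_borel_measurable_def by simp
  from measurable_compose[OF this, of "\<lambda>w. ennreal (norm w)" borel]
  have "(\<lambda>z. ennreal (norm (indicator U z *\<^sub>R g z))) \<in> borel_measurable lebesgue" by simp
  moreover have f_eq: "(\<lambda>z. ennreal (norm (indicator U z *\<^sub>R g z))) = f"
    by (auto simp: f_def fun_eq_iff indicator_def)
  ultimately have "f \<in> borel_measurable lebesgue" by (simp only:)
  then obtain G where G: "G \<in> borel_measurable lborel" "AE z in lborel. f z = G z"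
    using completion_ex_borel_measurable[of f lborel] by auto
  have "(\<integral>\<^sup>+z. (G z)\<^sup>2 \<partial>lborel) = (\<integral>\<^sup>+z. (f z)\<^sup>2 \<partial>lborel)"
    using G(2) by (intro nn_integral_cong_AE) auto
  also have "\<dots> = (\<integral>\<^sup>+z. (f z)\<^sup>2 \<partial>lebesgue)" by (rule nn_integral_completion[symmetric])
  also have "\<dots> = (\<integral>\<^sup>+z. ennreal (norm (indicator U z *\<^sub>R (norm (g z))\<^sup>2)) \<partial>lebesgue)"
    by (intro nn_integral_cong) (auto simp: f_def indicator_def ennreal_power)
  also have "\<dots> < \<infinity>"
    using assms unfolding L2_on_def set_integrable_def integrable_iff_bounded by auto
  finally have "(\<integral>\<^sup>+z. (G z)\<^sup>2 \<partial>lborel) < \<infinity>" .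
  with G show ?thesis using that[of G] by (simp add: f_def)
qed

text \<open>One of the three summands is at least a third of the sum.\<close>

lemma ennreal_square_third_le:
  fixes A B C :: ennreal
  assumes "ennreal x \<le> A + B + C" "x \<ge> 0"
  shows "ennreal ((x / 3)\<^sup>2) \<le> A\<^sup>2 + B\<^sup>2 + C\<^sup>2"
proof -
  have "ennreal (x / 3) \<le> A \<or> ennreal (x / 3) \<le> B \<or> ennreal (x / 3) \<le> C"
  proof (rule ccontr)
    assume "\<not> ?thesis"
    then have lt: "A < ennreal (x / 3)" "B < ennreal (x / 3)" "C < ennreal (x / 3)" by auto
    obtain a where a: "A = ennreal a" "0 \<le> a" using lt by (cases A) auto
    obtain b where b: "B = ennreal b" "0 \<le> b" using lt by (cases B) auto
    obtain c where c: "C = ennreal c" "0 \<le> c" using lt by (cases C) auto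
    note abc = a b c
    then have "a < x / 3" "b < x / 3" "c < x / 3" using lt by (auto simp: ennreal_less_iff)
    moreover have "ennreal x \<le> ennreal (a + b + c)" using assms abc by (simp add: ennreal_plus)
    then have "x \<le> a + b + c" using abc by (subst (asm) ennreal_le_iff) auto
    ultimately show False by linarith
  qed
  moreover have "ennreal ((x / 3)\<^sup>2) \<le> D\<^sup>2" if "ennreal (x / 3) \<le> D" for D
    using power_mono[OF that, of 2] assms(2) by (simp add: ennreal_power)
  moreover have "A\<^sup>2 \<le> A\<^sup>2 + B\<^sup>2 + C\<^sup>2" "B\<^sup>2 \<le> A\<^sup>2 + B\<^sup>2 + C\<^sup>2" "C\<^sup>2 \<le> A\<^sup>2 + B\<^sup>2 + C\<^sup>2"
    using add_mono[of "A\<^sup>2" "A\<^sup>2" 0 "B\<^sup>2 + C\<^sup>2"] add_mono[of "B\<^sup>2" "B\<^sup>2" 0 "A\<^sup>2 + C\<^sup>2"]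
      add_mono[of 0 "A\<^sup>2 + B\<^sup>2" "C\<^sup>2" "C\<^sup>2"] by (simp_all add: ac_simps)
  ultimately show ?thesis by (elim disjE) (erule order_trans[rotated], simp)+
qed

lemma nn_integral_Icc_square_le:
  fixes F :: "real \<Rightarrow> ennreal"
  assumes [measurable]: "F \<in> borel_measurable borel" and "a \<le> b"
  shows "(\<integral>\<^sup>+x. F x * indicator {a..b} x \<partial>lborel)\<^sup>2 \<le> ennreal (b - a) * (\<integral>\<^sup>+x. (F x)\<^sup>2 * indicator {a..b} x \<partial>lborel)"
proof -
  have "(\<integral>\<^sup>+x. F x * indicator {a..b} x \<partial>lborel) = (\<integral>\<^sup>+x. indicator {a..b} x * (F x * indicator {a..b} x) \<partial>lborel)"
    by (intro nn_integral_cong) (auto simp: indicator_def)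
  then have "(\<integral>\<^sup>+x. F x * indicator {a..b} x \<partial>lborel)\<^sup>2
      \<le> (\<integral>\<^sup>+x. (indicator {a..b} x)\<^sup>2 \<partial>lborel) * (\<integral>\<^sup>+x. (F x * indicator {a..b} x)\<^sup>2 \<partial>lborel)"
    by (simp only:) (rule Cauchy_Schwarz_nn_integral; measurable)
  also have "(\<integral>\<^sup>+x. (indicator {a..b} x)\<^sup>2 \<partial>lborel) = (\<integral>\<^sup>+x. indicator {a..b} x \<partial>lborel)"
    by (intro nn_integral_cong) (auto simp: indicator_def)
  also have "\<dots> = ennreal (b - a)" using assms by simp
  also have "(\<integral>\<^sup>+x. (F x * indicator {a..b} x)\<^sup>2 \<partial>lborel) = (\<integral>\<^sup>+x. (F x)\<^sup>2 * indicator {a..b} x \<partial>lborel)"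
    by (intro nn_integral_cong) (auto simp: indicator_def)
  finally show ?thesis .
qed

text \<open>Three sides of the square with centre \<open>1\<close> and half-side \<open>s\<close>, cut off at the unit circle.\<close>

definition square_path :: "real \<Rightarrow> complex set" where
  "square_path s = closed_segment (Complex (sqrt (1 - s\<^sup>2)) s) (Complex (1 - s) s)
     \<union> closed_segment (Complex (1 - s) s) (Complex (1 - s) (- s))
     \<union> closed_segment (Complex (1 - s) (- s)) (Complex (sqrt (1 - s\<^sup>2)) (- s))"

lemma square_path_corner:
  assumes "0 < s" "s \<le> 1/2"
  shows "1 - s \<le> sqrt (1 - s\<^sup>2)" "sqrt (1 - s\<^sup>2) \<le> 1" "s\<^sup>2 \<le> 1/4"
proof -
  have "s\<^sup>2 \<le> (1/2)\<^sup>2" using assms by (intro power_mono) auto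
  then show "s\<^sup>2 \<le> 1/4" by (simp add: power2_eq_square)
  have "(1 - s)\<^sup>2 \<le> 1 - s\<^sup>2" using assms by (simp add: power2_eq_square algebra_simps)
  then show "1 - s \<le> sqrt (1 - s\<^sup>2)" by (rule real_le_rsqrt)
qed auto

lemma square_path_in_disc:
  assumes s: "0 < s" "s \<le> 1/2" and z: "z \<in> square_path s"
  shows "z \<in> cball 0 1" "Re z \<ge> 1/2"
proof -
  note c = square_path_corner[OF s]
  have "s * s \<le> s" using s by (simp add: mult_left_le)
  then have "(1 - s)\<^sup>2 + s\<^sup>2 \<le> 1" by (simp add: power2_eq_square algebra_simps)
  then have cor: "Complex (1 - s) s \<in> cball 0 1" "Complex (1 - s) (- s) \<in> cball 0 1"
    by (simp_all add: cmod_def)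
  have cor': "Complex (sqrt (1 - s\<^sup>2)) s \<in> cball 0 1" "Complex (sqrt (1 - s\<^sup>2)) (- s) \<in> cball 0 1"
    using c by (simp_all add: cmod_def)
  show "z \<in> cball 0 1"
    using z closed_segment_subset[OF cor'(1) cor(1) convex_cball] closed_segment_subset[OF cor convex_cball]
      closed_segment_subset[OF cor(2) cor'(2) convex_cball] unfolding square_path_def by auto
  have cv: "convex {z. 1/2 \<le> Re z}" by (rule convex_halfspace_Re_ge)
  have r: "Complex (1 - s) s \<in> {z. 1/2 \<le> Re z}" "Complex (1 - s) (- s) \<in> {z. 1/2 \<le> Re z}"
    "Complex (sqrt (1 - s\<^sup>2)) s \<in> {z. 1/2 \<le> Re z}" "Complex (sqrt (1 - s\<^sup>2)) (- s) \<in> {z. 1/2 \<le> Re z}"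
    using c s by auto
  show "Re z \<ge> 1/2"
    using z closed_segment_subset[OF r(3,1) cv] closed_segment_subset[OF r(1,2) cv]
      closed_segment_subset[OF r(2,4) cv] unfolding square_path_def by auto
qed

lemma connected_square_path: "connected (square_path s)"
  unfolding square_path_def
  by (intro connected_Un connected_segment) (use ends_in_segment in blast)+

text \<open>Otherwise the image stays within distance \<open>x\<close> of its starting point, hence at positive abscissa and in the
region where the cusp separates the closed domain into an upper and a lower part; but it is connected and meets both.\<close>

lemma (in cusp_geometry) square_path_escapes:
  assumes cont: "continuous_on (cball 0 1) h" and img: "h ` cball 0 1 \<subseteq> closure \<Omega>"
    and s: "0 < s" "s \<le> 1/2" and x: "0 < x" "2 * x + x powr \<beta> < r"
    and ends: "h (Complex (sqrt (1 - s\<^sup>2)) s) = upper x" "h (Complex (sqrt (1 - s\<^sup>2)) (- s)) = lower x"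
  obtains q where "q \<in> square_path s" "x \<le> norm (h q - upper x)"
proof (rule ccontr)
  assume "\<not> thesis"
  then have lt: "norm (h q - upper x) < x" if "q \<in> square_path s" for q
    using that \<open>\<And>q. q \<in> square_path s \<Longrightarrow> x \<le> norm (h q - upper x) \<Longrightarrow> thesis\<close> by force
  have sub: "square_path s \<subseteq> cball 0 1" using square_path_in_disc(1)[OF s] by auto
  have nz: "Im (coord (h q)) \<noteq> 0" if q: "q \<in> square_path s" for q
  proof -
    have d: "norm (coord (h q) - Complex x (x powr \<beta>)) < x"
      using lt[OF q] norm_coord_diff[of "h q" "upper x"] by (simp add: coord_upper dist_norm)
    then have "\<bar>Re (coord (h q)) - x\<bar> < x" using abs_Re_le_cmod[of "coord (h q) - Complex x (x powr \<beta>)"] by simp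
    then have pos: "0 < Re (coord (h q))" by linarith
    have "norm (coord (h q)) \<le> norm (coord (h q) - Complex x (x powr \<beta>)) + norm (Complex x (x powr \<beta>))"
      using norm_triangle_ineq[of "coord (h q) - Complex x (x powr \<beta>)" "Complex x (x powr \<beta>)"] by simp
    also have "\<dots> < r" using d norm_cusp_le(1)[of x x] x by linarith
    finally have "h q \<in> ball p r" by (simp add: norm_coord)
    moreover have "h q \<in> closure \<Omega>" using img sub q by auto
    ultimately have "Re (coord (h q)) powr \<beta> \<le> \<bar>Im (coord (h q))\<bar>" using pos by (rule closure_\<Omega>_local)
    then show ?thesis using pos by auto
  qed
  have e: "Complex (sqrt (1 - s\<^sup>2)) s \<in> square_path s" "Complex (sqrt (1 - s\<^sup>2)) (- s) \<in> square_path s"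
    by (simp_all add: square_path_def)
  define S where "S = (\<lambda>q. Im (coord (h q))) ` square_path s"
  have "connected S"
    unfolding S_def
    by (intro connected_continuous_image connected_square_path continuous_intros
        continuous_on_compose2[OF continuous_coord[of UNIV] continuous_on_subset[OF cont sub]]) auto
  moreover have "x powr \<beta> \<in> S" "- (x powr \<beta>) \<in> S"
    unfolding S_def using e ends by (force simp: coord_upper coord_lower)+
  ultimately have "0 \<in> S" using connectedD_interval[of S "- (x powr \<beta>)" "x powr \<beta>" 0] by simp
  then show False using nz by (auto simp: S_def)
qed

lemma (in mollifier) moll_increment_line:
  assumes fr: "axis_frame v w" and cont: "continuous_on (cball 0 1) h"
    and weak: "weak_directional_deriv (ball 0 1) v h g"
    and G [measurable]: "G \<in> borel_measurable borel"
    and AE: "AE z in lborel. indicator (ball 0 1) z * ennreal (norm (g z)) = G z"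
    and x: "x0 \<le> x1" "x1 \<le> x2" "x2 \<le> x3"
    and inside: "\<And>x y. x \<in> {x0..x3} \<Longrightarrow> \<bar>Re y\<bar> \<le> \<delta> \<Longrightarrow> \<bar>Im y\<bar> \<le> \<delta> \<Longrightarrow> x *\<^sub>R v + q + y \<in> ball 0 1"
  shows "ennreal (norm (moll h (x2 *\<^sub>R v + q) - moll h (x1 *\<^sub>R v + q)))
    \<le> (\<integral>\<^sup>+x. moll_nn G (x *\<^sub>R v + q) * indicator {x0..x3} x \<partial>lborel)"
proof -
  have "ennreal (norm (moll h (x1 *\<^sub>R v + q + (x2 - x1) *\<^sub>R v) - moll h (x1 *\<^sub>R v + q)))
      \<le> (\<integral>\<^sup>+s. moll_nn G (x1 *\<^sub>R v + q + s *\<^sub>R v) * indicator {0..x2 - x1} s \<partial>lborel)"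
  proof (rule moll_increment_le[OF fr cont weak G AE])
    fix s y assume s: "s \<in> {0..x2 - x1}" and y: "\<bar>Re y\<bar> \<le> \<delta>" "\<bar>Im y\<bar> \<le> \<delta>"
    have "(x1 + s) *\<^sub>R v + q + y \<in> ball 0 1" by (rule inside[OF _ y]) (use s x in auto)
    then show "x1 *\<^sub>R v + q + s *\<^sub>R v + y \<in> ball 0 1" by (simp add: algebra_simps)
  qed (use x in auto)
  also have "\<dots> = (\<integral>\<^sup>+s. moll_nn G ((x1 + s) *\<^sub>R v + q) * indicator {x1..x2} (x1 + s) \<partial>lborel)"
    by (intro nn_integral_cong) (auto simp: indicator_def algebra_simps)
  also have "\<dots> = (\<integral>\<^sup>+x. moll_nn G (x *\<^sub>R v + q) * indicator {x1..x2} x \<partial>lborel)"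
    by (rule nn_integral_lborel_translate) measurable
  also have "\<dots> \<le> (\<integral>\<^sup>+x. moll_nn G (x *\<^sub>R v + q) * indicator {x0..x3} x \<partial>lborel)"
    using x by (intro nn_integral_mono) (auto simp: indicator_def)
  finally show ?thesis by (simp add: algebra_simps)
qed

lemma nn_integral_affine_real:
  fixes F :: "real \<Rightarrow> ennreal"
  assumes [measurable]: "F \<in> borel_measurable borel" and "c = 1 \<or> c = - 1"
  shows "(\<integral>\<^sup>+x. F (t + c * x) \<partial>lborel) = (\<integral>\<^sup>+x. F x \<partial>lborel)"
  using nn_integral_real_affine[of F c t] assms by auto

lemma nn_integral_lines:
  fixes F :: "complex \<Rightarrow> ennreal"
  assumes [measurable]: "F \<in> borel_measurable borel" and fr: "axis_frame v w" and c: "c = 1 \<or> c = - 1"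
  shows "(\<integral>\<^sup>+s. \<integral>\<^sup>+x. F (x *\<^sub>R v + ((t + c * s) *\<^sub>R w + q)) \<partial>lborel \<partial>lborel) = (\<integral>\<^sup>+z. F z \<partial>lborel)"
proof -
  have "(\<integral>\<^sup>+z. F z \<partial>lborel) = (\<integral>\<^sup>+z. F (q + z) \<partial>lborel)"
    by (rule nn_integral_lborel_translate[symmetric]) measurable
  also have "\<dots> = (\<integral>\<^sup>+s. \<integral>\<^sup>+x. F (q + (x *\<^sub>R v + s *\<^sub>R w)) \<partial>lborel \<partial>lborel)"
    by (rule nn_integral_axis_frame[OF fr]) measurable
  also have "\<dots> = (\<integral>\<^sup>+s. \<integral>\<^sup>+x. F (q + (x *\<^sub>R v + (t + c * s) *\<^sub>R w)) \<partial>lborel \<partial>lborel)"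
    using nn_integral_affine_real[of "\<lambda>s. \<integral>\<^sup>+x. F (q + (x *\<^sub>R v + s *\<^sub>R w)) \<partial>lborel" c t] c by simp
  finally show ?thesis by (simp add: algebra_simps)
qed

lemma square_path_eq:
  assumes "0 < s" "s \<le> 1/2"
  shows "square_path s = {z. \<bar>Im z\<bar> = s \<and> Re z \<in> {1 - s..sqrt (1 - s\<^sup>2)}} \<union> {z. Re z = 1 - s \<and> \<bar>Im z\<bar> \<le> s}"
proof -
  have "closed_segment (sqrt (1 - s\<^sup>2)) (1 - s) = {1 - s..sqrt (1 - s\<^sup>2)}"
    "closed_segment (1 - s) (sqrt (1 - s\<^sup>2)) = {1 - s..sqrt (1 - s\<^sup>2)}"
    "closed_segment s (- s) = {- s..s}"
    using square_path_corner(1)[OF assms] assms by (auto simp: closed_segment_eq_real_ivl split: if_splits)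
  then show ?thesis
    using assms unfolding square_path_def
    by (subst (1 3) closed_segment_same_Im, simp, simp, subst closed_segment_same_Re, simp) auto
qed

text \<open>The mollification is taken at the points \<open>z - \<kappa>\<close>, so that near \<open>1\<close> it is defined up to the unit circle.\<close>

lemma left_shift_into_disc:
  assumes \<kappa>: "0 < \<kappa>" "\<kappa> \<le> 1/2" and z: "z \<in> cball 0 1" "1/2 \<le> Re z"
    and y: "\<bar>Re y\<bar> \<le> \<kappa> / 16" "\<bar>Im y\<bar> \<le> \<kappa> / 16"
  shows "z - of_real \<kappa> + y \<in> ball 0 1" "dist (z - of_real \<kappa> + y) z \<le> 9/8 * \<kappa>"
proof -
  have ny: "norm y \<le> \<kappa> / 8" using cmod_le[of y] y by simp
  have "(norm (z - of_real \<kappa>))\<^sup>2 = (norm z)\<^sup>2 - 2 * \<kappa> * Re z + \<kappa>\<^sup>2"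
    unfolding cmod_power2 by (simp add: power2_eq_square algebra_simps)
  also have "\<dots> \<le> 1 - \<kappa> + \<kappa>\<^sup>2"
  proof -
    have "(norm z)\<^sup>2 \<le> 1" using z by (simp add: power_le_one)
    moreover have "\<kappa> * (1/2) \<le> \<kappa> * Re z" using z \<kappa> by (intro mult_left_mono) auto
    ultimately show ?thesis by simp
  qed
  also have "\<dots> \<le> (1 - \<kappa> / 4)\<^sup>2"
  proof -
    have "\<kappa> * \<kappa> \<le> \<kappa> * (1/2)" using \<kappa> by (intro mult_left_mono) auto
    then have "\<kappa>\<^sup>2 \<le> \<kappa> / 2" by (simp add: power2_eq_square)
    moreover have "(1 - \<kappa> / 4)\<^sup>2 = 1 - \<kappa> / 2 + \<kappa>\<^sup>2 / 16"
      by (simp add: power2_eq_square algebra_simps)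
    ultimately show ?thesis using zero_le_power2[of \<kappa>] by linarith
  qed
  finally have "(norm (z - of_real \<kappa>))\<^sup>2 \<le> (1 - \<kappa> / 4)\<^sup>2" .
  then have "norm (z - of_real \<kappa>) \<le> 1 - \<kappa> / 4"
    by (rule power2_le_imp_le) (use \<kappa> in simp)
  then show "z - of_real \<kappa> + y \<in> ball 0 1"
    using norm_triangle_ineq[of "z - of_real \<kappa>" y] ny \<kappa> by auto
  have "norm (z - of_real \<kappa> + y - z) \<le> \<kappa> + norm y"
    using norm_triangle_ineq[of "- of_real \<kappa>" y] \<kappa> by simp
  then show "dist (z - of_real \<kappa> + y) z \<le> 9/8 * \<kappa>"
    using ny by (simp add: dist_norm)
qed

text \<open>The inequality \<open>main\<close> bounds the logarithmically divergent integral over \<open>{d..1/2}\<close> by \<open>E\<close>, a fixed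
combination of the energies of the two partial derivatives, for every \<open>d\<close>. For each \<open>d\<close> a mollification \<open>H\<close> of \<open>h\<close> is chosen that is close to \<open>h\<close> compared with the profile
at \<open>d\<close>; on the square path at \<open>s \<ge> d\<close> it still moves by half of the profile at \<open>s\<close>, and
\<open>T\<close>, \<open>V\<close> and \<open>B\<close> bound its increments on the top, left and bottom side.\<close>

lemma (in cusp_geometry) no_sobolev_extension:
  assumes K: "K \<ge> 2" and cont: "continuous_on (cball 0 1) h" and img: "h ` cball 0 1 \<subseteq> closure \<Omega>"
    and W: "W12_on (ball 0 1) h"
    and size: "2 * profile K 2 + profile K 2 powr \<beta> < r"
    and up: "\<And>z. norm z = 1 \<Longrightarrow> 1/2 \<le> Re z \<Longrightarrow> Im z > 0 \<Longrightarrow> h z = upper (profile K (norm (z - 1)))"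
    and low: "\<And>z. norm z = 1 \<Longrightarrow> 1/2 \<le> Re z \<Longrightarrow> Im z < 0 \<Longrightarrow> h z = lower (profile K (norm (z - 1)))"
  shows False
proof -
  let ?U = "ball 0 1 :: complex set"
  obtain g1 where g1: "L2_on ?U g1" "weak_directional_deriv ?U 1 h g1"
    using W unfolding W12_on_def by auto
  obtain g2 where g2: "L2_on ?U g2" "weak_directional_deriv ?U \<i> h g2"
    using W unfolding W12_on_def by auto
  obtain G1 where G1 [measurable]: "G1 \<in> borel_measurable borel"
    and G1_AE: "AE z in lborel. indicator ?U z * ennreal (norm (g1 z)) = G1 z"
    and G1_fin: "(\<integral>\<^sup>+z. (G1 z)\<^sup>2 \<partial>lborel) < \<infinity>"
    using L2_on_borel_representative[OF g1(1)] by blast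
  obtain G2 where G2 [measurable]: "G2 \<in> borel_measurable borel"
    and G2_AE: "AE z in lborel. indicator ?U z * ennreal (norm (g2 z)) = G2 z"
    and G2_fin: "(\<integral>\<^sup>+z. (G2 z)\<^sup>2 \<partial>lborel) < \<infinity>"
    using L2_on_borel_representative[OF g2(1)] by blast
  have fr: "axis_frame 1 \<i>" "axis_frame \<i> 1" by (auto simp: axis_frame_def)
  define E where "E = 2 * (\<integral>\<^sup>+z. (G1 z)\<^sup>2 \<partial>lborel) + (\<integral>\<^sup>+z. (G2 z)\<^sup>2 \<partial>lborel)"
  have "E < \<infinity>" using G1_fin G2_fin by (simp add: E_def ennreal_mult_less_top)
  then obtain E' where E': "E = ennreal E'" "E' \<ge> 0" by (cases E) auto
  have main: "ennreal ((ln (K - ln d) - ln (K - ln (1/2))) / 72) \<le> E" if d: "0 < d" "d \<le> 1/2" for d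
  proof -
    define e where "e = profile K d / 4"
    have e_pos: "e > 0" using profile_pos[OF K, of d] d by (simp add: e_def)
    have "uniformly_continuous_on (cball 0 1) h"
      by (intro compact_uniformly_continuous cont compact_cball)
    then obtain \<mu> where \<mu>: "\<mu> > 0" "\<And>z z'. z \<in> cball 0 1 \<Longrightarrow> z' \<in> cball 0 1 \<Longrightarrow> dist z' z < \<mu> \<Longrightarrow> dist (h z') (h z) < e"
      unfolding uniformly_continuous_on_def using e_pos by meson
    define \<kappa> where "\<kappa> = min (1/2) (\<mu> / 2)"
    have \<kappa>: "0 < \<kappa>" "\<kappa> \<le> 1/2" "\<kappa> \<le> \<mu> / 2" using \<mu>(1) by (auto simp: \<kappa>_def)
    define \<delta> where "\<delta> = \<kappa> / 16"
    obtain k A where "mollifier \<delta> k A" using mollifier_exists[of \<delta>] \<kappa> by (auto simp: \<delta>_def)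
    then interpret mollifier \<delta> k A .
    have shift: "z - of_real \<kappa> + y \<in> ?U" "dist (z - of_real \<kappa> + y) z < \<mu>"
      if "z \<in> cball 0 1" "1/2 \<le> Re z" "\<bar>Re y\<bar> \<le> \<delta>" "\<bar>Im y\<bar> \<le> \<delta>" for z y
      using left_shift_into_disc[OF \<kappa>(1,2) that(1,2), of y] that(3,4) \<kappa> by (auto simp: \<delta>_def)
    define H where "H = (\<lambda>z. moll h (z - of_real \<kappa>))"
    have H_near: "norm (H z - h z) \<le> e" if z: "z \<in> cball 0 1" "1/2 \<le> Re z" for z
      unfolding H_def
    proof (rule moll_approx[OF cont])
      fix y :: complex assume y: "\<bar>Re y\<bar> \<le> \<delta>" "\<bar>Im y\<bar> \<le> \<delta>"
      have "dist (h (z - of_real \<kappa> + y)) (h z) < e"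
        using shift[OF z y] z by (intro \<mu>(2)) auto
      then show "z - of_real \<kappa> + y \<in> ?U \<and> norm (h (z - of_real \<kappa> + y) - h z) \<le> e"
        using shift(1)[OF z y] by (simp add: dist_norm)
    qed (use e_pos in auto)
    define M1 where "M1 = moll_nn G1"
    define M2 where "M2 = moll_nn G2"
    have [measurable]: "M1 \<in> borel_measurable borel" "M2 \<in> borel_measurable borel"
      by (simp_all add: M1_def M2_def)
    define T where "T = (\<lambda>s. \<integral>\<^sup>+x. M1 (x *\<^sub>R 1 + (s *\<^sub>R \<i> - of_real \<kappa>)) * indicator {1 - s..sqrt (1 - s\<^sup>2)} x \<partial>lborel)"
    define V where "V = (\<lambda>s. \<integral>\<^sup>+y. M2 (y *\<^sub>R \<i> + ((1 - s) *\<^sub>R 1 - of_real \<kappa>)) * indicator {- s..s} y \<partial>lborel)"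
    define T2 where "T2 = (\<lambda>s. \<integral>\<^sup>+x. (M1 (x *\<^sub>R 1 + (s *\<^sub>R \<i> - of_real \<kappa>)))\<^sup>2 \<partial>lborel)"
    define V2 where "V2 = (\<lambda>s. \<integral>\<^sup>+y. (M2 (y *\<^sub>R \<i> + ((1 - s) *\<^sub>R 1 - of_real \<kappa>)))\<^sup>2 \<partial>lborel)"
    have incr: "ennreal (norm (H (x2 *\<^sub>R v + y *\<^sub>R w) - H (x1 *\<^sub>R v + y *\<^sub>R w)))
        \<le> (\<integral>\<^sup>+x. moll_nn G (x *\<^sub>R v + (y *\<^sub>R w - of_real \<kappa>)) * indicator {x0..x3} x \<partial>lborel)"
      if "axis_frame v w" "weak_directional_deriv ?U v h g" "G \<in> borel_measurable borel"
        "AE z in lborel. indicator ?U z * ennreal (norm (g z)) = G z" "x0 \<le> x1" "x1 \<le> x2" "x2 \<le> x3"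
        and ins: "\<And>x. x \<in> {x0..x3} \<Longrightarrow> x *\<^sub>R v + y *\<^sub>R w \<in> cball 0 1 \<and> 1/2 \<le> Re (x *\<^sub>R v + y *\<^sub>R w)"
      for v w g G x0 x1 x2 x3 y
      unfolding H_def add_diff_eq[symmetric]
    proof (rule moll_increment_line[OF that(1) cont that(2-7)])
      fix x ya assume x: "x \<in> {x0..x3}" and ya: "\<bar>Re ya\<bar> \<le> \<delta>" "\<bar>Im ya\<bar> \<le> \<delta>"
      show "x *\<^sub>R v + (y *\<^sub>R w - of_real \<kappa>) + ya \<in> ?U"
        using shift(1)[OF _ _ ya, of "x *\<^sub>R v + y *\<^sub>R w"] ins[OF x] by (simp only: add_diff_eq)
    qed
    have frame_point: "x *\<^sub>R 1 + y *\<^sub>R \<i> = Complex x y" "y *\<^sub>R \<i> + x *\<^sub>R 1 = Complex x y" for x y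
      by (simp_all add: complex_eq_iff)
    note horiz = incr[OF fr(1) g1(2) G1 G1_AE, unfolded frame_point, folded M1_def]
      and vert = incr[OF fr(2) g2(2) G2 G2_AE, unfolded frame_point, folded M2_def]
    have lower_bound: "ennreal ((profile K s)\<^sup>2 / s / 72) \<le> T2 s + V2 s + T2 (- s)" if s: "d \<le> s" "s \<le> 1/2" for s
    proof -
      have s0: "0 < s" using s d by simp
      note co = square_path_corner[OF s0 s(2)]
      define c where "c = sqrt (1 - s\<^sup>2)"
      have c: "1 - s \<le> c" "c \<le> 1" "1/2 \<le> c" "c\<^sup>2 + s\<^sup>2 = 1" using co s by (auto simp: c_def)
      define \<rho> where "\<rho> = norm (Complex c s - 1)"
      have \<rho>: "s \<le> \<rho>" "\<rho> \<le> 2" "norm (Complex c (- s) - 1) = \<rho>"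
      proof -
        show "s \<le> \<rho>" using abs_Im_le_cmod[of "Complex c s - 1"] s0 by (simp add: \<rho>_def)
        have "norm (Complex c s) = 1" using c by (simp add: cmod_def)
        then show "\<rho> \<le> 2" unfolding \<rho>_def using norm_triangle_ineq4[of "Complex c s" 1] by simp
        show "norm (Complex c (- s) - 1) = \<rho>" by (simp add: \<rho>_def cmod_def)
      qed
      define a where "a = profile K \<rho>"
      have a: "profile K s \<le> a" "a \<le> profile K 2" "0 < a" "profile K d \<le> profile K s"
        using \<rho> s0 s d K by (auto simp: a_def intro!: profile_mono profile_pos)
      have "a powr \<beta> \<le> profile K 2 powr \<beta>" using a \<beta>_gt_1 by (intro powr_mono2) auto
      then have asize: "2 * a + a powr \<beta> < r" using size a by linarith
      have n1: "norm (Complex c s) = 1" "norm (Complex c (- s)) = 1" using c by (auto simp: cmod_def)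
      have ends: "h (Complex c s) = upper a" "h (Complex c (- s)) = lower a"
        using up[of "Complex c s"] low[of "Complex c (- s)"] n1 c s0 \<rho>(3) by (auto simp: a_def \<rho>_def)
      obtain q where q: "q \<in> square_path s" "a \<le> norm (h q - upper a)"
        using square_path_escapes[OF cont img s0 s(2) a(3) asize] ends unfolding c_def by blast
      have onpath: "z \<in> cball 0 1 \<and> 1/2 \<le> Re z" if "z \<in> square_path s" for z
        using square_path_in_disc[OF s0 s(2) that] by simp
      have top_sub: "Complex x s \<in> square_path s" "Complex x (- s) \<in> square_path s" if "x \<in> {1 - s..c}" for x
        using that s0 by (auto simp: square_path_eq[OF s0 s(2)] c_def)
      have left_sub: "Complex (1 - s) y \<in> square_path s" if "y \<in> {- s..s}" for y
        using that by (auto simp: square_path_eq[OF s0 s(2)])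
      have topc: "Complex x s \<in> cball 0 1 \<and> 1/2 \<le> x" "Complex x (- s) \<in> cball 0 1 \<and> 1/2 \<le> x" if "x \<in> {1 - s..c}" for x
        using onpath[OF top_sub(1)[OF that]] onpath[OF top_sub(2)[OF that]] by auto
      have leftc: "Complex (1 - s) y \<in> cball 0 1 \<and> 1/2 \<le> 1 - s" if "y \<in> {- s..s}" for y
        using onpath[OF left_sub[OF that]] by auto
      let ?z0 = "Complex c s"
      have tri: "ennreal (norm (u1 - u3)) \<le> ennreal (norm (u1 - u2)) + ennreal (norm (u2 - u3))" for u1 u2 u3 :: complex
        using norm_triangle_ineq[of "u1 - u2" "u2 - u3"] by (simp flip: ennreal_plus)
      have T_eq: "T s = (\<integral>\<^sup>+x. M1 (x *\<^sub>R 1 + (s *\<^sub>R \<i> - of_real \<kappa>)) * indicator {1 - s..c} x \<partial>lborel)"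
        by (simp add: T_def c_def)
      define B where "B = (\<integral>\<^sup>+x. M1 (x *\<^sub>R 1 + ((- s) *\<^sub>R \<i> - of_real \<kappa>)) * indicator {1 - s..c} x \<partial>lborel)"
      have seg1: "ennreal (norm (H (Complex x s) - H ?z0)) \<le> T s" if "x \<in> {1 - s..c}" for x
        using horiz[of "1 - s" x c c s] topc that c unfolding T_eq by (simp add: norm_minus_commute)
      have seg2: "ennreal (norm (H (Complex (1 - s) y) - H (Complex (1 - s) s))) \<le> V s" if "y \<in> {- s..s}" for y
        using vert[of "- s" y s s "1 - s"] leftc that unfolding V_def by (simp add: norm_minus_commute)
      have seg3: "ennreal (norm (H (Complex x (- s)) - H (Complex (1 - s) (- s)))) \<le> B" if "x \<in> {1 - s..c}" for x
        using horiz[of "1 - s" "1 - s" x c "- s"] topc that c unfolding B_def by simp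
      have corner1: "ennreal (norm (H (Complex (1 - s) s) - H ?z0)) \<le> T s" using seg1[of "1 - s"] c by auto
      have left: "ennreal (norm (H (Complex (1 - s) y) - H ?z0)) \<le> V s + T s" if "y \<in> {- s..s}" for y
        using tri[of "H (Complex (1 - s) y)" "H ?z0" "H (Complex (1 - s) s)"] add_mono[OF seg2[OF that] corner1]
        by (rule order_trans)
      have corner2: "ennreal (norm (H (Complex (1 - s) (- s)) - H ?z0)) \<le> V s + T s" using left[of "- s"] s0 by auto
      have bot: "ennreal (norm (H (Complex x (- s)) - H ?z0)) \<le> B + (V s + T s)" if "x \<in> {1 - s..c}" for x
        using tri[of "H (Complex x (- s))" "H ?z0" "H (Complex (1 - s) (- s))"] add_mono[OF seg3[OF that] corner2]
        by (rule order_trans)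
      have "ennreal (norm (H q - H ?z0)) \<le> T s + V s + B"
      proof -
        consider "Im q = s" "Re q \<in> {1 - s..c}" | "Re q = 1 - s" "Im q \<in> {- s..s}" | "Im q = - s" "Re q \<in> {1 - s..c}"
          using q(1) s0 by (auto simp: square_path_eq[OF s0 s(2)] c_def abs_le_iff abs_if split: if_splits)
        then show ?thesis
        proof cases
          case 1
          have "T s \<le> T s + V s + B" by (simp add: add.assoc)
          then show ?thesis using order_trans[OF seg1[OF 1(2)]] 1(1) complex_surj[of q] by simp
        next
          case 2
          have "V s + T s \<le> T s + V s + B" by (simp add: add.commute)
          then show ?thesis using order_trans[OF left[OF 2(2)]] 2(1) complex_surj[of q] by simp
        next
          case 3
          have "B + (V s + T s) \<le> T s + V s + B" by (simp add: ac_simps)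
          then show ?thesis using order_trans[OF bot[OF 3(2)]] 3(1) complex_surj[of q] by simp
        qed
      qed
      moreover have "profile K s / 2 \<le> norm (H q - H ?z0)"
      proof -
        have "norm (h q - h ?z0) \<le> norm (H q - h q) + norm (H q - H ?z0) + norm (H ?z0 - h ?z0)"
          using norm_triangle_ineq[of "h q - H q" "H q - h ?z0"] norm_triangle_ineq[of "H q - H ?z0" "H ?z0 - h ?z0"]
          by (simp add: norm_minus_commute)
        moreover have "norm (H q - h q) \<le> e" using onpath[OF q(1)] by (intro H_near) auto
        moreover have "norm (H ?z0 - h ?z0) \<le> e" using topc(1)[of c] c by (intro H_near) auto
        moreover have "e \<le> profile K s / 4" using a by (simp add: e_def)
        ultimately show ?thesis using q(2) ends a by simp
      qed
      ultimately have "ennreal (profile K s / 2) \<le> T s + V s + B"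
        using ennreal_leI order_trans by blast
      then have "ennreal ((profile K s / 2 / 3)\<^sup>2) \<le> (T s)\<^sup>2 + (V s)\<^sup>2 + B\<^sup>2"
        by (rule ennreal_square_third_le) (simp add: profile_nonneg)
      also have "\<dots> \<le> ennreal (2 * s) * T2 s + ennreal (2 * s) * V2 s + ennreal (2 * s) * T2 (- s)"
      proof (intro add_mono)
        have cs: "c - (1 - s) \<le> 2 * s" using c by simp
        \<comment> \<open>The horizontal sides have length at most \<open>s\<close> and the vertical one has length \<open>2 s\<close>.\<close>
        have "(T s)\<^sup>2 \<le> ennreal (c - (1 - s)) * (\<integral>\<^sup>+x. (M1 (x *\<^sub>R 1 + (s *\<^sub>R \<i> - of_real \<kappa>)))\<^sup>2 * indicator {1 - s..c} x \<partial>lborel)"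
          unfolding T_eq using c by (intro nn_integral_Icc_square_le) auto
        also have "\<dots> \<le> ennreal (2 * s) * T2 s"
          unfolding T2_def using cs by (intro mult_mono ennreal_leI nn_integral_mono) (auto simp: indicator_def)
        finally show "(T s)\<^sup>2 \<le> ennreal (2 * s) * T2 s" .
        have "B\<^sup>2 \<le> ennreal (c - (1 - s)) * (\<integral>\<^sup>+x. (M1 (x *\<^sub>R 1 + ((- s) *\<^sub>R \<i> - of_real \<kappa>)))\<^sup>2 * indicator {1 - s..c} x \<partial>lborel)"
          unfolding B_def using c by (intro nn_integral_Icc_square_le) auto
        also have "\<dots> \<le> ennreal (2 * s) * T2 (- s)"
          unfolding T2_def using cs by (intro mult_mono ennreal_leI nn_integral_mono) (auto simp: indicator_def)
        finally show "B\<^sup>2 \<le> ennreal (2 * s) * T2 (- s)" .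
        have "(V s)\<^sup>2 \<le> ennreal (s - (- s)) * (\<integral>\<^sup>+y. (M2 (y *\<^sub>R \<i> + ((1 - s) *\<^sub>R 1 - of_real \<kappa>)))\<^sup>2 * indicator {- s..s} y \<partial>lborel)"
          unfolding V_def using s0 by (intro nn_integral_Icc_square_le) auto
        also have "\<dots> \<le> ennreal (2 * s) * V2 s"
          unfolding V2_def by (intro mult_mono ennreal_leI nn_integral_mono) (auto simp: indicator_def)
        finally show "(V s)\<^sup>2 \<le> ennreal (2 * s) * V2 s" .
      qed
      also have "\<dots> = ennreal (2 * s) * (T2 s + V2 s + T2 (- s))" by (simp add: distrib_left)
      finally have "ennreal (1 / (2 * s)) * ennreal ((profile K s / 2 / 3)\<^sup>2)
          \<le> ennreal (1 / (2 * s)) * (ennreal (2 * s) * (T2 s + V2 s + T2 (- s)))"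
        by (rule mult_left_mono) simp
      also have "\<dots> = T2 s + V2 s + T2 (- s)"
        using s0 by (simp add: mult.assoc[symmetric] flip: ennreal_mult)
      finally show ?thesis
        using s0 by (simp add: power2_eq_square mult.commute[of s 72] flip: ennreal_mult)
    qed
    have [measurable]: "T2 \<in> borel_measurable borel" "V2 \<in> borel_measurable borel"
      unfolding T2_def V2_def by measurable
    have "ennreal ((ln (K - ln d) - ln (K - ln (1/2))) / 72)
        = ennreal (1/72) * (\<integral>\<^sup>+s. ennreal ((profile K s)\<^sup>2 / s) * indicator {d..1/2} s \<partial>lborel)"
      unfolding nn_integral_profile_square[OF K d] by (simp flip: ennreal_mult')
    also have "\<dots> = (\<integral>\<^sup>+s. ennreal (1/72) * (ennreal ((profile K s)\<^sup>2 / s) * indicator {d..1/2} s) \<partial>lborel)"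
      by (rule nn_integral_cmult[symmetric]) (simp add: profile_def)
    also have "\<dots> \<le> (\<integral>\<^sup>+s. T2 s + V2 s + T2 (- s) \<partial>lborel)"
    proof (rule nn_integral_mono)
      fix s
      show "ennreal (1/72) * (ennreal ((profile K s)\<^sup>2 / s) * indicator {d..1/2} s) \<le> T2 s + V2 s + T2 (- s)"
        using lower_bound[of s] by (auto simp: indicator_def mult.commute[of s 72] simp flip: ennreal_mult')
    qed
    also have "\<dots> = (\<integral>\<^sup>+s. T2 s \<partial>lborel) + (\<integral>\<^sup>+s. V2 s \<partial>lborel) + (\<integral>\<^sup>+s. T2 (- s) \<partial>lborel)"
      by (simp add: nn_integral_add)
    also have "(\<integral>\<^sup>+s. T2 s \<partial>lborel) = (\<integral>\<^sup>+z. (M1 z)\<^sup>2 \<partial>lborel)"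
      using nn_integral_lines[of "\<lambda>z. (M1 z)\<^sup>2" 1 \<i> 1 0 "- of_real \<kappa>"] fr by (simp add: T2_def)
    also have "(\<integral>\<^sup>+s. T2 (- s) \<partial>lborel) = (\<integral>\<^sup>+z. (M1 z)\<^sup>2 \<partial>lborel)"
      using nn_integral_lines[of "\<lambda>z. (M1 z)\<^sup>2" 1 \<i> "-1" 0 "- of_real \<kappa>"] fr by (simp add: T2_def)
    also have "(\<integral>\<^sup>+s. V2 s \<partial>lborel) = (\<integral>\<^sup>+z. (M2 z)\<^sup>2 \<partial>lborel)"
      using nn_integral_lines[of "\<lambda>z. (M2 z)\<^sup>2" \<i> 1 "-1" 1 "- of_real \<kappa>"] fr by (simp add: V2_def)
    also have "(\<integral>\<^sup>+z. (M1 z)\<^sup>2 \<partial>lborel) + (\<integral>\<^sup>+z. (M2 z)\<^sup>2 \<partial>lborel) + (\<integral>\<^sup>+z. (M1 z)\<^sup>2 \<partial>lborel)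
        = 2 * (\<integral>\<^sup>+z. (M1 z)\<^sup>2 \<partial>lborel) + (\<integral>\<^sup>+z. (M2 z)\<^sup>2 \<partial>lborel)"
      by (simp add: mult_2 ac_simps)
    also have "\<dots> \<le> E"
      unfolding E_def M1_def M2_def by (intro add_mono mult_left_mono moll_nn_square_le) auto
    finally show ?thesis .
  qed
  \<comment> \<open>With \<open>d = exp (- X)\<close> the left-hand side of \<open>main\<close> exceeds \<open>E\<close>.\<close>
  define X where "X = exp (72 * E' + 72 + ln (K - ln (1/2)))"
  have ln_half: "ln (1/2) < (0::real)" by simp
  have "1 \<le> K - ln (1/2)" using K ln_half by linarith
  then have lnK: "0 \<le> ln (K - ln (1/2))" by simp
  have X: "X \<ge> 1" using E' lnK by (simp add: X_def)
  have "exp (- X) \<le> exp (- 1)" using X by simp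
  also have "exp (-1 :: real) \<le> 1/2"
    using exp_ge_add_one_self[of 1] by (simp add: exp_minus field_simps)
  finally have "exp (- X) \<le> 1/2" .
  then have "ennreal ((ln (K - ln (exp (- X))) - ln (K - ln (1/2))) / 72) \<le> ennreal E'"
    using main[of "exp (- X)"] E' by simp
  then have "(ln (K + X) - ln (K - ln (1/2))) / 72 \<le> E'"
    using E'(2) by (simp add: ennreal_le_iff)
  moreover have "ln X \<le> ln (K + X)" using X K by simp
  moreover have "ln X = 72 * E' + 72 + ln (K - ln (1/2))" by (simp add: X_def)
  ultimately show False by simp
qed

section \<open>The cusp parametrization and its modulus of continuity\<close>

text \<open>The quotient of \<open>ln \<rho> - ln \<sigma>\<close> by \<open>\<rho> - \<sigma>\<close> is of order \<open>1 / \<rho>\<close> when the two are comparable and otherwise only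
logarithmically larger. The bound is chosen so that its square is integrable in \<open>\<sigma>\<close>; it follows from
\<open>ln x \<le> (x - 1/x) / 2\<close> at \<open>x = (\<rho> / \<sigma>)\<^sup>1\<^sup>/\<^sup>4\<close>.\<close>

lemma ln_ratio_le:
  fixes \<rho> \<sigma> :: real
  assumes "0 < \<sigma>" "\<sigma> \<le> \<rho>"
  shows "ln \<rho> - ln \<sigma> \<le> 2 * (\<rho> - \<sigma>) / (\<rho> powr (3/4) * \<sigma> powr (1/4))"
proof -
  define a where "a = \<rho> powr (1/4)"
  define b where "b = \<sigma> powr (1/4)"
  have pos: "0 < a" "0 < b" "0 < \<rho>" using assms by (auto simp: a_def b_def)
  have a4: "\<rho> = a ^ 4" "\<sigma> = b ^ 4" "\<rho> powr (3/4) = a ^ 3"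
    using assms pos by (simp_all add: a_def b_def powr_powr flip: powr_numeral)
  have ba: "b \<le> a" unfolding a_def b_def using assms by (intro powr_mono2) auto
  define x where "x = a / b"
  have x1: "1 \<le> x" using ba pos by (simp add: x_def)
  have ln4: "ln \<rho> - ln \<sigma> = 4 * ln x"
    using pos by (simp add: a4 x_def ln_realpow ln_div)
  have lnx: "ln x \<le> (x\<^sup>2 - 1) / (2 * x)"
  proof -
    have "ln x - (x - 1 / x) / 2 \<le> ln 1 - (1 - 1 / 1) / (2::real)"
    proof (rule DERIV_nonpos_imp_nonincreasing[where f = "\<lambda>x. ln x - (x - 1 / x) / 2"])
      fix t :: real assume t: "1 \<le> t" "t \<le> x"
      have "((\<lambda>x. ln x - (x - 1 / x) / 2) has_real_derivative 1 / t - (1 + 1 / t\<^sup>2) / 2) (at t)"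
        using t by (auto intro!: derivative_eq_intros simp: power2_eq_square)
      moreover have "1 / t - (1 + 1 / t\<^sup>2) / 2 = - ((1 - 1 / t)\<^sup>2) / 2"
        using t by (simp add: power2_eq_square field_simps)
      ultimately show "\<exists>y. ((\<lambda>x. ln x - (x - 1 / x) / 2) has_real_derivative y) (at t) \<and> y \<le> 0"
        by (intro exI[of _ "- ((1 - 1 / t)\<^sup>2) / 2"]) auto
    qed (use x1 in auto)
    then show ?thesis using x1 by (simp add: field_simps power2_eq_square)
  qed
  have "4 * ((x\<^sup>2 - 1) / (2 * x)) = 2 * ((x\<^sup>2 - 1) / x)" using x1 by (simp add: field_simps)
  then have 1: "ln \<rho> - ln \<sigma> \<le> 2 * ((x\<^sup>2 - 1) / x)" using ln4 lnx by linarith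
  have "(x\<^sup>2 - 1) / x \<le> (x ^ 4 - 1) / x ^ 3"
  proof -
    have "(x\<^sup>2 - 1) * x\<^sup>2 \<le> (x\<^sup>2 - 1) * (x\<^sup>2 + 1)" using x1 by (intro mult_left_mono) auto
    then have "(x\<^sup>2 - 1) * x\<^sup>2 \<le> x ^ 4 - 1" by (simp add: algebra_simps flip: power_add)
    then have "(x\<^sup>2 - 1) * x\<^sup>2 / x ^ 3 \<le> (x ^ 4 - 1) / x ^ 3" using x1 by (intro divide_right_mono) auto
    moreover have "(x\<^sup>2 - 1) * x\<^sup>2 / x ^ 3 = (x\<^sup>2 - 1) / x" using x1 by (simp add: power3_eq_cube power2_eq_square)
    ultimately show ?thesis by simp
  qed
  moreover have "(x ^ 4 - 1) / x ^ 3 = (\<rho> - \<sigma>) / (\<rho> powr (3/4) * \<sigma> powr (1/4))"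
    unfolding a4(3) b_def[symmetric] unfolding a4 x_def
    using pos by (simp add: power_divide field_simps eval_nat_numeral)
  ultimately have "ln \<rho> - ln \<sigma> \<le> 2 * ((\<rho> - \<sigma>) / (\<rho> powr (3/4) * \<sigma> powr (1/4)))"
    using 1 by linarith
  then show ?thesis by simp
qed

lemma powr_neg_diff_le:
  fixes L M \<gamma> :: real
  assumes "1 \<le> L" "L \<le> M" "\<gamma> > 0"
  shows "0 \<le> L powr (- \<gamma>) - M powr (- \<gamma>)" "L powr (- \<gamma>) - M powr (- \<gamma>) \<le> \<gamma> * L powr (- \<gamma> - 1) * (M - L)"
proof -
  show "0 \<le> L powr (- \<gamma>) - M powr (- \<gamma>)"
    using powr_mono2'[of "- \<gamma>" L M] assms by simp
  have "- (\<gamma> * L powr (- \<gamma> - 1)) * (M - L) \<le> M powr (- \<gamma>) - L powr (- \<gamma>)"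
  proof -
    have "L powr (- \<gamma>) + \<gamma> * L powr (- \<gamma> - 1) * L \<le> M powr (- \<gamma>) + \<gamma> * L powr (- \<gamma> - 1) * M"
    proof (rule DERIV_nonneg_imp_nondecreasing[where f = "\<lambda>t. t powr (- \<gamma>) + \<gamma> * L powr (- \<gamma> - 1) * t"])
      fix t assume t: "L \<le> t" "t \<le> M"
      have "((\<lambda>t. t powr (- \<gamma>) + \<gamma> * L powr (- \<gamma> - 1) * t) has_real_derivative
          - \<gamma> * t powr (- \<gamma> - 1) + \<gamma> * L powr (- \<gamma> - 1)) (at t)"
        using t assms by (auto intro!: derivative_eq_intros)
      moreover have "t powr (- \<gamma> - 1) \<le> L powr (- \<gamma> - 1)" using t assms by (intro powr_mono2') auto
      then have "\<gamma> * t powr (- \<gamma> - 1) \<le> \<gamma> * L powr (- \<gamma> - 1)" using assms by simp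
      ultimately show "\<exists>y. ((\<lambda>t. t powr (- \<gamma>) + \<gamma> * L powr (- \<gamma> - 1) * t) has_real_derivative y) (at t) \<and> 0 \<le> y"
        by (intro exI[of _ "- \<gamma> * t powr (- \<gamma> - 1) + \<gamma> * L powr (- \<gamma> - 1)"]) auto
    qed (use assms in auto)
    then show ?thesis by (simp add: algebra_simps)
  qed
  then show "L powr (- \<gamma>) - M powr (- \<gamma>) \<le> \<gamma> * L powr (- \<gamma> - 1) * (M - L)" by simp
qed

text \<open>For a point of the circle with real part \<open>x \<ge> -4/5\<close> this is the distance to \<open>-1\<close>. The truncation keeps it away from
zero.\<close>

definition width :: "real \<Rightarrow> real" where "width x = sqrt (2 + 2 * max x (-4/5))"

lemma width_ge: "3/5 \<le> width x"
  unfolding width_def by (rule real_le_rsqrt) (auto simp: power2_eq_square)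

lemma width_lipschitz: "\<bar>width x - width y\<bar> \<le> 2 * \<bar>x - y\<bar>"
proof -
  define a where "a = 2 + 2 * max x (-4/5)"
  define b where "b = 2 + 2 * max y (-4/5)"
  have ab: "0 \<le> a" "0 \<le> b" by (auto simp: a_def b_def)
  have sum: "6/5 \<le> width x + width y" using width_ge[of x] width_ge[of y] by simp
  have "(width x - width y) * (width x + width y) = a - b"
  proof -
    have "width x = sqrt a" "width y = sqrt b" by (simp_all add: width_def a_def b_def)
    then show ?thesis using ab by (simp add: algebra_simps)
  qed
  then have "\<bar>width x - width y\<bar> * (width x + width y) = \<bar>a - b\<bar>"
    using sum by (metis abs_mult abs_of_nonneg order_trans zero_le_divide_iff zero_le_numeral)
  moreover have "\<bar>a - b\<bar> \<le> 2 * \<bar>x - y\<bar>" by (auto simp: a_def b_def max_def abs_if)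
  moreover have "\<bar>width x - width y\<bar> * (6/5) \<le> \<bar>width x - width y\<bar> * (width x + width y)"
    using sum by (intro mult_left_mono) auto
  ultimately have "\<bar>width x - width y\<bar> * (6/5) \<le> 2 * \<bar>x - y\<bar>" by (simp only:)
  moreover have "w \<le> 2 * d" if "w * (6/5) \<le> 2 * d" "0 \<le> d" for w d :: real using that by linarith
  ultimately show ?thesis using abs_ge_zero by blast
qed

lemma differentiable_transform_open:
  assumes "f differentiable (at z)" "open S" "z \<in> S" "\<And>x. x \<in> S \<Longrightarrow> f x = g x"
  shows "g differentiable (at z)"
  using assms has_derivative_transform_within_open unfolding differentiable_def by blast

locale cusp_map =
  fixes K \<beta> :: real
  assumes K: "K \<ge> 2" and \<beta>: "\<beta> > 1"
begin

abbreviation rad :: "complex \<Rightarrow> real" where "rad z \<equiv> norm (z - 1)"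

text \<open>On the right part of the circle this is the sign of the imaginary part, since there
\<open>2 \<bar>Im z\<bar> = \<bar>1 - z\<^sup>2\<bar> = \<bar>1 - z\<bar> \<bar>1 + z\<bar>\<close>. It is bounded, and its gradient is of order \<open>1 / \<bar>z - 1\<bar>\<close>.\<close>

definition side :: "complex \<Rightarrow> real" where "side z = 2 * Im z / (rad z * width (Re z))"

text \<open>On the right part of the circle, the parametrization of the standard cusp boundary by the profile of the
distance to \<open>1\<close>; inside the disc, an extension of it.\<close>

definition cusp_param :: "complex \<Rightarrow> complex" where
  "cusp_param z = Complex (profile K (rad z)) (side z * profile K (rad z) powr \<beta>)"

text \<open>The rate of logarithmic decay of the energy: \<open>3\<close> comes from the abscissa and \<open>\<beta>\<close> from the ordinate.\<close>

definition b :: real where "b = min 3 \<beta>"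

text \<open>The modulus of continuity of \<open>cusp_param\<close> divided by the distance, at distances \<open>\<sigma> \<le> \<rho>\<close> from \<open>1\<close>.\<close>

definition modulus :: "real \<Rightarrow> real \<Rightarrow> real" where
  "modulus \<rho> \<sigma> = (K - ln \<rho>) powr (- b / 2) / (\<rho> powr (3/4) * \<sigma> powr (1/4))"

lemma rad_le_2: "z \<in> cball 0 1 \<Longrightarrow> rad z \<le> 2"
  using norm_triangle_ineq4[of z 1] by simp

lemma Im_div_rad_le: "\<bar>Im z / rad z\<bar> \<le> 1"
proof (cases "rad z = 0")
  case False
  then show ?thesis using abs_Im_le_cmod[of "z - 1"] by (simp add: abs_divide)
qed simp

lemma side_bound: "\<bar>side z\<bar> \<le> 4"
proof -
  have w: "3/5 \<le> width (Re z)" by (rule width_ge)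
  have "\<bar>side z\<bar> = 2 * \<bar>Im z / rad z\<bar> / width (Re z)"
    using w by (simp add: side_def abs_mult abs_divide)
  also have "\<dots> \<le> 2 * 1 / (3/5)"
    using w Im_div_rad_le[of z] by (intro frac_le) auto
  finally show ?thesis by simp
qed

lemma modulus_nonneg: "modulus \<rho> \<sigma> \<ge> 0"
  by (simp add: modulus_def)

lemma powr_log_le_b:
  assumes "1 \<le> L" "b / 2 \<le> c"
  shows "L powr (- c) \<le> L powr (- b / 2)"
  using assms by (intro powr_mono) auto

lemma rad_diff: "\<bar>rad z - rad w\<bar> \<le> norm (z - w)"
  using norm_triangle_ineq3[of "z - 1" "w - 1"] by simp

lemma profile_powr: "0 < \<rho> \<Longrightarrow> profile K \<rho> powr c = (K - ln \<rho>) powr (- (c / 2))"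
  by (simp add: profile_def powr_powr)

lemma inverse_rad_le_modulus:
  assumes "0 < \<sigma>" "\<sigma> \<le> \<rho>" "\<rho> \<le> 2"
  shows "(K - ln \<rho>) powr (- \<beta> / 2) / \<rho> \<le> modulus \<rho> \<sigma>"
proof -
  have "\<rho> powr (3/4) * \<sigma> powr (1/4) \<le> \<rho> powr (3/4) * \<rho> powr (1/4)"
    using assms by (intro mult_left_mono powr_mono2) auto
  also have "\<dots> = \<rho>" using assms by (simp flip: powr_add)
  finally have 1: "\<rho> powr (3/4) * \<sigma> powr (1/4) \<le> \<rho>" .
  have "(K - ln \<rho>) powr (- (\<beta> / 2)) \<le> (K - ln \<rho>) powr (- b / 2)"
    using log_gap_ge_1[OF K, of \<rho>] assms by (intro powr_log_le_b) (auto simp: b_def)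
  then show ?thesis unfolding modulus_def using assms 1 by (intro frac_le) auto
qed

lemma profile_diff_le:
  assumes "0 < \<sigma>" "\<sigma> \<le> \<rho>" "\<rho> \<le> 2" "c \<ge> 1"  "b / 2 \<le> c / 2 + 1"
  shows "\<bar>profile K \<rho> powr c - profile K \<sigma> powr c\<bar> \<le> c * ((\<rho> - \<sigma>) * modulus \<rho> \<sigma>)"
proof -
  let ?L = "K - ln \<rho>" and ?M = "K - ln \<sigma>"
  have L: "1 \<le> ?L" "?L \<le> ?M" using log_gap_ge_1[OF K, of \<rho>] assms by auto
  have d: "?M - ?L \<le> 2 * (\<rho> - \<sigma>) / (\<rho> powr (3/4) * \<sigma> powr (1/4))"
    using ln_ratio_le[OF assms(1,2)] by simp
  have "\<bar>profile K \<rho> powr c - profile K \<sigma> powr c\<bar> = ?L powr (- (c/2)) - ?M powr (- (c/2))"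
    using powr_neg_diff_le(1)[OF L, of "c/2"] assms by (simp add: profile_powr)
  also have "\<dots> \<le> c / 2 * ?L powr (- (c/2) - 1) * (?M - ?L)"
    using powr_neg_diff_le(2)[OF L, of "c/2"] assms by simp
  also have "\<dots> \<le> c / 2 * ?L powr (- b / 2) * (2 * (\<rho> - \<sigma>) / (\<rho> powr (3/4) * \<sigma> powr (1/4)))"
  proof (intro mult_mono d mult_nonneg_nonneg)
    show "?L powr (- (c/2) - 1) \<le> ?L powr (- b / 2)"
      using powr_log_le_b[OF L(1), of "c/2 + 1"] assms by simp
  qed (use L assms in auto)
  also have "\<dots> = c * ((\<rho> - \<sigma>) * modulus \<rho> \<sigma>)"
  proof -
    have "c / 2 * P * (2 * D / Q) = c * (D * (P / Q))" for P Q D :: real by simp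
    then show ?thesis unfolding modulus_def .
  qed
  finally show ?thesis .
qed

lemma side_diff_le:
  assumes z: "z \<in> cball 0 1" and r: "0 < rad w" "rad w \<le> rad z"
  shows "\<bar>side z - side w\<bar> \<le> 31 * norm (z - w) / rad z"
proof -
  let ?\<rho> = "rad z" and ?\<sigma> = "rad w"
  have pos: "0 < ?\<rho>" using r by linarith
  note wz = width_ge[of "Re z"] and ww = width_ge[of "Re w"]
  define D where "D = norm (z - w)"
  have "Im z / ?\<rho> - Im w / ?\<sigma> = (Im z - Im w) / ?\<rho> + (Im w / ?\<sigma>) * ((?\<sigma> - ?\<rho>) / ?\<rho>)"
    using pos r by (simp add: field_simps)
  also have "\<bar>\<dots>\<bar> \<le> \<bar>(Im z - Im w) / ?\<rho>\<bar> + \<bar>Im w / ?\<sigma>\<bar> * \<bar>(?\<sigma> - ?\<rho>) / ?\<rho>\<bar>"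
    unfolding abs_mult[symmetric] by (rule abs_triangle_ineq)
  also have "\<dots> \<le> D / ?\<rho> + 1 * (D / ?\<rho>)"
  proof (intro add_mono mult_mono Im_div_rad_le)
    show "\<bar>(Im z - Im w) / ?\<rho>\<bar> \<le> D / ?\<rho>"
      using abs_Im_le_cmod[of "z - w"] pos by (simp add: D_def abs_divide divide_right_mono)
    show "\<bar>(?\<sigma> - ?\<rho>) / ?\<rho>\<bar> \<le> D / ?\<rho>"
      using rad_diff[of w z] pos by (simp add: D_def abs_divide divide_right_mono norm_minus_commute)
  qed auto
  finally have 1: "\<bar>Im z / ?\<rho> - Im w / ?\<sigma>\<bar> \<le> 2 * D / ?\<rho>" by simp
  have 2: "\<bar>1 / width (Re z) - 1 / width (Re w)\<bar> \<le> 6 * D"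
  proof -
    have p: "width (Re z) * width (Re w) \<ge> (3/5) * (3/5)" using wz ww by (intro mult_mono) auto
    have "1 / width (Re z) - 1 / width (Re w) = (width (Re w) - width (Re z)) / (width (Re z) * width (Re w))"
      using wz ww by (simp add: field_simps)
    also have "\<bar>\<dots>\<bar> = \<bar>width (Re w) - width (Re z)\<bar> / (width (Re z) * width (Re w))"
      using wz ww by (simp add: abs_divide abs_mult)
    also have "\<dots> \<le> 2 * D / ((3/5) * (3/5))"
      using width_lipschitz[of "Re w" "Re z"] abs_Re_le_cmod[of "w - z"] p
      by (intro frac_le) (auto simp: D_def norm_minus_commute)
    also have "\<dots> \<le> 6 * D" by (simp add: D_def)
    finally show ?thesis .
  qed
  have "side z - side w = 2 * (Im z / ?\<rho> - Im w / ?\<sigma>) / width (Re z) + 2 * (Im w / ?\<sigma>) * (1 / width (Re z) - 1 / width (Re w))"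
    by (simp add: side_def algebra_simps add_divide_distrib diff_divide_distrib)
  also have "\<bar>\<dots>\<bar> \<le> \<bar>2 * (Im z / ?\<rho> - Im w / ?\<sigma>) / width (Re z)\<bar> + \<bar>2 * (Im w / ?\<sigma>) * (1 / width (Re z) - 1 / width (Re w))\<bar>"
    by (rule abs_triangle_ineq)
  also have "\<dots> = 2 * \<bar>Im z / ?\<rho> - Im w / ?\<sigma>\<bar> / width (Re z) + 2 * \<bar>Im w / ?\<sigma>\<bar> * \<bar>1 / width (Re z) - 1 / width (Re w)\<bar>"
    using wz by (simp only: abs_mult abs_divide) simp
  also have "\<dots> \<le> 2 * (2 * D / ?\<rho>) / (3/5) + 2 * 1 * (6 * D)"
    using 1 2 wz Im_div_rad_le[of w] pos
    by (intro add_mono frac_le mult_mono) (auto simp: D_def)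
  also have "\<dots> \<le> 7 * (D / ?\<rho>) + 12 * (2 * (D / ?\<rho>))"
  proof -
    have "D * ?\<rho> \<le> D * 2" using rad_le_2[OF z] by (intro mult_left_mono) (auto simp: D_def)
    then have "D \<le> 2 * (D / ?\<rho>)" using pos by (simp add: field_simps)
    moreover have "0 \<le> D / ?\<rho>" using pos by (simp add: D_def)
    ultimately show ?thesis by simp
  qed
  finally show ?thesis by (simp add: D_def)
qed

text \<open>The central estimate. Letting the points merge it bounds the gradient, and it also bounds the integrand of
the Douglas condition.\<close>

lemma cusp_param_diff_le:
  assumes z: "z \<in> cball 0 1" and r: "0 < rad w" "rad w \<le> rad z"
  shows "norm (cusp_param z - cusp_param w) \<le> (32 + 4 * \<beta>) * (norm (z - w) * modulus (rad z) (rad w))"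
proof -
  let ?\<rho> = "rad z" and ?\<sigma> = "rad w"
  define D where "D = norm (z - w)"
  define W where "W = modulus ?\<rho> ?\<sigma>"
  have W: "0 \<le> W" by (simp add: W_def modulus_nonneg)
  have \<rho>2: "?\<rho> \<le> 2" using rad_le_2[OF z] .
  have \<rho>D: "(?\<rho> - ?\<sigma>) * W \<le> D * W" using rad_diff[of z w] W by (intro mult_right_mono) (auto simp: D_def)
  have p: "\<bar>profile K ?\<rho> - profile K ?\<sigma>\<bar> \<le> D * W"
    using profile_diff_le[OF r \<rho>2, of 1] \<rho>D profile_nonneg by (simp add: b_def W_def)
  have "\<bar>profile K ?\<rho> powr \<beta> - profile K ?\<sigma> powr \<beta>\<bar> \<le> \<beta> * ((?\<rho> - ?\<sigma>) * W)"
    unfolding W_def using r \<rho>2 \<beta> by (intro profile_diff_le) (auto simp: b_def)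
  also have "\<dots> \<le> \<beta> * (D * W)" using \<rho>D \<beta> by (intro mult_left_mono) auto
  finally have q: "\<bar>profile K ?\<rho> powr \<beta> - profile K ?\<sigma> powr \<beta>\<bar> \<le> \<beta> * (D * W)" .
  have "\<bar>side z * profile K ?\<rho> powr \<beta> - side w * profile K ?\<sigma> powr \<beta>\<bar>
      = \<bar>(side z - side w) * profile K ?\<rho> powr \<beta> + side w * (profile K ?\<rho> powr \<beta> - profile K ?\<sigma> powr \<beta>)\<bar>"
    by (simp add: algebra_simps)
  also have "\<dots> \<le> \<bar>side z - side w\<bar> * profile K ?\<rho> powr \<beta> + \<bar>side w\<bar> * \<bar>profile K ?\<rho> powr \<beta> - profile K ?\<sigma> powr \<beta>\<bar>"
    by (rule order_trans[OF abs_triangle_ineq]) (simp add: abs_mult)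
  also have "\<dots> \<le> 31 * D / ?\<rho> * profile K ?\<rho> powr \<beta> + 4 * (\<beta> * (D * W))"
    using side_diff_le[OF z r] side_bound[of w] q by (intro add_mono mult_mono) (auto simp: D_def)
  also have "31 * D / ?\<rho> * profile K ?\<rho> powr \<beta> = 31 * (D * ((K - ln ?\<rho>) powr (- \<beta> / 2) / ?\<rho>))"
    using r by (subst profile_powr) auto
  also have "\<dots> \<le> 31 * (D * W)"
    unfolding W_def using inverse_rad_le_modulus[OF r \<rho>2] by (intro mult_left_mono) (auto simp: D_def)
  finally have im: "\<bar>Im (cusp_param z - cusp_param w)\<bar> \<le> 31 * (D * W) + 4 * (\<beta> * (D * W))" by (simp add: cusp_param_def)
  have "norm (cusp_param z - cusp_param w) \<le> \<bar>Re (cusp_param z - cusp_param w)\<bar> + \<bar>Im (cusp_param z - cusp_param w)\<bar>" by (rule cmod_le)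
  also have "\<dots> \<le> D * W + (31 * (D * W) + 4 * (\<beta> * (D * W)))"
    using p im by (intro add_mono) (auto simp: cusp_param_def)
  finally show ?thesis by (simp add: D_def W_def algebra_simps)
qed

lemma cusp_param_1 [simp]: "cusp_param 1 = 0"
  by (simp add: cusp_param_def complex_eq_iff)

lemma continuous_on_cusp_param: "continuous_on (cball 0 1) cusp_param"
proof -
  have contp: "continuous_on (cball 0 1) (\<lambda>z. profile K (rad z))"
    using rad_le_2
    by (intro continuous_on_compose2[OF continuous_on_profile[OF K]] continuous_intros) auto
  have contY: "continuous_on (cball 0 1) (\<lambda>z. profile K (rad z) powr \<beta>)"
    using \<beta> profile_nonneg by (intro continuous_on_powr' contp continuous_intros) auto
  have conti: "continuous_on (cball 0 1) (\<lambda>z. side z * profile K (rad z) powr \<beta>)"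
    unfolding continuous_on_eq_continuous_within
  proof
    fix z :: complex assume z: "z \<in> cball 0 1"
    have Y: "((\<lambda>z. profile K (rad z) powr \<beta>) \<longlongrightarrow> profile K (rad z) powr \<beta>) (at z within cball 0 1)"
      using contY z unfolding continuous_on_def by blast
    show "continuous (at z within cball 0 1) (\<lambda>z. side z * profile K (rad z) powr \<beta>)"
      unfolding continuous_within
    proof (cases "z = 1")
      case True
      have "((\<lambda>z. 4 * profile K (rad z) powr \<beta>) \<longlongrightarrow> 4 * (profile K (rad 1) powr \<beta>)) (at z within cball 0 1)"
        using tendsto_mult_left[OF Y, of 4] True by simp
      then have Y0: "((\<lambda>z. 4 * profile K (rad z) powr \<beta>) \<longlongrightarrow> 0) (at z within cball 0 1)" by simp
      have "((\<lambda>z. side z * profile K (rad z) powr \<beta>) \<longlongrightarrow> 0) (at z within cball 0 1)"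
        by (rule Lim_null_comparison[OF _ Y0], rule always_eventually)
           (use side_bound in \<open>auto simp: abs_mult intro: mult_right_mono\<close>)
      then show "((\<lambda>z. side z * profile K (rad z) powr \<beta>) \<longlongrightarrow> side z * profile K (rad z) powr \<beta>) (at z within cball 0 1)"
        using True by simp
    next
      case False
      have "(side \<longlongrightarrow> side z) (at z within cball 0 1)"
        unfolding side_def[abs_def] width_def
        using False width_ge[of "Re z"] by (intro tendsto_intros) (auto simp: width_def)
      then show "((\<lambda>z. side z * profile K (rad z) powr \<beta>) \<longlongrightarrow> side z * profile K (rad z) powr \<beta>) (at z within cball 0 1)"
        using Y by (rule tendsto_mult)
    qed
  qed
  then show ?thesis
    unfolding cusp_param_def[abs_def] Complex_eq
    by (intro continuous_on_add continuous_on_of_real continuous_on_mult continuous_on_const contp conti)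
qed

text \<open>So on the right part of the circle the upper half goes to the upper branch and the lower half to the lower
branch.\<close>

lemma cusp_param_circle:
  assumes z: "norm z = 1" "-4/5 \<le> Re z" "z \<noteq> 1"
  shows "cusp_param z = Complex (profile K (rad z)) (sgn (Im z) * profile K (rad z) powr \<beta>)"
proof -
  have n: "(Re z)\<^sup>2 + (Im z)\<^sup>2 = 1" using z(1) cmod_power2[of z] by simp
  have "(rad z)\<^sup>2 = 2 - 2 * Re z"
    using n unfolding cmod_power2 by (simp add: power2_eq_square algebra_simps)
  moreover have "(width (Re z))\<^sup>2 = 2 + 2 * Re z" using z(2) by (simp add: width_def)
  ultimately have "(rad z * width (Re z))\<^sup>2 = (2 - 2 * Re z) * (2 + 2 * Re z)" by (simp add: power_mult_distrib)
  also have "\<dots> = (2 * \<bar>Im z\<bar>)\<^sup>2" using n by (simp add: power2_eq_square algebra_simps)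
  finally have "rad z * width (Re z) = 2 * \<bar>Im z\<bar>"
    using width_ge[of "Re z"] power2_eq_imp_eq[of "rad z * width (Re z)" "2 * \<bar>Im z\<bar>"] by simp
  moreover have "Im z \<noteq> 0"
  proof
    assume "Im z = 0"
    then have "Re z = 1 \<or> Re z = -1" using n by (simp add: power2_eq_1_iff)
    then show False using z \<open>Im z = 0\<close> by (auto simp: complex_eq_iff)
  qed
  ultimately have "side z = sgn (Im z)" by (simp add: side_def sgn_if)
  then show ?thesis by (simp add: cusp_param_def)
qed

lemma differentiable_cusp_param:
  assumes z: "z \<noteq> 1" "z \<in> cball 0 1" "Re z \<noteq> -4/5"
  shows "cusp_param differentiable (at z)"
proof -
  have pos: "0 < rad z" using z by simp
  have L: "1 \<le> K - ln (rad z)" using log_gap_ge_1[OF K pos rad_le_2[OF z(2)]] .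
  have Re_d: "Re differentiable (at z)" "Im differentiable (at z)"
    by (auto intro!: bounded_linear_imp_differentiable bounded_linear_Re bounded_linear_Im)
  have w_d: "(\<lambda>z. width (Re z)) differentiable (at z)"
  proof (cases "Re z < -4/5")
    case True
    have "(\<lambda>z. sqrt (2/5)) differentiable (at z)" by simp
    moreover have "open {z. Re z < -4/5}" by (intro open_Collect_less continuous_intros)
    ultimately show ?thesis
      by (rule differentiable_transform_open) (use True in \<open>auto simp: width_def\<close>)
  next
    case False
    have "(\<lambda>x. sqrt (2 + 2 * x)) differentiable (at (Re z))"
      using False z(3) by (auto simp: real_differentiable_def intro!: derivative_eq_intros exI)
    then have "(\<lambda>z. sqrt (2 + 2 * Re z)) differentiable (at z)"
      using differentiable_chain_at[OF Re_d(1)] by (simp add: o_def)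
    moreover have "open {z. -4/5 < Re z}" by (intro open_Collect_less continuous_intros)
    ultimately show ?thesis
      by (rule differentiable_transform_open) (use False z(3) in \<open>auto simp: width_def\<close>)
  qed
  have r_d: "rad differentiable (at z)"
    using differentiable_norm_at[of "z - 1"] differentiable_chain_at[of "\<lambda>z. z - 1" z norm] z by (simp add: o_def)
  have pr: "profile K differentiable (at (rad z))"
  proof -
    have "((\<lambda>\<rho>. (K - ln \<rho>) powr (- (1/2))) has_real_derivative
        - (1/2) * (K - ln (rad z)) powr (- (1/2) - 1) * (0 - 1 / rad z)) (at (rad z))"
      using pos L by (auto intro!: derivative_eq_intros)
    then have "(\<lambda>\<rho>. (K - ln \<rho>) powr (- (1/2))) differentiable (at (rad z))"
      by (auto simp: real_differentiable_def)
    then show ?thesis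
      by (rule differentiable_transform_open[of _ _ "{0<..}"]) (use pos in \<open>auto simp: profile_def\<close>)
  qed
  have p_d: "(\<lambda>z. profile K (rad z)) differentiable (at z)"
    using differentiable_chain_at[OF r_d pr] by (simp add: o_def)
  have "(\<lambda>t. t powr \<beta>) differentiable (at (profile K (rad z)))"
    using profile_pos[OF K pos rad_le_2[OF z(2)]]
    by (auto simp: real_differentiable_def intro!: exI derivative_eq_intros)
  then have Y_d: "(\<lambda>z. profile K (rad z) powr \<beta>) differentiable (at z)"
    using differentiable_chain_at[OF p_d] by (simp add: o_def)
  have "side differentiable (at z)"
    unfolding side_def[abs_def] using pos width_ge[of "Re z"]
    by (intro differentiable_divide differentiable_mult Re_d w_d r_d differentiable_const) auto
  then have "(\<lambda>z. side z * profile K (rad z) powr \<beta>) differentiable (at z)"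
    using Y_d by (intro differentiable_mult)
  moreover have "bounded_linear complex_of_real" by (rule bounded_linear_of_real)
  ultimately have "(\<lambda>z. of_real (profile K (rad z)) + \<i> * of_real (side z * profile K (rad z) powr \<beta>)) differentiable (at z)"
    using p_d differentiable_chain_at[OF _ bounded_linear_imp_differentiable[OF bounded_linear_of_real], unfolded o_def]
    by (intro differentiable_add differentiable_mult differentiable_const) blast+
  then show ?thesis unfolding cusp_param_def[abs_def] Complex_eq by simp
qed

end

section \<open>The boundary homeomorphism and its extension\<close>

text \<open>The points \<open>-4/5 \<plusminus> 3/5 \<i>\<close> of the circle are where the cusp parametrization ends and the complementary arc \<open>\<Gamma>\<close>
begins. The arc is parametrized by the imaginary part of the point of the circle.\<close>

locale cusp_extension = cusp_geometry \<Omega> p u r \<beta> + cusp_map K \<beta> for \<Omega> p u r \<beta> K +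
  fixes \<Gamma> :: "real \<Rightarrow> complex" and L\<Gamma> :: real and x1 :: real
  assumes x1_def: "x1 = profile K (norm (Complex (-4/5) (3/5) - 1))"
    and x1_size: "x1 + x1 powr \<beta> < r"
    and \<Gamma>_lip: "L\<Gamma>-lipschitz_on {-(3/5)..3/5} \<Gamma>"
    and \<Gamma>_inj: "inj_on \<Gamma> {-(3/5)..3/5}"
    and \<Gamma>_img: "\<Gamma> ` {-(3/5)..3/5} = frontier \<Omega> - tip x1"
    and \<Gamma>_ends: "\<Gamma> (3/5) = upper x1" "\<Gamma> (-(3/5)) = lower x1"
    and \<Gamma>_diff: "\<And>y. y \<in> {-(3/5)<..<3/5} \<Longrightarrow> \<Gamma> differentiable (at y)"
begin

definition left_arc :: "real \<Rightarrow> complex" where "left_arc y = Complex (- sqrt (1 - y\<^sup>2)) y"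
definition clamp35 :: "real \<Rightarrow> real" where "clamp35 y = max (-(3/5)) (min (3/5) y)"
text \<open>The difference between the wanted boundary values and the cusp parametrization on the left part of the
circle, as a function of the imaginary part. It vanishes at the ends and is continued by zero.\<close>

definition correction :: "real \<Rightarrow> complex" where "correction y = \<Gamma> (clamp35 y) - (p + u * cusp_param (left_arc (clamp35 y)))"
text \<open>Each horizontal line through the left part of the circle meets the circle also on its right part, where the correction
must not be added.\<close>

definition cutoff :: "real \<Rightarrow> real" where "cutoff x = min 1 (max 0 (- (5/4) * x))"
text \<open>The boundary homeomorphism is the restriction of this function to the circle.\<close>

definition ext :: "complex \<Rightarrow> complex" where
  "ext z = p + u * cusp_param z + cutoff (Re z) *\<^sub>R correction (Im z)"

lemma clamp35_in: "clamp35 y \<in> {-(3/5)..3/5}"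
  by (auto simp: clamp35_def)

lemma clamp35_lip: "\<bar>clamp35 y - clamp35 y'\<bar> \<le> \<bar>y - y'\<bar>"
  by (auto simp: clamp35_def max_def min_def)

lemma left_arc_sqrt_ge:
  assumes "y \<in> {-(3/5)..3/5}"
  shows "4/5 \<le> sqrt (1 - y\<^sup>2)" "y\<^sup>2 \<le> 9/25"
proof -
  have "\<bar>y\<bar>\<^sup>2 \<le> (3/5)\<^sup>2" using assms by (intro power_mono) auto
  then show "y\<^sup>2 \<le> 9/25" by (simp add: power2_eq_square)
  then show "4/5 \<le> sqrt (1 - y\<^sup>2)" by (intro real_le_rsqrt) (auto simp: power2_eq_square)
qed

lemma norm_left_arc:
  assumes "y \<in> {-(3/5)..3/5}"
  shows "norm (left_arc y) = 1"
  using left_arc_sqrt_ge(2)[OF assms] by (simp add: left_arc_def cmod_def)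

lemma rad_left_arc_ge:
  assumes "y \<in> {-(3/5)..3/5}"
  shows "1 \<le> rad (left_arc y)"
proof -
  have "\<bar>Re (left_arc y - 1)\<bar> \<ge> 9/5" using left_arc_sqrt_ge(1)[OF assms] by (simp add: left_arc_def)
  then show ?thesis using abs_Re_le_cmod[of "left_arc y - 1"] by linarith
qed

lemma left_arc_lip:
  assumes y: "y \<in> {-(3/5)..3/5}" and y': "y' \<in> {-(3/5)..3/5}"
  shows "norm (left_arc y - left_arc y') \<le> 2 * \<bar>y - y'\<bar>"
proof -
  let ?a = "sqrt (1 - y\<^sup>2)" and ?b = "sqrt (1 - y'\<^sup>2)"
  have s: "8/5 \<le> ?a + ?b" using left_arc_sqrt_ge(1)[OF y] left_arc_sqrt_ge(1)[OF y'] by simp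
  have "(?a - ?b) * (?a + ?b) = (y' - y) * (y' + y)"
    using left_arc_sqrt_ge(2)[OF y] left_arc_sqrt_ge(2)[OF y'] by (simp add: algebra_simps power2_eq_square)
  then have "\<bar>?a - ?b\<bar> * \<bar>?a + ?b\<bar> = \<bar>y' - y\<bar> * \<bar>y' + y\<bar>" by (simp only: abs_mult[symmetric])
  moreover have "\<bar>?a - ?b\<bar> * (8/5) \<le> \<bar>?a - ?b\<bar> * \<bar>?a + ?b\<bar>" using s by (intro mult_left_mono) auto
  moreover have "\<bar>y' - y\<bar> * \<bar>y' + y\<bar> \<le> \<bar>y' - y\<bar> * (6/5)"
  proof (intro mult_left_mono)
    show "\<bar>y' + y\<bar> \<le> 6/5" by (rule abs_leI) (use y y' in auto)
  qed auto
  ultimately have "\<bar>?a - ?b\<bar> * (8/5) \<le> \<bar>y' - y\<bar> * (6/5)" by linarith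
  moreover have "a \<le> d" if "a * (8/5) \<le> d * (6/5)" "0 \<le> d" for a d :: real using that by linarith
  ultimately have "\<bar>?a - ?b\<bar> \<le> \<bar>y - y'\<bar>" unfolding abs_minus_commute[of y y'] using abs_ge_zero by blast
  then show ?thesis
    using cmod_le[of "left_arc y - left_arc y'"] by (simp add: left_arc_def abs_minus_commute)
qed

lemma cusp_param_diff_sym:
  assumes "z \<in> cball 0 1" "w \<in> cball 0 1" "z \<noteq> 1" "w \<noteq> 1"
  shows "norm (cusp_param z - cusp_param w) \<le> (32 + 4 * \<beta>) * (norm (z - w) * modulus (max (rad z) (rad w)) (min (rad z) (rad w)))"
proof (cases "rad w \<le> rad z")
  case True
  then have "max (rad z) (rad w) = rad z" "min (rad z) (rad w) = rad w" by simp_all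
  then show ?thesis using cusp_param_diff_le[OF assms(1) _ True] assms by simp
next
  case False
  then have "max (rad z) (rad w) = rad w" "min (rad z) (rad w) = rad z" by simp_all
  then show ?thesis using cusp_param_diff_le[OF assms(2), of z] False assms by (simp add: norm_minus_commute)
qed

lemma modulus_le_1:
  assumes "1 \<le> \<rho>" "\<rho> \<le> 2" "1 \<le> \<sigma>"
  shows "modulus \<rho> \<sigma> \<le> 1"
proof -
  have "(K - ln \<rho>) powr (- b / 2) \<le> 1 powr (- b / 2)"
    using log_gap_ge_1[OF K, of \<rho>] assms \<beta> by (intro powr_mono2') (auto simp: b_def)
  moreover have "1 * 1 \<le> \<rho> powr (3/4) * \<sigma> powr (1/4)"
    using assms by (intro mult_mono ge_one_powr_ge_zero) auto
  ultimately show ?thesis unfolding modulus_def by (simp add: divide_le_eq_1)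
qed

lemma cusp_param_left_arc_lip:
  assumes y: "y \<in> {-(3/5)..3/5}" and y': "y' \<in> {-(3/5)..3/5}"
  shows "norm (cusp_param (left_arc y) - cusp_param (left_arc y')) \<le> (64 + 8 * \<beta>) * \<bar>y - y'\<bar>"
proof -
  have c: "left_arc y \<in> cball 0 1" "left_arc y' \<in> cball 0 1" using norm_left_arc[OF y] norm_left_arc[OF y'] by auto
  note r = rad_left_arc_ge[OF y] rad_left_arc_ge[OF y'] rad_le_2[OF c(1)] rad_le_2[OF c(2)]
  have "left_arc y \<noteq> 1" "left_arc y' \<noteq> 1" using r by auto
  from cusp_param_diff_sym[OF c this]
  have "norm (cusp_param (left_arc y) - cusp_param (left_arc y')) \<le> (32 + 4 * \<beta>) * (norm (left_arc y - left_arc y') *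
      modulus (max (rad (left_arc y)) (rad (left_arc y'))) (min (rad (left_arc y)) (rad (left_arc y'))))" .
  also have "\<dots> \<le> (32 + 4 * \<beta>) * ((2 * \<bar>y - y'\<bar>) * 1)"
    using r \<beta> by (intro mult_left_mono mult_mono left_arc_lip y y' modulus_le_1 modulus_nonneg) auto
  also have "\<dots> = (64 + 8 * \<beta>) * \<bar>y - y'\<bar>" by (simp add: algebra_simps)
  finally show ?thesis .
qed

definition Lc :: real where "Lc = L\<Gamma> + (64 + 8 * \<beta>)"

lemma Lc_nonneg: "0 \<le> Lc" "0 \<le> L\<Gamma>"
  using lipschitz_on_nonneg[OF \<Gamma>_lip] \<beta> by (auto simp: Lc_def)

lemma correction_lip: "norm (correction y - correction y') \<le> Lc * \<bar>y - y'\<bar>"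
proof -
  let ?c = "clamp35 y" and ?c' = "clamp35 y'"
  have "norm (correction y - correction y') = norm ((\<Gamma> ?c - \<Gamma> ?c') - u * (cusp_param (left_arc ?c) - cusp_param (left_arc ?c')))"
    by (simp add: correction_def algebra_simps)
  also have "\<dots> \<le> norm (\<Gamma> ?c - \<Gamma> ?c') + norm (u * (cusp_param (left_arc ?c) - cusp_param (left_arc ?c')))"
    by (rule norm_triangle_ineq4)
  also have "\<dots> \<le> L\<Gamma> * \<bar>?c - ?c'\<bar> + (64 + 8 * \<beta>) * \<bar>?c - ?c'\<bar>"
    using lipschitz_onD[OF \<Gamma>_lip clamp35_in clamp35_in, of y y'] cusp_param_left_arc_lip[OF clamp35_in clamp35_in, of y y']
    by (intro add_mono) (simp_all add: dist_norm norm_mult norm_u)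
  also have "\<dots> = Lc * \<bar>?c - ?c'\<bar>" by (simp add: Lc_def algebra_simps)
  also have "\<dots> \<le> Lc * \<bar>y - y'\<bar>" using Lc_nonneg clamp35_lip by (intro mult_left_mono) auto
  finally show ?thesis .
qed

lemma left_arc_end: "left_arc (3/5) = Complex (-4/5) (3/5)" "left_arc (-(3/5)) = Complex (-4/5) (-(3/5))"
proof -
  have "sqrt (1 - (3/5)\<^sup>2) = (4/5 :: real)"
    by (rule real_sqrt_unique) (auto simp: power2_eq_square)
  then show "left_arc (3/5) = Complex (-4/5) (3/5)" "left_arc (-(3/5)) = Complex (-4/5) (-(3/5))"
    by (auto simp: left_arc_def)
qed

lemma cusp_param_right:
  assumes z: "norm z = 1" "-4/5 \<le> Re z"
  shows "Im z > 0 \<Longrightarrow> p + u * cusp_param z = upper (profile K (rad z))"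
    and "Im z < 0 \<Longrightarrow> p + u * cusp_param z = lower (profile K (rad z))"
    and "Im z = 0 \<Longrightarrow> z = 1"
proof -
  have n: "(Re z)\<^sup>2 + (Im z)\<^sup>2 = 1" using z(1) cmod_power2[of z] by simp
  show "Im z = 0 \<Longrightarrow> z = 1"
    using n z by (auto simp: power2_eq_1_iff complex_eq_iff)
  show "Im z > 0 \<Longrightarrow> p + u * cusp_param z = upper (profile K (rad z))"
    by (subst cusp_param_circle) (use z in \<open>auto simp: upper_def\<close>)
  show "Im z < 0 \<Longrightarrow> p + u * cusp_param z = lower (profile K (rad z))"
    by (subst cusp_param_circle) (use z in \<open>auto simp: lower_def\<close>)
qed

lemma correction_zero: "3/5 \<le> \<bar>y\<bar> \<Longrightarrow> correction y = 0"
proof -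
  assume y: "3/5 \<le> \<bar>y\<bar>"
  have n: "norm (Complex (-4/5) (3/5)) = 1" "norm (Complex (-4/5) (-(3/5))) = 1"
    by (simp_all add: cmod_def power2_eq_square)
  have r: "norm (Complex (-4/5) (-(3/5)) - 1) = norm (Complex (-4/5) (3/5) - 1)"
    by (simp add: cmod_def)
  have e: "\<Gamma> (3/5) = p + u * cusp_param (left_arc (3/5))" "\<Gamma> (-(3/5)) = p + u * cusp_param (left_arc (-(3/5)))"
    using cusp_param_right(1)[OF n(1)] cusp_param_right(2)[OF n(2)] r unfolding \<Gamma>_ends left_arc_end x1_def by simp_all
  have "clamp35 y = 3/5 \<or> clamp35 y = -(3/5)" using y by (auto simp: clamp35_def)
  then show "correction y = 0" by (elim disjE) (simp_all only: correction_def e diff_self)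
qed

lemma correction_bound: "norm (correction y) \<le> 2 * Lc"
proof (cases "3/5 \<le> \<bar>y\<bar>")
  case True then show ?thesis using correction_zero Lc_nonneg by simp
next
  case False
  have "norm (correction y) = norm (correction y - correction (3/5))" by (simp add: correction_zero)
  also have "\<dots> \<le> Lc * \<bar>y - 3/5\<bar>" by (rule correction_lip)
  also have "\<dots> \<le> Lc * 2" using False Lc_nonneg by (intro mult_left_mono) auto
  finally show ?thesis by simp
qed

lemma cutoff_bounds: "0 \<le> cutoff x" "cutoff x \<le> 1" "\<bar>cutoff x - cutoff y\<bar> \<le> 5/4 * \<bar>x - y\<bar>"
  by (auto simp: cutoff_def max_def min_def abs_if)

lemma cutoff_correction_lip:
  "norm (cutoff (Re z) *\<^sub>R correction (Im z) - cutoff (Re w) *\<^sub>R correction (Im w)) \<le> 4 * Lc * norm (z - w)"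
proof -
  have "norm (cutoff (Re z) *\<^sub>R correction (Im z) - cutoff (Re w) *\<^sub>R correction (Im w))
      = norm (cutoff (Re z) *\<^sub>R (correction (Im z) - correction (Im w)) + (cutoff (Re z) - cutoff (Re w)) *\<^sub>R correction (Im w))"
    by (simp add: algebra_simps)
  also have "\<dots> \<le> norm (cutoff (Re z) *\<^sub>R (correction (Im z) - correction (Im w))) + norm ((cutoff (Re z) - cutoff (Re w)) *\<^sub>R correction (Im w))"
    by (rule norm_triangle_ineq)
  also have "\<dots> = cutoff (Re z) * norm (correction (Im z) - correction (Im w)) + \<bar>cutoff (Re z) - cutoff (Re w)\<bar> * norm (correction (Im w))"
    using cutoff_bounds(1) by simp
  also have "\<dots> \<le> 1 * (Lc * norm (z - w)) + (5/4 * norm (z - w)) * (2 * Lc)"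
  proof (intro add_mono mult_mono)
    show "norm (correction (Im z) - correction (Im w)) \<le> Lc * norm (z - w)"
    proof -
      have "\<bar>Im z - Im w\<bar> \<le> norm (z - w)" using abs_Im_le_cmod[of "z - w"] by simp
      from mult_left_mono[OF this Lc_nonneg(1)] correction_lip[of "Im z" "Im w"] show ?thesis by linarith
    qed
    show "\<bar>cutoff (Re z) - cutoff (Re w)\<bar> \<le> 5/4 * norm (z - w)"
      using cutoff_bounds(3)[of "Re z" "Re w"] abs_Re_le_cmod[of "z - w"] by simp
  qed (use cutoff_bounds correction_bound Lc_nonneg in auto)
  also have "\<dots> \<le> 4 * Lc * norm (z - w)"
    using mult_nonneg_nonneg[OF Lc_nonneg(1) norm_ge_zero[of "z - w"]] by simp
  finally show ?thesis .
qed

lemma ext_diff_le: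
  assumes "z \<in> cball 0 1" "w \<in> cball 0 1" "z \<noteq> 1" "w \<noteq> 1"
  shows "norm (ext z - ext w) \<le> norm (z - w) *
    ((32 + 4 * \<beta>) * modulus (max (rad z) (rad w)) (min (rad z) (rad w)) + 4 * Lc)"
proof -
  have "ext z - ext w = u * (cusp_param z - cusp_param w) + (cutoff (Re z) *\<^sub>R correction (Im z) - cutoff (Re w) *\<^sub>R correction (Im w))"
    by (simp add: ext_def algebra_simps)
  then have "norm (ext z - ext w) \<le> norm (cusp_param z - cusp_param w) + norm (cutoff (Re z) *\<^sub>R correction (Im z) - cutoff (Re w) *\<^sub>R correction (Im w))"
    using norm_triangle_ineq[of "u * (cusp_param z - cusp_param w)" "cutoff (Re z) *\<^sub>R correction (Im z) - cutoff (Re w) *\<^sub>R correction (Im w)"]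
    by (simp add: norm_mult norm_u)
  also have "\<dots> \<le> (32 + 4 * \<beta>) * (norm (z - w) * modulus (max (rad z) (rad w)) (min (rad z) (rad w))) + 4 * Lc * norm (z - w)"
    by (intro add_mono cusp_param_diff_sym assms cutoff_correction_lip)
  finally show ?thesis by (simp add: algebra_simps)
qed

lemma ext_right:
  assumes z: "norm z = 1" "-4/5 \<le> Re z"
  shows "ext z = p + u * cusp_param z"
proof (cases "0 \<le> Re z")
  case True then show ?thesis by (simp add: ext_def cutoff_def)
next
  case False
  have n: "(Re z)\<^sup>2 + (Im z)\<^sup>2 = 1" using z(1) cmod_power2[of z] by simp
  have "\<bar>Re z\<bar>\<^sup>2 \<le> (4/5)\<^sup>2" using False z by (intro power_mono) auto
  then have "(3/5)\<^sup>2 \<le> \<bar>Im z\<bar>\<^sup>2" using n by (simp add: power2_eq_square)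
  then have "3/5 \<le> \<bar>Im z\<bar>" by (rule power2_le_imp_le) simp
  then show ?thesis by (simp add: ext_def correction_zero)
qed

lemma left_arc_param:
  assumes z: "norm z = 1" "Re z \<le> -4/5"
  shows "Im z \<in> {-(3/5)..3/5}" "left_arc (Im z) = z"
proof -
  have n: "(Re z)\<^sup>2 + (Im z)\<^sup>2 = 1" using z(1) cmod_power2[of z] by simp
  have "(4/5)\<^sup>2 \<le> \<bar>Re z\<bar>\<^sup>2" using z by (intro power_mono) auto
  then have "\<bar>Im z\<bar>\<^sup>2 \<le> (3/5)\<^sup>2" using n by (simp add: power2_eq_square)
  then have "\<bar>Im z\<bar> \<le> 3/5" by (rule power2_le_imp_le) simp
  then show "Im z \<in> {-(3/5)..3/5}" by auto
  have "1 - (Im z)\<^sup>2 = (Re z)\<^sup>2" using n by simp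
  then show "left_arc (Im z) = z" using z by (simp add: left_arc_def complex_eq_iff)
qed

lemma ext_left:
  assumes z: "norm z = 1" "Re z \<le> -4/5"
  shows "ext z = \<Gamma> (Im z)"
proof -
  note l = left_arc_param[OF z]
  have "clamp35 (Im z) = Im z" using l by (simp add: clamp35_def)
  moreover have "cutoff (Re z) = 1" using z by (simp add: cutoff_def)
  ultimately show ?thesis using l by (simp add: ext_def correction_def)
qed

lemma ext_1: "ext 1 = p"
  by (simp add: ext_def cutoff_def)

lemma continuous_correction: "continuous_on UNIV correction"
proof (rule lipschitz_on_continuous_on)
  show "Lc-lipschitz_on UNIV correction"
    using correction_lip Lc_nonneg by (intro lipschitz_onI) (auto simp: dist_norm)
qed

lemma continuous_cutoff: "continuous_on UNIV cutoff"
  unfolding cutoff_def by (intro continuous_intros)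

lemma continuous_ext: "continuous_on (cball 0 1) ext"
  unfolding ext_def
  by (intro continuous_intros continuous_on_cusp_param continuous_on_compose2[OF continuous_correction]
      continuous_on_compose2[OF continuous_cutoff]) auto

lemma ext_measurable: "ext \<in> borel_measurable borel"
proof -
  have [measurable]: "correction \<in> borel_measurable borel" "cutoff \<in> borel_measurable borel"
    using continuous_correction continuous_cutoff by (auto intro: borel_measurable_continuous_onI)
  have [measurable]: "profile K \<in> borel_measurable borel" unfolding profile_def by measurable
  have [measurable]: "width \<in> borel_measurable borel" unfolding width_def by measurable
  have [measurable]: "side \<in> borel_measurable borel" unfolding side_def by measurable
  show ?thesis unfolding ext_def cusp_param_def Complex_eq by measurable
qed

lemma differentiable_correction:
  assumes "\<bar>y\<bar> \<noteq> 3/5"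
  shows "correction differentiable (at y)"
proof (cases "\<bar>y\<bar> < 3/5")
  case True
  have y: "y \<in> {-(3/5)..3/5}" using True by auto
  have "y\<^sup>2 < (3/5)\<^sup>2" using True by (simp add: power2_strict_mono abs_less_iff flip: abs_square_less_1)
  then have y2: "y\<^sup>2 < 9/25" by (simp add: power2_eq_square)
  have "4/5 < sqrt (1 - y\<^sup>2)" using y2 by (intro real_less_rsqrt) (auto simp: power2_eq_square)
  have sq: "(\<lambda>y. - sqrt (1 - y\<^sup>2)) differentiable (at y)"
    using y2 by (auto simp: real_differentiable_def intro!: exI derivative_eq_intros)
  have left_arc_d: "left_arc differentiable (at y)"
    unfolding left_arc_def[abs_def] Complex_eq
    using differentiable_chain_at[OF sq bounded_linear_imp_differentiable[OF bounded_linear_of_real], unfolded o_def]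
    by (intro differentiable_add differentiable_mult differentiable_const
        bounded_linear_imp_differentiable[OF bounded_linear_of_real]) blast
  have "cusp_param differentiable (at (left_arc y))"
  proof (rule differentiable_cusp_param)
    show "left_arc y \<noteq> 1" using rad_left_arc_ge[OF y] by auto
    show "left_arc y \<in> cball 0 1" using norm_left_arc[OF y] by simp
    show "Re (left_arc y) \<noteq> -4/5" using \<open>4/5 < sqrt (1 - y\<^sup>2)\<close> by (simp add: left_arc_def)
  qed
  then have "(\<lambda>y. cusp_param (left_arc y)) differentiable (at y)"
    using differentiable_chain_at[OF left_arc_d] by (simp add: o_def)
  then have "(\<lambda>y. \<Gamma> y - (p + u * cusp_param (left_arc y))) differentiable (at y)"
    using True by (intro differentiable_diff \<Gamma>_diff differentiable_add differentiable_mult differentiable_const) auto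
  then show ?thesis
    by (rule differentiable_transform_open[of _ _ "{-(3/5)<..<3/5}"]) (use True in \<open>auto simp: correction_def clamp35_def\<close>)
next
  case False
  have "(\<lambda>y. 0) differentiable (at y)" by simp
  moreover have "open {y::real. 3/5 < \<bar>y\<bar>}" by (intro open_Collect_less continuous_intros)
  ultimately show ?thesis
    by (rule differentiable_transform_open) (use False assms correction_zero in auto)
qed

lemma differentiable_cutoff:
  assumes "x \<noteq> 0" "x \<noteq> -4/5"
  shows "cutoff differentiable (at x)"
proof -
  consider "0 < x" | "-4/5 < x" "x < 0" | "x < -4/5" using assms by linarith
  then show ?thesis
  proof cases
    case 1
    have "(\<lambda>x. 0) differentiable (at x)" by simp
    then show ?thesis
      by (rule differentiable_transform_open[of _ _ "{0<..}"]) (use 1 in \<open>auto simp: cutoff_def\<close>)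
  next
    case 2
    have "(\<lambda>x. - (5/4) * x) differentiable (at x)" by (auto intro!: derivative_intros)
    then show ?thesis
      by (rule differentiable_transform_open[of _ _ "{-4/5<..<0}"]) (use 2 in \<open>auto simp: cutoff_def\<close>)
  next
    case 3
    have "(\<lambda>x. 1) differentiable (at x)" by simp
    then show ?thesis
      by (rule differentiable_transform_open[of _ _ "{..<-4/5}"]) (use 3 in \<open>auto simp: cutoff_def\<close>)
  qed
qed

lemma differentiable_ext:
  assumes z: "z \<in> ball 0 1" "Re z \<noteq> -4/5" "Re z \<noteq> 0" "\<bar>Im z\<bar> \<noteq> 3/5"
  shows "ext differentiable (at z)"
proof -
  have "cusp_param differentiable (at z)" using z by (intro differentiable_cusp_param) auto
  moreover have "(\<lambda>z. cutoff (Re z)) differentiable (at z)"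
    using differentiable_chain_at[OF bounded_linear_imp_differentiable[OF bounded_linear_Re] differentiable_cutoff, of z] z
    by (simp add: o_def)
  moreover have "(\<lambda>z. correction (Im z)) differentiable (at z)"
    using differentiable_chain_at[OF bounded_linear_imp_differentiable[OF bounded_linear_Im] differentiable_correction, of z] z
    by (simp add: o_def)
  ultimately show ?thesis
    unfolding ext_def[abs_def]
    by (intro differentiable_add differentiable_mult differentiable_const differentiable_scaleR)
qed

lemma circle_coordinates:
  assumes "norm z = 1"
  shows "(Re z)\<^sup>2 + (Im z)\<^sup>2 = 1" "(rad z)\<^sup>2 = 2 - 2 * Re z"
proof -
  show a: "(Re z)\<^sup>2 + (Im z)\<^sup>2 = 1" using assms cmod_power2[of z] by simp
  show "(rad z)\<^sup>2 = 2 - 2 * Re z" using a unfolding cmod_power2 by (simp add: power2_eq_square algebra_simps)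
qed

lemma end_radius:
  "norm (Complex (-4/5) (3/5) - 1) \<le> 2" "(norm (Complex (-4/5) (3/5) - 1))\<^sup>2 = 18/5" "0 < x1"
proof -
  show le2: "norm (Complex (-4/5) (3/5) - 1) \<le> 2" by (rule rad_le_2) (simp add: cmod_def power2_eq_square)
  show "(norm (Complex (-4/5) (3/5) - 1))\<^sup>2 = 18/5" unfolding cmod_power2 by (simp add: power2_eq_square)
  have "Complex (-4/5) (3/5) - 1 \<noteq> 0" by (simp add: complex_eq_iff)
  then show "0 < x1" unfolding x1_def using profile_pos[OF K _ le2] by simp
qed

lemma ext_right_tip:
  assumes z: "norm z = 1" "-4/5 < Re z"
  shows "ext z \<in> tip x1"
proof -
  have "(rad z)\<^sup>2 < (norm (Complex (-4/5) (3/5) - 1))\<^sup>2"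
    using circle_coordinates(2)[OF z(1)] end_radius(2) z(2) by simp
  then have "rad z < norm (Complex (-4/5) (3/5) - 1)" by (rule power2_less_imp_less) simp
  then have lt: "profile K (rad z) \<in> {0..<x1}"
    using profile_strict_mono[OF K _ _ end_radius(1)] profile_nonneg by (simp add: x1_def)
  consider "Im z > 0" | "Im z < 0" | "Im z = 0" by linarith
  then show ?thesis
  proof cases
    case 3
    then have "z = 1" using cusp_param_right(3) z by simp
    then show ?thesis using end_radius(3) upper_0 ext_1 by (force simp: tip_def)
  qed (use ext_right cusp_param_right z lt in \<open>auto simp: tip_def\<close>)
qed

text \<open>The right part of the circle goes to the tip and the left part to its complement. On the right part the
abscissa determines the distance to \<open>1\<close>, and the sign of the ordinate determines the half of the circle.\<close>

lemma ext_inj: "inj_on ext (sphere 0 1)"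
proof -
  have left_tip: "ext z \<notin> tip x1" if z: "norm z = 1" "Re z \<le> -4/5" for z
    using left_arc_param[OF z] \<Gamma>_img unfolding ext_left[OF z] by blast
  show ?thesis
  proof (rule inj_onI)
    fix z w assume zw: "z \<in> sphere 0 1" "w \<in> sphere 0 1" and eq: "ext z = ext w"
    have n: "norm z = 1" "norm w = 1" using zw by auto
    show "z = w"
    proof (cases "Re z \<le> -4/5")
      case True
      then have w: "Re w \<le> -4/5" using left_tip ext_right_tip eq n by (metis not_le)
      have "Im z = Im w"
        using inj_onD[OF \<Gamma>_inj _ left_arc_param(1)[OF n(1) True] left_arc_param(1)[OF n(2) w]] eq
          ext_left[OF n(1) True] ext_left[OF n(2) w] by simp
      then show ?thesis using left_arc_param(2)[OF n(1) True] left_arc_param(2)[OF n(2) w] by metis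
    next
      case False
      then have w: "-4/5 < Re w" using left_tip ext_right_tip eq n by (metis not_le)
      have "coord (ext z) = coord (ext w)" using eq by simp
      then have EE: "cusp_param z = cusp_param w" using ext_right n False w by (simp add: coord_inverse)
      have r2: "rad z \<le> 2" "rad w \<le> 2" using rad_le_2 n by auto
      have "profile K (rad z) = profile K (rad w)" using EE by (simp add: cusp_param_def)
      then have rr: "rad z = rad w"
        using profile_strict_mono[OF K norm_ge_zero _ r2(1), of "w - 1"] profile_strict_mono[OF K norm_ge_zero _ r2(2), of "z - 1"]
        by (metis less_irrefl linorder_neqE_linordered_idom)
      have re: "Re z = Re w" using circle_coordinates(2)[OF n(1)] circle_coordinates(2)[OF n(2)] rr by simp
      then have "(Im z)\<^sup>2 = (Im w)\<^sup>2" using circle_coordinates(1)[OF n(1)] circle_coordinates(1)[OF n(2)] by simp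
      then have im: "\<bar>Im z\<bar> = \<bar>Im w\<bar>" by (simp add: power2_eq_iff abs_eq_iff)
      show ?thesis
      proof (cases "z = 1 \<or> w = 1")
        case True
        then have "rad z = 0" using rr by auto
        then show ?thesis using rr by simp
      next
        case False
        then have pos: "0 < profile K (rad z) powr \<beta>" using profile_pos[OF K _ r2(1)] by simp
        have "sgn (Im z) * profile K (rad z) powr \<beta> = sgn (Im w) * profile K (rad z) powr \<beta>"
        proof -
          have "Im (cusp_param z) = sgn (Im z) * profile K (rad z) powr \<beta>"
            using cusp_param_circle[OF n(1)] False \<open>\<not> Re z \<le> -4/5\<close> by simp
          moreover have "Im (cusp_param w) = sgn (Im w) * profile K (rad w) powr \<beta>"
            using cusp_param_circle[OF n(2)] False w by simp
          ultimately show ?thesis using EE rr by auto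
        qed
        then have "sgn (Im z) = sgn (Im w)" using pos by simp
        then have "Im z = Im w" using im by (metis abs_sgn mult_sgn_abs)
        then show ?thesis using re by (simp add: complex_eq_iff)
      qed
    qed
  qed
qed

lemma ext_onto: "ext ` sphere 0 1 = frontier \<Omega>"
proof -
  let ?\<rho>1 = "norm (Complex (-4/5) (3/5) - 1)"
  note rho12 = end_radius(1) and rho1sq = end_radius(2) and x1pos = end_radius(3)
  have tipJ: "tip x1 \<subseteq> frontier \<Omega>" using tip_eq[OF x1_size x1pos] by auto
  show ?thesis
  proof (intro equalityI subsetI)
    fix q assume "q \<in> ext ` sphere 0 1"
    then obtain z where z: "norm z = 1" "q = ext z" by auto
    show "q \<in> frontier \<Omega>"
    proof (cases "Re z \<le> -4/5")
      case True
      then show ?thesis using ext_left[OF z(1) True] left_arc_param(1)[OF z(1) True] \<Gamma>_img z(2) by blast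
    next
      case False
      then have "q \<in> tip x1" using ext_right_tip z by simp
      then show ?thesis using tipJ by blast
    qed
  next
    fix q assume q: "q \<in> frontier \<Omega>"
    show "q \<in> ext ` sphere 0 1"
    proof (cases "q \<in> tip x1")
      case False
      then obtain y where y: "y \<in> {-(3/5)..3/5}" "q = \<Gamma> y" using q \<Gamma>_img by blast
      have "Re (left_arc y) \<le> -4/5" using left_arc_sqrt_ge(1)[OF y(1)] by (simp add: left_arc_def)
      then have "ext (left_arc y) = q" using ext_left[OF norm_left_arc[OF y(1)]] y by (simp add: left_arc_def)
      then show ?thesis using norm_left_arc[OF y(1)] by force
    next
      case True
      then obtain x where x: "0 \<le> x" "x < x1" "q = upper x \<or> q = lower x" by (auto simp: tip_def)
      show ?thesis
      proof (cases "x = 0")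
        case True
        then have "q = ext 1" using x upper_0 lower_0 ext_1 by auto
        then show ?thesis by force
      next
        case False
        have "\<exists>\<rho>\<ge>0. \<rho> \<le> ?\<rho>1 \<and> profile K \<rho> = x"
          by (rule IVT') (use x rho12 in \<open>auto simp: x1_def intro: continuous_on_subset[OF continuous_on_profile[OF K]]\<close>)
        then obtain \<rho> where \<rho>: "0 \<le> \<rho>" "\<rho> \<le> ?\<rho>1" "profile K \<rho> = x" by auto
        have \<rho>0: "0 < \<rho>" using \<rho> False by (cases "\<rho> = 0") auto
        have "\<rho> \<noteq> ?\<rho>1" using \<rho> x by (auto simp: x1_def)
        then have "\<rho> < ?\<rho>1" using \<rho> by simp
        then have "\<rho>\<^sup>2 < ?\<rho>1\<^sup>2" using \<rho> by (intro power_strict_mono) auto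
        then have \<rho>sq: "\<rho>\<^sup>2 < 18/5" "0 < \<rho>\<^sup>2" using rho1sq \<rho>0 by auto
        define c where "c = 1 - \<rho>\<^sup>2 / 2"
        have c: "-4/5 < c" "c < 1" using \<rho>sq by (auto simp: c_def)
        have "\<bar>c\<bar> < 1" using c by (auto simp: abs_less_iff)
        then have c2: "c\<^sup>2 < 1" by (simp add: abs_square_less_1)
        define s where "s = sqrt (1 - c\<^sup>2)"
        have s: "0 < s" "c\<^sup>2 + s\<^sup>2 = 1" using c2 by (auto simp: s_def)
        have nn: "norm (Complex c s) = 1" "norm (Complex c (- s)) = 1" using s by (simp_all add: cmod_def)
        have "(c - 1)\<^sup>2 + s\<^sup>2 = \<rho>\<^sup>2" using s(2) by (simp add: c_def power2_eq_square algebra_simps)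
        then have rr: "rad (Complex c s) = \<rho>" "rad (Complex c (- s)) = \<rho>" using \<rho>0 by (simp_all add: cmod_def)
        have "ext (Complex c s) = upper x" "ext (Complex c (- s)) = lower x"
          using ext_right[OF nn(1)] ext_right[OF nn(2)] cusp_param_right(1)[OF nn(1)] cusp_param_right(2)[OF nn(2)] c s rr \<rho> by auto
        then show ?thesis using x(3) nn by (auto intro: rev_image_eqI)
      qed
    qed
  qed
qed

end

section \<open>Finite energy and conclusion\<close>

lemma sum_square_le: "(x + y :: real)\<^sup>2 \<le> 2 * x\<^sup>2 + 2 * y\<^sup>2"
  using zero_le_power2[of "x - y"] by (simp add: power2_eq_square algebra_simps)

lemma measurable_circle_id [measurable]: "(\<lambda>z. z) \<in> borel_measurable circle_arclength"
proof -
  have "(\<lambda>z. z) \<in> borel_measurable (restrict_space borel (sphere 0 1 :: complex set))"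
    by (rule measurable_restrict_space1) simp
  then show ?thesis using measurable_cong_sets[OF sets_circle_arclength refl] by blast
qed

context cusp_extension
begin

lemma modulus_square:
  assumes "0 < \<rho>" "0 < \<sigma>"
  shows "(modulus \<rho> \<sigma>)\<^sup>2 = (K - ln \<rho>) powr (- b) / (\<rho> * sqrt \<rho>) * (1 / sqrt \<sigma>)"
proof -
  have "((K - ln \<rho>) powr (- b / 2))\<^sup>2 = (K - ln \<rho>) powr (- b)"
    by (simp add: power2_eq_square flip: powr_add)
  moreover have "(\<rho> powr (3/4))\<^sup>2 = \<rho> * sqrt \<rho>"
  proof -
    have "(\<rho> powr (3/4))\<^sup>2 = \<rho> powr (1 + 1/2)" by (simp add: power2_eq_square flip: powr_add)
    then show ?thesis using assms by (simp only: powr_add) (simp add: powr_half_sqrt)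
  qed
  moreover have "(\<sigma> powr (1/4))\<^sup>2 = sqrt \<sigma>"
    using assms by (simp add: power2_eq_square powr_half_sqrt flip: powr_add)
  ultimately show ?thesis by (simp add: modulus_def power_divide power_mult_distrib)
qed

lemma b_gt_1: "b > 1"
  using \<beta> by (simp add: b_def)

text \<open>The bound on difference quotients passes to the limit because \<open>modulus\<close> is continuous on the diagonal.\<close>

lemma ext_derivative_bound:
  assumes z: "z \<in> ball 0 1" and d: "ext differentiable (at z)" and v: "norm v = 1"
  shows "norm (frechet_derivative ext (at z) v) \<le> (32 + 4 * \<beta>) * modulus (rad z) (rad z) + 4 * Lc"
proof -
  let ?D = "frechet_derivative ext (at z) v"
  have z1: "z \<noteq> 1" using z by auto
  have pos: "0 < rad z" using z1 by simp
  have L: "1 \<le> K - ln (rad z)" using log_gap_ge_1[OF K pos rad_le_2] z by auto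
  have q: "((\<lambda>s. (ext (z + s *\<^sub>R v) - ext z) /\<^sub>R s) \<longlongrightarrow> ?D) (at 0)"
    using vector_derivative_quotient_tendsto[OF differentiable_line[OF d, of v]] by simp
  have rt: "((\<lambda>s. rad (z + s *\<^sub>R v)) \<longlongrightarrow> rad z) (at 0)"
    by (auto intro!: tendsto_eq_intros)
  have mx: "((\<lambda>s. max (rad (z + s *\<^sub>R v)) (rad z)) \<longlongrightarrow> rad z) (at 0)"
    using tendsto_max[OF rt tendsto_const[of "rad z"]] by simp
  have mn: "((\<lambda>s. min (rad (z + s *\<^sub>R v)) (rad z)) \<longlongrightarrow> rad z) (at 0)"
    using tendsto_min[OF rt tendsto_const[of "rad z"]] by simp
  have "((\<lambda>s. (32 + 4 * \<beta>) * modulus (max (rad (z + s *\<^sub>R v)) (rad z)) (min (rad (z + s *\<^sub>R v)) (rad z)) + 4 * Lc)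
      \<longlongrightarrow> (32 + 4 * \<beta>) * modulus (rad z) (rad z) + 4 * Lc) (at 0)"
    unfolding modulus_def using pos L by (intro tendsto_intros mx mn) auto
  moreover have "\<forall>\<^sub>F s in at 0. norm ((ext (z + s *\<^sub>R v) - ext z) /\<^sub>R s)
      \<le> (32 + 4 * \<beta>) * modulus (max (rad (z + s *\<^sub>R v)) (rad z)) (min (rad (z + s *\<^sub>R v)) (rad z)) + 4 * Lc"
  proof -
    have "open {s::real. z + s *\<^sub>R v \<in> ball 0 1}" by (rule open_line) simp
    then have "\<forall>\<^sub>F s in at 0. s \<in> {s. z + s *\<^sub>R v \<in> ball 0 1} \<and> s \<noteq> 0"
      unfolding eventually_at_filter using z by (auto intro: eventually_mono[OF eventually_nhds_in_open])
    then show ?thesis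
    proof eventually_elim
      case (elim s)
      then have w: "z + s *\<^sub>R v \<in> cball 0 1" "z + s *\<^sub>R v \<noteq> 1" "s \<noteq> 0" by auto
      have "norm (ext (z + s *\<^sub>R v) - ext z) \<le> \<bar>s\<bar> * ((32 + 4 * \<beta>) * modulus (max (rad (z + s *\<^sub>R v)) (rad z)) (min (rad (z + s *\<^sub>R v)) (rad z)) + 4 * Lc)"
        using ext_diff_le[OF w(1) _ w(2) z1] z v by simp
      then show ?case using w(3) by (simp add: divide_simps mult.commute)
    qed
  qed
  ultimately show ?thesis
    by (intro tendsto_le[OF _ _ tendsto_norm[OF q]]) auto
qed

lemma ext_W12: "W12_on (ball 0 1) ext"
proof (rule W12_onI[where S = "{-4/5, 0, 3/5, -(3/5)}" and M = "\<lambda>z. (32 + 4 * \<beta>) * modulus (rad z) (rad z) + 4 * Lc"])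
  let ?C = "32 + 4 * \<beta>"
  show d: "ext differentiable (at z)" if "z \<in> ball 0 1" "Re z \<notin> {-4/5, 0, 3/5, -(3/5)}" "Im z \<notin> {-4/5, 0, 3/5, -(3/5)}" for z
    using that by (intro differentiable_ext) auto
  show "norm (frechet_derivative ext (at z) v) \<le> ?C * modulus (rad z) (rad z) + 4 * Lc"
    if "z \<in> ball 0 1" "Re z \<notin> {-4/5, 0, 3/5, -(3/5)}" "Im z \<notin> {-4/5, 0, 3/5, -(3/5)}" "v \<in> {1, \<i>}" for z v
    using that by (intro ext_derivative_bound d) auto
  define F where "F = (\<lambda>z. ennreal ((K - ln (rad z)) powr (- b) / (rad z)\<^sup>2) * indicator {z. 0 < rad z \<and> rad z \<le> 2} z)"
  have [measurable]: "F \<in> borel_measurable borel" unfolding F_def by measurable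
  have F: "(\<integral>\<^sup>+z. F z \<partial>lborel) < \<infinity>"
    unfolding F_def
    by (rule nn_integral_log_weight_finite[where C = 4]) (use emeasure_lborel_norm_le b_gt_1 K in auto)
  have "(\<integral>\<^sup>+z. indicator (ball 0 1) z * ennreal ((?C * modulus (rad z) (rad z) + 4 * Lc)\<^sup>2) \<partial>lborel)
      \<le> (\<integral>\<^sup>+z. ennreal (2 * ?C\<^sup>2) * F z + ennreal (2 * (4 * Lc)\<^sup>2) * indicator (ball 0 1) z \<partial>lborel)"
  proof (rule nn_integral_mono)
    fix z :: complex
    show "indicator (ball 0 1) z * ennreal ((?C * modulus (rad z) (rad z) + 4 * Lc)\<^sup>2)
        \<le> ennreal (2 * ?C\<^sup>2) * F z + ennreal (2 * (4 * Lc)\<^sup>2) * indicator (ball 0 1) z"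
    proof (cases "z \<in> ball 0 1")
      case True
      then have z: "0 < rad z" "rad z \<le> 2" using rad_le_2[of z] by auto
      have "rad z * sqrt (rad z) * sqrt (rad z) = (rad z)\<^sup>2" using z by (simp add: power2_eq_square mult.assoc)
      then have w2: "(modulus (rad z) (rad z))\<^sup>2 = (K - ln (rad z)) powr (- b) / (rad z)\<^sup>2"
        unfolding modulus_square[OF z(1) z(1)] by simp
      have "(?C * modulus (rad z) (rad z) + 4 * Lc)\<^sup>2 \<le> 2 * (?C * modulus (rad z) (rad z))\<^sup>2 + 2 * (4 * Lc)\<^sup>2"
        by (rule sum_square_le)
      also have "\<dots> = 2 * ?C\<^sup>2 * ((K - ln (rad z)) powr (- b) / (rad z)\<^sup>2) + 2 * (4 * Lc)\<^sup>2"
        by (simp add: power_mult_distrib w2)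
      finally show ?thesis
        using True z by (simp add: F_def flip: ennreal_mult' ennreal_plus)
    qed simp
  qed
  also have "\<dots> = ennreal (2 * ?C\<^sup>2) * (\<integral>\<^sup>+z. F z \<partial>lborel) + ennreal (2 * (4 * Lc)\<^sup>2) * emeasure lborel (ball (0::complex) 1)"
  proof -
    have [measurable]: "ball (0::complex) 1 \<in> sets borel" by simp
    show ?thesis by (subst nn_integral_add) (simp_all add: nn_integral_cmult nn_integral_cmult_indicator)
  qed
  also have "\<dots> < \<infinity>"
    using F emeasure_bounded_finite[of "ball (0::complex) 1"] by (auto simp: ennreal_mult_less_top)
  finally show "(\<integral>\<^sup>+z. indicator (ball 0 1) z * ennreal ((?C * modulus (rad z) (rad z) + 4 * Lc)\<^sup>2) \<partial>lborel) < \<infinity>" .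
qed (use continuous_ext ext_measurable in auto)

text \<open>By symmetry it suffices to integrate the square of \<open>modulus\<close> over pairs in which \<open>w\<close> is closer to \<open>1\<close> than \<open>z\<close>.
The integral over \<open>w\<close> is then of order \<open>L\<^sup>-\<^sup>b / \<rho>\<close> in the distance \<open>\<rho>\<close> from \<open>z\<close> to \<open>1\<close>, which is integrable
along the circle.\<close>

lemma ext_douglas: "douglas_condition ext"
proof -
  let ?C = "32 + 4 * \<beta>" and ?M = circle_arclength
  interpret finite_measure ?M by (rule finite_measure_circle_arclength)
  interpret pair: pair_sigma_finite ?M ?M by unfold_locales
  have [measurable]: "rad \<in> borel_measurable ?M" by measurable
  define F where "F = (\<lambda>\<rho>. (K - ln \<rho>) powr (- b) / (\<rho> * sqrt \<rho>))"
  have [measurable]: "F \<in> borel_measurable borel" unfolding F_def by measurable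
  define N where "N = (\<lambda>z w. ennreal (F (rad z)) * (ennreal (1 / sqrt (rad w)) * indicator {w. 0 < rad w \<and> rad w \<le> rad z} w))"
  have vol: "emeasure ?M {z \<in> space ?M. rad z \<le> \<sigma>} \<le> ennreal (4 * \<sigma>)" if "0 < \<sigma>" for \<sigma>
    using emeasure_circle_arclength_le[OF that] .
  obtain B where B: "B \<ge> 0"
    "\<And>s. s > 0 \<Longrightarrow> (\<integral>\<^sup>+w. ennreal (1 / sqrt (rad w)) * indicator {w. 0 < rad w \<and> rad w \<le> s} w \<partial>?M) \<le> ennreal (B * sqrt s)"
    by (rule nn_integral_inverse_sqrt_le[of rad ?M 4]) (use vol in auto)
  have inner: "(\<integral>\<^sup>+w. N z w \<partial>?M) \<le> ennreal B * (ennreal ((K - ln (rad z)) powr (- b) / rad z ^ 1) * indicator {z. 0 < rad z \<and> rad z \<le> 2} z)"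
    if z: "z \<in> space ?M" for z
  proof (cases "rad z = 0")
    case True
    then have "N z w = 0" for w by (auto simp: N_def indicator_def)
    then show ?thesis by simp
  next
    case False
    then have pos: "0 < rad z" by simp
    have le2: "rad z \<le> 2" using z by (intro rad_le_2) (auto simp: space_circle_arclength)
    have "(\<integral>\<^sup>+w. N z w \<partial>?M) = ennreal (F (rad z)) * (\<integral>\<^sup>+w. ennreal (1 / sqrt (rad w)) * indicator {w. 0 < rad w \<and> rad w \<le> rad z} w \<partial>?M)"
      unfolding N_def by (rule nn_integral_cmult) measurable
    also have "\<dots> \<le> ennreal (F (rad z)) * ennreal (B * sqrt (rad z))"
      by (intro mult_left_mono B pos) auto
    also have "\<dots> = ennreal (B * ((K - ln (rad z)) powr (- b) / rad z ^ 1))"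
      using pos B by (simp add: F_def flip: ennreal_mult')
    also have "\<dots> = ennreal B * ennreal ((K - ln (rad z)) powr (- b) / rad z ^ 1)"
      using B(1) by (rule ennreal_mult')
    finally show ?thesis using pos le2 by simp
  qed
  have wfin: "(\<integral>\<^sup>+z. ennreal ((K - ln (rad z)) powr (- b) / rad z ^ 1) * indicator {z. 0 < rad z \<and> rad z \<le> 2} z \<partial>?M) < \<infinity>"
    by (rule nn_integral_log_weight_finite[where C = 4]) (use vol b_gt_1 K in auto)
  have NN: "(\<integral>\<^sup>+z. \<integral>\<^sup>+w. N z w \<partial>?M \<partial>?M) < \<infinity>"
  proof -
    have "(\<integral>\<^sup>+z. \<integral>\<^sup>+w. N z w \<partial>?M \<partial>?M) \<le> (\<integral>\<^sup>+z. ennreal B * (ennreal ((K - ln (rad z)) powr (- b) / rad z ^ 1) * indicator {z. 0 < rad z \<and> rad z \<le> 2} z) \<partial>?M)"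
      by (intro nn_integral_mono inner)
    also have "\<dots> = ennreal B * (\<integral>\<^sup>+z. ennreal ((K - ln (rad z)) powr (- b) / rad z ^ 1) * indicator {z. 0 < rad z \<and> rad z \<le> 2} z \<partial>?M)"
      by (rule nn_integral_cmult) measurable
    also have "\<dots> < \<infinity>" using wfin by (simp add: ennreal_mult_less_top)
    finally show ?thesis .
  qed
  have Nm [measurable]: "(\<lambda>(z, w). N z w) \<in> borel_measurable (?M \<Otimes>\<^sub>M ?M)"
    unfolding N_def by measurable
  have NN': "(\<integral>\<^sup>+z. \<integral>\<^sup>+w. N w z \<partial>?M \<partial>?M) < \<infinity>"
    using NN pair.Fubini'[of N] Nm by simp
  have null: "emeasure ?M {1} = 0"
  proof -
    have "emeasure ?M {1} \<le> ennreal (4 * \<sigma>)" if "0 < \<sigma>" for \<sigma>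
    proof -
      have "emeasure ?M {1} \<le> emeasure ?M {z \<in> space ?M. rad z \<le> \<sigma>}"
      proof (rule emeasure_mono)
        show "{z \<in> space ?M. rad z \<le> \<sigma>} \<in> sets ?M" by measurable
      qed (use that in \<open>auto simp: space_circle_arclength\<close>)
      then show ?thesis using vol[OF that] by (rule order_trans)
    qed
    note le = this
    obtain x where x: "emeasure ?M {1} = ennreal x" "0 \<le> x" using le[of 1] by (cases "emeasure ?M {1}") auto
    have "x \<le> 4 * (x / 8)" if "0 < x"
    proof -
      have "ennreal x \<le> ennreal (4 * (x / 8))" using le[of "x / 8"] that by (simp only: x(1))
      then show ?thesis using that by (subst (asm) ennreal_le_iff) auto
    qed
    then have "x = 0" using x(2) by (cases "0 < x") auto
    then show ?thesis using x by simp
  qed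
  have AE1: "AE z in ?M. z \<noteq> 1"
    using null by (intro AE_I[where N = "{1}"])
      (auto simp: sets_circle_arclength sets_restrict_space_iff)
  define c1 where "c1 = ennreal (2 * ?C\<^sup>2)"
  define c2 where "c2 = ennreal (2 * (4 * Lc)\<^sup>2)"
  have pointwise: "ennreal ((norm (ext z - ext w))\<^sup>2 / (norm (z - w))\<^sup>2) \<le> c1 * (N z w + N w z) + c2"
    if zw: "z \<in> space ?M" "w \<in> space ?M" "z \<noteq> 1" "w \<noteq> 1" for z w
  proof (cases "z = w")
    case False
    let ?mx = "max (rad z) (rad w)" and ?mn = "min (rad z) (rad w)"
    have n: "norm (z - w) > 0" using False by simp
    have pos: "0 < ?mx" "0 < ?mn" using zw by (auto simp: less_max_iff_disj)
    have "norm (ext z - ext w) \<le> norm (z - w) * (?C * modulus ?mx ?mn + 4 * Lc)"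
      using zw by (intro ext_diff_le) (auto simp: space_circle_arclength)
    then have "(norm (ext z - ext w))\<^sup>2 \<le> (norm (z - w))\<^sup>2 * (?C * modulus ?mx ?mn + 4 * Lc)\<^sup>2"
      unfolding power_mult_distrib[symmetric] by (intro power_mono) auto
    then have "(norm (ext z - ext w))\<^sup>2 / (norm (z - w))\<^sup>2 \<le> (?C * modulus ?mx ?mn + 4 * Lc)\<^sup>2"
      using n by (simp add: divide_le_eq mult.commute)
    also have "\<dots> \<le> 2 * (?C * modulus ?mx ?mn)\<^sup>2 + 2 * (4 * Lc)\<^sup>2" by (rule sum_square_le)
    also have "\<dots> = 2 * ?C\<^sup>2 * (F ?mx * (1 / sqrt ?mn)) + 2 * (4 * Lc)\<^sup>2"
      using modulus_square[OF pos] by (simp add: power_mult_distrib F_def)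
    finally have "ennreal ((norm (ext z - ext w))\<^sup>2 / (norm (z - w))\<^sup>2)
        \<le> ennreal (2 * ?C\<^sup>2 * (F ?mx * (1 / sqrt ?mn)) + 2 * (4 * Lc)\<^sup>2)" by (rule ennreal_leI)
    also have "\<dots> = c1 * ennreal (F ?mx * (1 / sqrt ?mn)) + c2"
      using pos by (simp add: c1_def c2_def F_def flip: ennreal_mult' ennreal_plus)
    also have "\<dots> \<le> c1 * (N z w + N w z) + c2"
    proof (intro add_right_mono mult_left_mono)
      have "0 \<le> F ?mx" using pos by (simp add: F_def)
      then have F_prod: "ennreal (F ?mx * (1 / sqrt ?mn)) = ennreal (F ?mx) * ennreal (1 / sqrt ?mn)"
        by (rule ennreal_mult')
      show "ennreal (F ?mx * (1 / sqrt ?mn)) \<le> N z w + N w z"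
      proof (cases "rad w \<le> rad z")
        case True
        then have m: "?mx = rad z" "?mn = rad w" by simp_all
        have "ennreal (F ?mx * (1 / sqrt ?mn)) = N z w"
          using True pos unfolding F_prod unfolding m by (simp add: N_def)
        then show ?thesis by simp
      next
        case False
        then have m: "?mx = rad w" "?mn = rad z" by simp_all
        have "ennreal (F ?mx * (1 / sqrt ?mn)) = N w z"
          using False pos unfolding F_prod unfolding m by (simp add: N_def)
        then show ?thesis by simp
      qed
    qed auto
    finally show ?thesis .
  qed simp
  have Nz: "N z \<in> borel_measurable ?M" "(\<lambda>w. N w z) \<in> borel_measurable ?M" for z
    unfolding N_def by measurable
  have "(\<integral>\<^sup>+z. (\<integral>\<^sup>+w. ennreal ((norm (ext z - ext w))\<^sup>2 / (norm (z - w))\<^sup>2) \<partial>?M) \<partial>?M)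
      \<le> (\<integral>\<^sup>+z. (\<integral>\<^sup>+w. c1 * (N z w + N w z) + c2 \<partial>?M) \<partial>?M)"
  proof (intro nn_integral_mono_AE)
    show "AE z in ?M. (\<integral>\<^sup>+w. ennreal ((norm (ext z - ext w))\<^sup>2 / (norm (z - w))\<^sup>2) \<partial>?M)
        \<le> (\<integral>\<^sup>+w. c1 * (N z w + N w z) + c2 \<partial>?M)"
      using AE1 AE_space
    proof eventually_elim
      case (elim z)
      show ?case
      proof (intro nn_integral_mono_AE)
        show "AE w in ?M. ennreal ((norm (ext z - ext w))\<^sup>2 / (norm (z - w))\<^sup>2) \<le> c1 * (N z w + N w z) + c2"
          using AE1 AE_space by eventually_elim (use elim pointwise in auto)
      qed
    qed
  qed
  also have "\<dots> = (\<integral>\<^sup>+z. c1 * ((\<integral>\<^sup>+w. N z w \<partial>?M) + (\<integral>\<^sup>+w. N w z \<partial>?M)) + c2 * emeasure ?M (space ?M) \<partial>?M)"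
    using Nz by (simp add: nn_integral_add nn_integral_cmult)
  also have "\<dots> = c1 * ((\<integral>\<^sup>+z. \<integral>\<^sup>+w. N z w \<partial>?M \<partial>?M) + (\<integral>\<^sup>+z. \<integral>\<^sup>+w. N w z \<partial>?M \<partial>?M)) + c2 * emeasure ?M (space ?M) * emeasure ?M (space ?M)"
  proof -
    have "(\<lambda>z. \<integral>\<^sup>+w. N z w \<partial>?M) \<in> borel_measurable ?M" by measurable
    moreover have "(\<lambda>z. \<integral>\<^sup>+w. N w z \<partial>?M) \<in> borel_measurable ?M"
    proof (rule borel_measurable_nn_integral)
      show "(\<lambda>(z, w). N w z) \<in> borel_measurable (?M \<Otimes>\<^sub>M ?M)" unfolding N_def by measurable
    qed
    ultimately show ?thesis by (simp add: nn_integral_add nn_integral_cmult)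
  qed
  also have "\<dots> < \<infinity>"
  proof -
    have "emeasure ?M (space ?M) < top"
      using finite_measure_circle_arclength by (simp add: finite_measure.emeasure_eq_measure)
    then show ?thesis using NN NN' by (simp add: c1_def c2_def ennreal_mult_less_top)
  qed
  finally show ?thesis by (simp add: douglas_condition_def)
qed

lemma ext_no_sobolev_homeomorphism:
  assumes size: "2 * profile K 2 + profile K 2 powr \<beta> < r"
    and h: "homeomorphism (cball 0 1) (closure \<Omega>) h k" "\<And>z. z \<in> sphere 0 1 \<Longrightarrow> h z = ext z"
  shows "\<not> W12_on (ball 0 1) h"
proof
  assume W: "W12_on (ball 0 1) h"
  show False
  proof (rule no_sobolev_extension[OF K _ _ W size])
    show "continuous_on (cball 0 1) h" using h(1) by (rule homeomorphism_cont1)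
    show "h ` cball 0 1 \<subseteq> closure \<Omega>" using homeomorphism_image1[OF h(1)] by simp
    show "h z = upper (profile K (rad z))" if "norm z = 1" "1/2 \<le> Re z" "Im z > 0" for z
      using h(2)[of z] ext_right[of z] cusp_param_right(1)[of z] that by simp
    show "h z = lower (profile K (rad z))" if "norm z = 1" "1/2 \<le> Re z" "Im z < 0" for z
      using h(2)[of z] ext_right[of z] cusp_param_right(2)[of z] that by simp
  qed
qed

end

theorem mainTheorem3:
  fixes \<beta> :: real and \<Omega> :: "complex set"
  assumes "\<beta> > 1"
    and "inward_cusp_domain \<beta> \<Omega>"
  shows "\<exists>\<phi>. (\<exists>\<psi>. homeomorphism (sphere 0 1) (frontier \<Omega>) \<phi> \<psi>) \<and>
     douglas_condition \<phi> \<and>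
     (\<exists>f. continuous_on (cball 0 1) f \<and> (\<forall>z\<in>sphere 0 1. f z = \<phi> z) \<and> W12_on (ball 0 1) f) \<and>
     \<not> (\<exists>h k. homeomorphism (cball 0 1) (closure \<Omega>) h k \<and>
            (\<forall>z\<in>sphere 0 1. h z = \<phi> z) \<and> W12_on (ball 0 1) h)"
proof -
  have jd: "jordan_domain \<Omega>"
    using assms(2) unfolding inward_cusp_domain_def by (rule conjunct1)
  have "\<exists>p\<in>frontier \<Omega>. smooth_curve_except_at (frontier \<Omega>) p \<and>
      (\<exists>u r. norm u = 1 \<and> r > 0 \<and> (- \<Omega>) \<inter> ball p r = ((\<lambda>z. p + u * z) ` cusp_region \<beta>) \<inter> ball p r)"
    using assms(2) unfolding inward_cusp_domain_def by (rule conjunct2)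
  then obtain p u r where p: "p \<in> frontier \<Omega>"
    and sm: "smooth_curve_except_at (frontier \<Omega>) p" and ur: "norm u = 1" "r > 0"
    and cusp: "(- \<Omega>) \<inter> ball p r = ((\<lambda>z. p + u * z) ` cusp_region \<beta>) \<inter> ball p r"
    by (elim bexE exE conjE)
  obtain g where g: "simple_path g" "\<Omega> \<in> components (- path_image g)"
    using jd unfolding jordan_domain_def by auto
  have "closed (path_image g)" using g(1) by (simp add: simple_path_imp_path closed_path_image)
  then have "open \<Omega>" using g(2) open_components[of "- path_image g" \<Omega>] by (simp add: open_Compl)
  then interpret cusp_geometry \<Omega> p u r \<beta>
    using ur assms(1) cusp by unfold_locales
  \<comment> \<open>The constant \<open>K\<close> is chosen so large that the whole tip lies well inside the ball where the boundary is the cusp.\<close>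
  define m where "m = min 1 (r / 4)"
  have m: "0 < m" "m \<le> 1" "m \<le> r / 4" using ur by (auto simp: m_def)
  define K where "K = 2 + 1 / m\<^sup>2"
  have K2: "K \<ge> 2" by (simp add: K_def)
  interpret cusp_map K \<beta> using K2 assms(1) by unfold_locales
  have "1 / m\<^sup>2 \<le> K - ln 2" using ln_le_minus_one[of 2] by (simp add: K_def)
  then have "1 / (K - ln 2) \<le> m\<^sup>2"
    using m log_gap_ge_1[OF K2, of 2] by (simp add: field_simps)
  then have "(profile K 2)\<^sup>2 \<le> m\<^sup>2" using profile_square[OF K2, of 2] by simp
  then have P: "profile K 2 \<le> m" by (rule power2_le_imp_le) (use m in simp)
  have powr_le: "x powr \<beta> \<le> x" if "0 \<le> x" "x \<le> 1" for x
    using powr_mono'[of 1 \<beta> x] assms(1) that by (cases "x = 0") auto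
  have size: "2 * profile K 2 + profile K 2 powr \<beta> < r"
    using P m powr_le[of "profile K 2"] profile_nonneg[of K 2] ur by linarith
  define x1 where "x1 = profile K (norm (Complex (-4/5) (3/5) - 1))"
  have c: "Complex (-4/5) (3/5) \<in> cball 0 1" by (simp add: cmod_def power2_eq_square)
  have "Complex (-4/5) (3/5) - 1 \<noteq> 0" by (simp add: complex_eq_iff)
  then have x1: "0 < x1" "x1 \<le> profile K 2"
    unfolding x1_def using rad_le_2[OF c] K2 by (auto intro!: profile_pos profile_mono)
  have x1r: "x1 + x1 powr \<beta> < r"
    using x1 P m powr_le[of x1] ur by linarith
  have l: "0 < (3/5 :: real)" by simp
  obtain \<Gamma> :: "real \<Rightarrow> complex" and M where \<Gamma>: "M-lipschitz_on {-(3/5)..3/5} \<Gamma>" "inj_on \<Gamma> {-(3/5)..3/5}"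
    "\<Gamma> ` {-(3/5)..3/5} = frontier \<Omega> - tip x1" "\<Gamma> (3/5) = upper x1" "\<Gamma> (-(3/5)) = lower x1"
    "\<And>y. y \<in> {-(3/5)<..<3/5} \<Longrightarrow> \<Gamma> differentiable (at y)"
    by (rule complementary_arc[OF jd p sm x1(1) x1r l]) (rule that; assumption)
  interpret cusp_extension \<Omega> p u r \<beta> K \<Gamma> M x1
    by unfold_locales (use \<Gamma> x1r in \<open>auto simp: x1_def\<close>)
  have "continuous_on (sphere 0 1) ext" using continuous_ext by (rule continuous_on_subset) auto
  then have homeo: "\<exists>\<psi>. homeomorphism (sphere 0 1) (frontier \<Omega>) ext \<psi>"
    using homeomorphism_compact[OF compact_sphere _ ext_onto ext_inj] by blast
  have extension: "\<exists>f. continuous_on (cball 0 1) f \<and> (\<forall>z\<in>sphere 0 1. f z = ext z) \<and> W12_on (ball 0 1) f"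
    using continuous_ext ext_W12 by auto
  have obstruction: "\<not> (\<exists>h k. homeomorphism (cball 0 1) (closure \<Omega>) h k \<and>
      (\<forall>z\<in>sphere 0 1. h z = ext z) \<and> W12_on (ball 0 1) h)"
  proof (intro notI, elim exE conjE)
    fix h k
    assume h: "homeomorphism (cball 0 1) (closure \<Omega>) h k" and eq: "\<forall>z\<in>sphere 0 1. h z = ext z"
      and W: "W12_on (ball 0 1) h"
    have "\<not> W12_on (ball 0 1) h"
      by (rule ext_no_sobolev_homeomorphism[OF size h]) (use eq in simp)
    then show False using W by (rule notE)
  qed
  show ?thesis
    by (rule exI[of _ ext]) (intro conjI homeo ext_douglas extension obstruction)
qed

end
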